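(* Let $K$ be a field, $E$ an elliptic curve over $K$ given by a Weierstrass equation, and $m\geq 4$ an integer coprime to $\mathrm{char}(K)$ when $\mathrm{char}(K)>0$. Let $P_1=(x_1,y_1)$, $P_2=(x_2,y_2)$ be a $\mathbb{Z}/m\mathbb{Z}$-basis of $E[m]$ and $\zeta_m:=e_m(P_1,P_2)$. If $K(E[m])=K(x_1,\zeta_m,y_1,y_2)$, then $K(E[m])=K(x_1,\zeta_m,y_2)$. (In particular, $K(E[m])=K(x_1,\zeta_m,y_2)$ for every odd $m\geq 5$.)
   Context: $E[m]$ is the $m$-torsion subgroup of $E(\overline{K})$; $K(E[m])$ is the field obtained from $K$ by adjoining the coordinates of all points of $E[m]$; $e_m$ is the Weil pairing, so $\zeta_m$ is a primitive $m$-th root of unity.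
   Formalization: For even m the Weierstrass equation is required to have no xy term (a1 = 0, as in y² = x³ + Ax + B), since the claim fails otherwise, e.g. for m = 4 and y² + xy = x³ + x² + x over F_5; for odd m any Weierstrass equation is allowed. *)

theory Defs
  imports
    "HOL-Algebra.Algebraic_Closure_Type"
    "HOL-Algebra.Generated_Fields"
begin

text \<open>
  The equation \<open>y\<^sup>2 + a\<^sub>1 x y + a\<^sub>3 y = x\<^sup>3 + a\<^sub>2 x\<^sup>2 + a\<^sub>4 x + a\<^sub>6\<close>.
  Base change along a field embedding \<open>f\<close> is \<open>map_weierstrass f\<close>.

  For even \<open>m\<close>, whether \<open>y\<^sub>1\<close> can be dropped from the generators of \<open>K(E[m])\<close> depends on the choice of
  the coordinate \<open>y\<close>, and \<open>a\<^sub>1 = 0\<close> (as in \<open>y\<^sup>2 = x\<^sup>3 + A x + B\<close>) has to be required. Counterexample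
  otherwise: \<open>m = 4\<close> and \<open>y\<^sup>2 + x y = x\<^sup>3 + x\<^sup>2 + x\<close> over the field with 5 elements, with basis
  \<open>P\<^sub>1 = (1, i - 3)\<close>, \<open>P\<^sub>2 = (2 + 2 i, 0)\<close>, where \<open>i\<^sup>2 = 2\<close>. No condition is needed for odd \<open>m\<close>.
\<close>
datatype 'k weierstrass =
  Weierstrass (wa1: 'k) (wa2: 'k) (wa3: 'k) (wa4: 'k) (wa6: 'k)

definition discriminant :: "'k::field weierstrass \<Rightarrow> 'k" where
  "discriminant E =
    (let b2 = wa1 E ^ 2 + 4 * wa2 E;
         b4 = 2 * wa4 E + wa1 E * wa3 E;
         b6 = wa3 E ^ 2 + 4 * wa6 E;
         b8 = wa1 E ^ 2 * wa6 E + 4 * wa2 E * wa6 E - wa1 E * wa3 E * wa4 E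
              + wa2 E * wa3 E ^ 2 - wa4 E ^ 2
     in - (b2 ^ 2) * b8 - 8 * b4 ^ 3 - 27 * b6 ^ 2 + 9 * b2 * b4 * b6)"

definition elliptic_curve :: "'k::field weierstrass \<Rightarrow> bool" where
  "elliptic_curve E \<longleftrightarrow> discriminant E \<noteq> 0"


subsection \<open>Points and the chord-tangent group law\<close>

datatype 'k ec_point = Infinity | Affine 'k 'k

definition points :: "'k::field weierstrass \<Rightarrow> 'k ec_point set" where
  "points E = insert Infinity {Affine x y |x y.
     y ^ 2 + wa1 E * x * y + wa3 E * y = x ^ 3 + wa2 E * x ^ 2 + wa4 E * x + wa6 E}"

text \<open>
  In the affine case, \<open>l\<close> is the slope of the chord, or of the tangent if the two points coincide;
  on the curve, equal abscissas and \<open>Q \<noteq> -P\<close> force \<open>Q = P\<close>.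
\<close>
fun ec_add :: "'k::field weierstrass \<Rightarrow> 'k ec_point \<Rightarrow> 'k ec_point \<Rightarrow> 'k ec_point" where
  "ec_add E Infinity Q = Q"
| "ec_add E P Infinity = P"
| "ec_add E (Affine x1 y1) (Affine x2 y2) =
    (if x1 = x2 \<and> y1 + y2 + wa1 E * x2 + wa3 E = 0 then Infinity
     else
       let l = (if x1 = x2
                then (3 * x1 ^ 2 + 2 * wa2 E * x1 + wa4 E - wa1 E * y1)
                     / (2 * y1 + wa1 E * x1 + wa3 E)
                else (y2 - y1) / (x2 - x1));
           x3 = l ^ 2 + wa1 E * l - wa2 E - x1 - x2;
           y3 = - (l + wa1 E) * x3 - (y1 - l * x1) - wa3 E
       in Affine x3 y3)"

definition ec_mult :: "'k::field weierstrass \<Rightarrow> nat \<Rightarrow> 'k ec_point \<Rightarrow> 'k ec_point" where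
  "ec_mult E n P = (ec_add E P ^^ n) Infinity"

definition torsion :: "'k::field weierstrass \<Rightarrow> nat \<Rightarrow> 'k ec_point set" where
  "torsion E m = {P \<in> points E. ec_mult E m P = Infinity}"

definition torsion_basis ::
    "'k::field weierstrass \<Rightarrow> nat \<Rightarrow> 'k ec_point \<Rightarrow> 'k ec_point \<Rightarrow> bool" where
  "torsion_basis E m P Q \<longleftrightarrow> P \<in> torsion E m \<and> Q \<in> torsion E m \<and>
     bij_betw (\<lambda>(a, b). ec_add E (ec_mult E a P) (ec_mult E b Q))
       ({..<m} \<times> {..<m}) (torsion E m)"


subsection \<open>Functions on the curve and their divisors\<close>

text \<open>
  An element of \<open>k[X][Y]\<close> is a polynomial in \<open>Y\<close> whose coefficients are polynomials in \<open>X\<close>. Over an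
  algebraically closed field \<open>k\<close>, the coordinate ring of \<open>E\<close> is \<open>k[X][Y]\<close> modulo \<open>curve_poly E\<close>, and
  a rational function on \<open>E\<close> is a quotient of two elements \<open>F\<close>, \<open>G\<close> with \<open>G\<close> nonzero there.
\<close>
definition curve_poly :: "'k::field weierstrass \<Rightarrow> 'k poly poly" where
  "curve_poly E = [: - [:wa6 E, wa4 E, wa2 E, 1:], [:wa3 E, wa1 E:], 1 :]"

definition eval2 :: "'k::field poly poly \<Rightarrow> 'k \<Rightarrow> 'k \<Rightarrow> 'k" where
  "eval2 F x y = poly (poly F [:y:]) x"

text \<open>
  \<open>F\<close> lies in the \<open>n\<close>-th power of the maximal ideal of the local ring of \<open>E\<close> at \<open>(x, y)\<close>. The
  polynomial \<open>S\<close> clears the denominators of the local ring.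
\<close>
definition vanishes_to_order ::
    "'k::field weierstrass \<Rightarrow> 'k poly poly \<Rightarrow> 'k \<Rightarrow> 'k \<Rightarrow> nat \<Rightarrow> bool" where
  "vanishes_to_order E F x y n \<longleftrightarrow>
    (\<exists>S A. eval2 S x y \<noteq> 0 \<and>
       curve_poly E dvd S * F - (\<Sum>i\<le>n. A i * [:[:- x, 1:]:] ^ i * [:[:- y:], 1:] ^ (n - i)))"

text \<open>
  At infinity \<open>X\<close> and \<open>Y\<close> have poles of order 2 and 3. As \<open>curve_poly E\<close> is monic of degree 2 in \<open>Y\<close>,
  the pseudo-remainder is the representative \<open>a(X) + b(X) Y\<close> of the class of \<open>F\<close>; the pole orders
  of \<open>a(X)\<close> and \<open>b(X) Y\<close> have different parity, so they cannot cancel.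
\<close>
fun ord_at :: "'k::field weierstrass \<Rightarrow> 'k poly poly \<Rightarrow> 'k ec_point \<Rightarrow> int" where
  "ord_at E F (Affine x y) = int (GREATEST n. vanishes_to_order E F x y n)"
| "ord_at E F Infinity =
    (let r = pseudo_mod F (curve_poly E);
         a = Polynomial.coeff r 0;
         b = Polynomial.coeff r 1
     in - int (if b = 0 then 2 * Polynomial.degree a
               else max (2 * Polynomial.degree a) (2 * Polynomial.degree b + 3)))"

text \<open>The rational function \<open>F / G\<close> is nonzero and has divisor \<open>D\<close>.\<close>
definition has_divisor ::
    "'k::field weierstrass \<Rightarrow> 'k poly poly \<Rightarrow> 'k poly poly \<Rightarrow> ('k ec_point \<Rightarrow> int) \<Rightarrow> bool" where
  "has_divisor E F G D \<longleftrightarrow>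
     \<not> curve_poly E dvd F \<and> \<not> curve_poly E dvd G \<and>
     (\<forall>Q\<in>points E. ord_at E F Q - ord_at E G Q = D Q)"


subsection \<open>The Weil pairing\<close>

text \<open>
  The classical definition \<open>e\<^sub>m(S, T) = g(X + S) / g(X)\<close>, where \<open>g = F / G\<close> is a function with divisor
  \<open>[m]\<^sup>*(T) - [m]\<^sup>*(O)\<close> and \<open>X\<close> is any point at which both values are defined and nonzero. For \<open>m\<close>
  prime to the characteristic, \<open>[m]\<close> is unramified, so \<open>[m]\<^sup>*(T)\<close> is the sum of the points \<open>Q\<close> with
  \<open>m Q = T\<close>, each with multiplicity one.
\<close>
definition weil_pairing ::
    "'k::field weierstrass \<Rightarrow> nat \<Rightarrow> 'k ec_point \<Rightarrow> 'k ec_point \<Rightarrow> 'k" where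
  "weil_pairing E m S T =
    (THE z. \<exists>F G x y x' y'.
       has_divisor E F G
         (\<lambda>Q. of_bool (ec_mult E m Q = T) - of_bool (ec_mult E m Q = Infinity)) \<and>
       Affine x y \<in> points E \<and> ec_add E (Affine x y) S = Affine x' y' \<and>
       eval2 F x y \<noteq> 0 \<and> eval2 G x y \<noteq> 0 \<and> eval2 F x' y' \<noteq> 0 \<and> eval2 G x' y' \<noteq> 0 \<and>
       z = (eval2 F x' y' / eval2 G x' y') / (eval2 F x y / eval2 G x y))"


subsection \<open>Fields generated over the base field\<close>

definition adjoin :: "'a::field alg_closure set \<Rightarrow> 'a alg_closure set" where
  "adjoin A = generate_field ring_of_type_algebra (range to_ac \<union> A)"

abbreviation closure_curve :: "'a::field weierstrass \<Rightarrow> 'a alg_closure weierstrass" where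
  "closure_curve E \<equiv> map_weierstrass to_ac E"

definition torsion_field :: "'a::field weierstrass \<Rightarrow> nat \<Rightarrow> 'a alg_closure set" where
  "torsion_field E m =
     adjoin (\<Union>{{x, y} |x y. Affine x y \<in> torsion (closure_curve E) m})"

end

theory Submission
  imports Defs
begin

text \<open>
  A Galois automorphism \<open>\<sigma>\<close> over \<open>L = K(x\<^sub>1, \<zeta>, y\<^sub>2)\<close> maps \<open>P\<^sub>1\<close> to \<open>\<plusminus>P\<^sub>1\<close>; as it fixes \<open>\<zeta> = e\<^sub>m(P\<^sub>1, P\<^sub>2)\<close>, it
  maps \<open>P\<^sub>2\<close> to \<open>a P\<^sub>1 \<plusminus> P\<^sub>2\<close> with the same sign, and it preserves the ordinate of \<open>P\<^sub>2\<close>. For odd \<open>m\<close> and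
  positive sign, \<open>P\<^sub>2\<close>, \<open>\<sigma> P\<^sub>2\<close>, \<open>\<sigma>\<^sup>2 P\<^sub>2\<close> lie on a horizontal line; if they were distinct their sum
  \<open>3 P\<^sub>2 + 3 a P\<^sub>1\<close> would vanish. With negative sign, \<open>\<sigma>\<^sup>2\<close> fixes \<open>P\<^sub>2\<close>, so \<open>2 a = 0\<close> modulo
  \<open>m\<close>; then either \<open>\<sigma> P\<^sub>2 = - P\<^sub>2\<close>, or the horizontal line through \<open>P\<^sub>2\<close> and \<open>\<sigma> P\<^sub>2\<close> passes through a point of
  order 2, and both force \<open>2 P\<^sub>2 = O\<close>. The possible inseparability of \<open>x\<^sub>2\<close> over \<open>L\<close> is excluded
  by looking at the tangent at \<open>P\<^sub>2\<close>.

  The group law and the Weil pairing are obtained from divisors: orders of functions at points satisfy the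
  degree formula (through norms to \<open>k[x]\<close>), a function without poles is constant, and \<open>P \<mapsto> (P) - (O)\<close> is
  injective on divisor classes, which gives associativity. A nontrivial point \<open>T\<close> in the radical of the
  pairing would yield a function of degree \<open>m\<^sup>2\<close> identifying \<open>E / E[m]\<close> with the projective line, on which
  a translation would act without fixed points.
\<close>

text \<open>For even \<open>m\<close> the argument with three points on a line is replaced by the
  hypothesis on generators: an automorphism over K(x_1, zeta, y_2) that fixes y_1 also fixes x_2,
  and this is applied to the square of \<sigma>, which fixes P_1 for either sign. There remains a
  point A of order dividing 2 with P_2 + \<sigma> P_2 = A. If the two points differ, -A is the third
  point on their horizontal line, so A = -A has the ordinate of P_2. The condition 2 P = O reads 2 y
  + a_1 x + a_3 = 0; with a_1 = 0 it sees only the ordinate and passes from A to P_2. The bound on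
  \<open>m\<close> excludes both 2 P_2 = O and 3 P_2 = O.

  Invariance under automorphisms gives membership in the base field only up to inseparability. For
  y_1 the obstacle is removed by the quadratic equation over x_1, whose derivative is nonzero since
  2 P_1 is not O; for zeta by T^m - 1, which is where the characteristic enters; for x_2 by the
  tangent.

  Functions are total maps compared outside finitely many points, so poles carry arbitrary values
  and pulling back along a translation is plain composition.\<close>

primrec px :: "'k::zero ec_point \<Rightarrow> 'k" where
  "px Infinity = 0"
| "px (Affine x y) = x"

primrec py :: "'k::zero ec_point \<Rightarrow> 'k" where
  "py Infinity = 0"
| "py (Affine x y) = y"

text \<open>As in Euclid's argument: the product of all \<open>X - a\<close> vanishes everywhere, so
  adding 1 gives a nonconstant polynomial without a root.\<close>

lemma alg_closed_infinite: "infinite (UNIV :: 'k::alg_closed_field set)"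
proof
  assume fin: "finite (UNIV :: 'k set)"
  define p :: "'k poly" where "p = (\<Prod>a\<in>UNIV. [:-a, 1:]) + 1"
  have "Polynomial.degree (\<Prod>a\<in>(UNIV::'k set). [:-a, 1:]) = card (UNIV :: 'k set)"
    by (subst degree_prod_eq_sum_degree) auto
  moreover have "card (UNIV :: 'k set) > 0"
    using fin by (simp add: card_gt_0_iff)
  ultimately have "Polynomial.degree p > 0"
    unfolding p_def by (subst degree_add_eq_left) auto
  then obtain x where "poly p x = 0"
    using alg_closed_imp_poly_has_root by blast
  moreover have "poly p x = 1"
    using fin by (simp add: p_def poly_prod)
  ultimately show False by simp
qed

lemma poly_eqI_infinite:
  fixes p q :: "'k::alg_closed_field poly"
  assumes "\<And>x. poly p x = poly q x"
  shows "p = q"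
proof (rule ccontr)
  assume "p \<noteq> q"
  then have "finite {x. poly (p - q) x = 0}"
    by (intro poly_roots_finite) auto
  then show False
    using assms alg_closed_infinite[where 'k = 'k] by simp
qed

section \<open>Points of the curve, negation and smoothness\<close>

locale ell =
  fixes E :: "'k::alg_closed_field weierstrass"
  assumes nonsing: "discriminant E \<noteq> 0"
begin

abbreviation "a1 \<equiv> wa1 E"
abbreviation "a2 \<equiv> wa2 E"
abbreviation "a3 \<equiv> wa3 E"
abbreviation "a4 \<equiv> wa4 E"
abbreviation "a6 \<equiv> wa6 E"

definition curve :: "'k \<Rightarrow> 'k \<Rightarrow> bool" where
  "curve x y \<longleftrightarrow> y ^ 2 + a1 * x * y + a3 * y = x ^ 3 + a2 * x ^ 2 + a4 * x + a6"

definition aff :: "'k ec_point set" where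
  "aff = {Affine x y |x y. curve x y}"

lemma points_eq: "points E = insert Infinity aff"
  by (auto simp: points_def aff_def curve_def)

lemma Affine_in_aff [simp]: "Affine x y \<in> aff \<longleftrightarrow> curve x y"
  by (auto simp: aff_def)

lemma Infinity_notin_aff [simp]: "Infinity \<notin> aff"
  by (auto simp: aff_def)

lemma affE:
  assumes "P \<in> aff"
  obtains x y where "P = Affine x y" "curve x y"
  using assms by (auto simp: aff_def)

lemma aff_eqI: "P \<in> aff \<Longrightarrow> Q \<in> aff \<Longrightarrow> px P = px Q \<Longrightarrow> py P = py Q \<Longrightarrow> P = Q"
  by (auto elim!: affE)

definition neg :: "'k ec_point \<Rightarrow> 'k ec_point" where
  "neg P = (case P of Infinity \<Rightarrow> Infinity | Affine x y \<Rightarrow> Affine x (- y - a1 * x - a3))"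

lemma neg_simps [simp]:
  "neg Infinity = Infinity"
  "neg (Affine x y) = Affine x (- y - a1 * x - a3)"
  by (simp_all add: neg_def)

lemma neg_neg [simp]: "neg (neg P) = P"
  by (cases P) simp_all

lemma curve_neg: "curve x y \<Longrightarrow> curve x (- y - a1 * x - a3)"
  unfolding curve_def by Groebner_Basis.algebra

lemma neg_aff [simp]: "neg P \<in> aff \<longleftrightarrow> P \<in> aff"
  using curve_neg[of "px P" "py P"] curve_neg[of "px (neg P)" "py (neg P)"]
  by (cases P) auto

lemma px_neg [simp]: "px (neg P) = px P"
  by (cases P) simp_all

lemma py_neg: "P \<in> aff \<Longrightarrow> py (neg P) = - py P - a1 * px P - a3"
  by (auto elim!: affE)

lemma curve_eqn:
  "P \<in> aff \<Longrightarrow> py P ^ 2 + a1 * px P * py P + a3 * py P = px P ^ 3 + a2 * px P ^ 2 + a4 * px P + a6"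
  by (auto elim!: affE simp: curve_def)

text \<open>For a fixed abscissa the equation is quadratic in y, with the ordinates of P and -P as
  its two roots.\<close>

lemma same_px:
  assumes "P \<in> aff" "Q \<in> aff" "px P = px Q"
  shows "Q = P \<or> Q = neg P"
proof -
  obtain x y y' where P: "P = Affine x y" and Q: "Q = Affine x y'"
    using assms by (auto elim!: affE)
  have "(y' - y) * (y' - (- y - a1 * x - a3)) = 0"
    using curve_eqn[OF assms(1)] curve_eqn[OF assms(2)] unfolding P Q px.simps py.simps by Groebner_Basis.algebra
  then show ?thesis
    by (auto simp: P Q)
qed

text \<open>The partial derivatives of the curve equation, the first one with its sign reversed.\<close>
definition dx :: "'k ec_point \<Rightarrow> 'k" where
  "dx P = 3 * px P ^ 2 + 2 * a2 * px P + a4 - a1 * py P"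

definition dy :: "'k ec_point \<Rightarrow> 'k" where
  "dy P = 2 * py P + a1 * px P + a3"

text \<open>At a singular point the two partial derivatives and the equation express
  \<open>a3\<close>, \<open>a4\<close> and \<open>a6\<close> through \<open>x\<close>,
  \<open>y\<close>, \<open>a1\<close> and \<open>a2\<close> without division. After substitution the
  discriminant vanishes identically, in every characteristic.\<close>

lemma smooth:
  assumes P: "P \<in> aff" and 0: "dy P = 0"
  shows "dx P \<noteq> 0"
proof
  assume 1: "dx P = 0"
  obtain x y where xy: "P = Affine x y"
    using P by (auto elim: affE)
  have h3: "a3 = - 2 * y - a1 * x"
    using 0 by (simp add: dy_def xy algebra_simps eq_neg_iff_add_eq_0)
  have h4: "a4 = a1 * y - 3 * x ^ 2 - 2 * a2 * x"
    using 1 unfolding dx_def xy px.simps py.simps by Groebner_Basis.algebra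
  have h6: "a6 = y ^ 2 + a1 * x * y + a3 * y - x ^ 3 - a2 * x ^ 2 - a4 * x"
    using curve_eqn[OF P] unfolding xy px.simps py.simps by Groebner_Basis.algebra
  have "discriminant E = 0"
    unfolding discriminant_def Let_def h6 h4 h3 by Groebner_Basis.algebra
  then show False
    using nonsing by simp
qed

lemma neg_eq_iff: "P \<in> aff \<Longrightarrow> neg P = P \<longleftrightarrow> dy P = 0"
  by (auto elim!: affE simp: dy_def algebra_simps eq_neg_iff_add_eq_0 neg_eq_iff_add_eq_0)

lemma point_over: "\<exists>P\<in>aff. px P = x"
proof -
  define p :: "'k poly" where "p = [:- (x ^ 3 + a2 * x ^ 2 + a4 * x + a6), a1 * x + a3, 1:]"
  have "Polynomial.degree p > 0"
    by (simp add: p_def)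
  then obtain y where "poly p y = 0"
    using alg_closed_imp_poly_has_root by blast
  then have "curve x y"
    unfolding curve_def p_def by (simp add: algebra_simps power2_eq_square power3_eq_cube)
  then show ?thesis
    by (intro bexI[of _ "Affine x y"]) auto
qed

lemma finite_fibre: "finite {P \<in> aff. px P = x}"
proof -
  obtain Q where Q: "Q \<in> aff" "px Q = x"
    using point_over by blast
  have "{P \<in> aff. px P = x} \<subseteq> {Q, neg Q}"
    using same_px[OF Q(1)] Q(2) by fastforce
  then show ?thesis
    by (rule finite_subset) simp
qed

lemma finite_px_in:
  assumes "finite A"
  shows "finite {P \<in> aff. px P \<in> A}"
proof -
  have "{P \<in> aff. px P \<in> A} = (\<Union>x\<in>A. {P \<in> aff. px P = x})"
    by auto
  then show ?thesis
    using assms finite_fibre by simp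
qed

lemma infinite_aff: "infinite aff"
proof
  assume "finite aff"
  then have "finite (px ` aff)" by simp
  moreover have "px ` aff = UNIV"
    using point_over by (metis UNIV_eq_I image_eqI)
  ultimately show False
    using alg_closed_infinite[where 'k = 'k] by simp
qed

text \<open>Functions are compared up to finitely many points, so values at poles and at infinity are irrelevant.\<close>
definition cof :: "'k ec_point filter" where
  "cof = inf cofinite (principal aff)"

lemma eventually_cof: "eventually Q cof \<longleftrightarrow> finite {P \<in> aff. \<not> Q P}"
  unfolding cof_def eventually_inf_principal eventually_cofinite by (simp add: conj_commute)

lemma cof_aff: "\<forall>\<^sub>F P in cof. P \<in> aff"
  by (simp add: eventually_cof)

lemma cof_ne_bot: "cof \<noteq> bot"
  using infinite_aff by (simp add: trivial_limit_def eventually_cof)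

lemma cof_ex:
  assumes "eventually Q cof"
  obtains P where "P \<in> aff" "Q P"
proof -
  have "\<forall>\<^sub>F P in cof. P \<in> aff \<and> Q P"
    using assms cof_aff by eventually_elim simp
  then show thesis
    using cof_ne_bot eventually_happens' that by blast
qed

lemma cof_const: "(\<forall>\<^sub>F P in cof. c) \<longleftrightarrow> c"
  using cof_ne_bot by simp

lemma cof_neq: "\<forall>\<^sub>F P in cof. P \<noteq> Q"
  unfolding eventually_cof by (rule finite_subset[of _ "{Q}"]) auto

lemma cof_px_neq: "\<forall>\<^sub>F P in cof. px P \<noteq> c"
  unfolding eventually_cof using finite_fibre by simp

subsection \<open>Regular functions\<close>

definition lin :: "'k poly \<Rightarrow> 'k poly \<Rightarrow> 'k ec_point \<Rightarrow> 'k" where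
  "lin a b P = poly a (px P) + poly b (px P) * py P"

definition cub :: "'k poly" where "cub = [:a6, a4, a2, 1:]"

definition tr :: "'k poly" where "tr = [:a3, a1:]"

text \<open>The norm of \<open>a(x) + b(x) y\<close> to \<open>k[x]\<close>.\<close>
definition nrm :: "'k poly \<Rightarrow> 'k poly \<Rightarrow> 'k poly" where
  "nrm a b = a ^ 2 - a * b * tr - b ^ 2 * cub"

lemma poly_cub: "poly cub x = x ^ 3 + a2 * x ^ 2 + a4 * x + a6"
  by (simp add: cub_def algebra_simps power2_eq_square power3_eq_cube)

lemma poly_tr: "poly tr x = a1 * x + a3"
  by (simp add: tr_def algebra_simps)

text \<open>\<open>neg\<close> induces the conjugation of the quadratic extension k(x, y) / k(x), so
  the norm of a function is its product with its conjugate.\<close>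

lemma nrm_eval:
  assumes "P \<in> aff"
  shows "poly (nrm a b) (px P) = lin a b P * lin a b (neg P)"
  using curve_eqn[OF assms]
  unfolding nrm_def lin_def py_neg[OF assms] px_neg poly_diff poly_mult poly_power poly_cub poly_tr
  by Groebner_Basis.algebra

text \<open>Minus the order of \<open>a(x) + b(x) y\<close> at infinity; it is the degree of the norm.\<close>
definition dg :: "'k poly \<Rightarrow> 'k poly \<Rightarrow> nat" where
  "dg a b = (if b = 0 then 2 * Polynomial.degree a
             else max (2 * Polynomial.degree a) (2 * Polynomial.degree b + 3))"

lemma cub_nz: "cub \<noteq> 0" "Polynomial.degree cub = 3"
  by (simp_all add: cub_def)

text \<open>The terms \<open>a ^ 2\<close> and \<open>b ^ 2 * cub\<close> have even and odd degree
  and cannot cancel; the mixed term stays below the larger of them. The two outer terms are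
  separated by whether \<open>degree a\<close> is at least \<open>degree b + 2\<close>.\<close>

lemma nrm_degree:
  assumes "a \<noteq> 0 \<or> b \<noteq> 0"
  shows "nrm a b \<noteq> 0" "Polynomial.degree (nrm a b) = dg a b"
proof -
  let ?d = "Polynomial.degree"
  have "nrm a b \<noteq> 0 \<and> ?d (nrm a b) = dg a b"
  proof (cases "b = 0")
    case True
    then show ?thesis
      using assms by (simp add: nrm_def dg_def degree_power_eq)
  next
    case b: False
    have B: "?d (b ^ 2 * cub) = 2 * ?d b + 3"
      using b cub_nz by (simp add: degree_mult_eq degree_power_eq)
    show ?thesis
    proof (cases "a = 0")
      case True
      then show ?thesis
        using b B cub_nz by (simp add: nrm_def dg_def)
    next
      case a: False
      have A: "?d (a ^ 2) = 2 * ?d a"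
        using a by (simp add: degree_power_eq)
      have "?d (a * b * tr) \<le> ?d (a * b) + ?d tr"
        by (rule degree_mult_le)
      also have "\<dots> \<le> ?d a + ?d b + 1"
        using a b by (auto simp: degree_mult_eq tr_def)
      finally have T: "?d (a * b * tr) \<le> ?d a + ?d b + 1" .
      show ?thesis
      proof (cases "?d a \<ge> ?d b + 2")
        case True
        have "?d (a * b * tr + b ^ 2 * cub) \<le> max (?d (a * b * tr)) (?d (b ^ 2 * cub))"
          by (rule degree_add_le_max)
        also have "\<dots> < 2 * ?d a"
          using True T B by simp
        finally have *: "?d (a * b * tr + b ^ 2 * cub) < ?d (a ^ 2)"
          using A by simp
        have "nrm a b = a ^ 2 + - (a * b * tr + b ^ 2 * cub)"
          by (simp add: nrm_def)
        then have "?d (nrm a b) = ?d (a ^ 2)"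
          using * by (metis degree_add_eq_left degree_minus)
        then show ?thesis
          using True A b by (auto simp: dg_def max_def)
      next
        case False
        have "?d (a ^ 2 - a * b * tr) \<le> max (?d (a ^ 2)) (?d (a * b * tr))"
          by (rule degree_diff_le_max)
        also have "\<dots> < 2 * ?d b + 3"
          using False T A by simp
        finally have *: "?d (a ^ 2 - a * b * tr) < ?d (- (b ^ 2 * cub))"
          using B by simp
        have "nrm a b = (a ^ 2 - a * b * tr) + - (b ^ 2 * cub)"
          by (simp add: nrm_def)
        then have "?d (nrm a b) = ?d (- (b ^ 2 * cub))"
          using * by (metis degree_add_eq_right)
        then show ?thesis
          using False B b by (auto simp: dg_def max_def)
      qed
    qed
  qed
  then show "nrm a b \<noteq> 0" "?d (nrm a b) = dg a b"
    by auto
qed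

lemma nrm_eq_0_iff: "nrm a b = 0 \<longleftrightarrow> a = 0 \<and> b = 0"
  using nrm_degree(1)[of a b] by (auto simp: nrm_def)

lemma lin_cof_nz:
  assumes "a \<noteq> 0 \<or> b \<noteq> 0"
  shows "\<forall>\<^sub>F P in cof. lin a b P \<noteq> 0"
proof -
  have "finite {x. poly (nrm a b) x = 0}"
    using nrm_degree(1)[OF assms] by (rule poly_roots_finite)
  then have "finite {P \<in> aff. px P \<in> {x. poly (nrm a b) x = 0}}"
    by (rule finite_px_in)
  moreover have "{P \<in> aff. lin a b P = 0} \<subseteq> {P \<in> aff. px P \<in> {x. poly (nrm a b) x = 0}}"
    using nrm_eval by auto
  ultimately show ?thesis
    by (auto simp: eventually_cof intro: finite_subset)
qed

definition reg :: "('k ec_point \<Rightarrow> 'k) \<Rightarrow> bool" where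
  "reg f \<longleftrightarrow> (\<exists>a b. \<forall>P\<in>aff. f P = lin a b P)"

lemma reg_lin [simp]: "reg (lin a b)"
  by (auto simp: reg_def)

lemma reg_poly [simp]: "reg (\<lambda>P. poly a (px P))"
  unfolding reg_def by (intro exI[of _ a] exI[of _ 0]) (simp add: lin_def)

lemma reg_const [simp]: "reg (\<lambda>P. c)"
  using reg_poly[of "[:c:]"] by simp

lemma reg_px [simp]: "reg px"
  using reg_poly[of "[:0, 1:]"] by simp

lemma reg_py [simp]: "reg py"
  unfolding reg_def by (intro exI[of _ 0] exI[of _ 1]) (simp add: lin_def)

lemma reg_add [simp]: "reg f \<Longrightarrow> reg g \<Longrightarrow> reg (\<lambda>P. f P + g P)"
  unfolding reg_def
proof (elim exE)
  fix a b c d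
  assume "\<forall>P\<in>aff. f P = lin a b P" "\<forall>P\<in>aff. g P = lin c d P"
  then show "\<exists>a b. \<forall>P\<in>aff. f P + g P = lin a b P"
    by (intro exI[of _ "a + c"] exI[of _ "b + d"]) (simp add: lin_def algebra_simps)
qed

lemma lin_mult:
  assumes "P \<in> aff"
  shows "lin a b P * lin c d P = lin (a * c + b * d * cub) (a * d + b * c - b * d * tr) P"
  using curve_eqn[OF assms]
  unfolding lin_def poly_add poly_diff poly_mult poly_cub poly_tr by Groebner_Basis.algebra

lemma reg_mult [simp]: "reg f \<Longrightarrow> reg g \<Longrightarrow> reg (\<lambda>P. f P * g P)"
  unfolding reg_def using lin_mult by (metis (no_types, lifting))

lemma reg_uminus [simp]: "reg f \<Longrightarrow> reg (\<lambda>P. - f P)"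
  using reg_mult[OF reg_const[of "-1"], of f] by simp

lemma reg_diff [simp]: "reg f \<Longrightarrow> reg g \<Longrightarrow> reg (\<lambda>P. f P - g P)"
  using reg_add[OF _ reg_uminus, of f g] by simp

lemma reg_power [simp]: "reg f \<Longrightarrow> reg (\<lambda>P. f P ^ n)"
  by (induction n) simp_all

lemma reg_neg [simp]:
  assumes "reg f"
  shows "reg (\<lambda>P. f (neg P))"
proof -
  obtain a b where ab: "\<And>P. P \<in> aff \<Longrightarrow> f P = lin a b P"
    using assms by (auto simp: reg_def)
  have "f (neg P) = lin (a - b * tr) (- b) P" if "P \<in> aff" for P
    using ab[of "neg P"] that by (simp add: lin_def py_neg poly_tr algebra_simps)
  then show ?thesis
    unfolding reg_def by blast
qed

text \<open>Identity principle: zeros of \<open>lin a b\<close> project to roots of its norm, which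
  is a nonzero polynomial unless \<open>a\<close> and \<open>b\<close> both vanish.\<close>

lemma reg_cases:
  assumes "reg f"
  shows "(\<forall>P\<in>aff. f P = 0) \<or> (\<forall>\<^sub>F P in cof. f P \<noteq> 0)"
proof -
  obtain a b where ab: "\<And>P. P \<in> aff \<Longrightarrow> f P = lin a b P"
    using assms by (auto simp: reg_def)
  show ?thesis
  proof (cases "a = 0 \<and> b = 0")
    case True
    then show ?thesis
      using ab by (simp add: lin_def)
  next
    case False
    then have "\<forall>\<^sub>F P in cof. lin a b P \<noteq> 0"
      by (intro lin_cof_nz) auto
    with cof_aff have "\<forall>\<^sub>F P in cof. f P \<noteq> 0"
      by eventually_elim (simp add: ab)
    then show ?thesis ..
  qed
qed

text \<open>Allows an identity known outside finitely many points to be evaluated at an excluded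
  one, in particular at the point P where \<open>unif P\<close> vanishes.\<close>

lemma reg_eq:
  assumes "reg f" "reg g" "\<forall>\<^sub>F P in cof. f P = g P" "P \<in> aff"
  shows "f P = g P"
proof -
  have "\<not> (\<forall>\<^sub>F P in cof. f P - g P \<noteq> 0)"
  proof
    assume "\<forall>\<^sub>F P in cof. f P - g P \<noteq> 0"
    with assms(3) have "\<forall>\<^sub>F P in cof. False"
      by eventually_elim simp
    then show False
      using cof_ne_bot by simp
  qed
  then show ?thesis
    using reg_cases[of "\<lambda>P. f P - g P"] assms by auto
qed

subsection \<open>Rational functions\<close>

definition nz :: "('k ec_point \<Rightarrow> 'k) \<Rightarrow> bool" where
  "nz f \<longleftrightarrow> (\<forall>\<^sub>F P in cof. f P \<noteq> 0)"

definition rat :: "('k ec_point \<Rightarrow> 'k) \<Rightarrow> bool" where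
  "rat f \<longleftrightarrow> (\<exists>F G. reg F \<and> reg G \<and> nz G \<and> (\<forall>\<^sub>F P in cof. f P = F P / G P))"

lemma nz_mult: "nz f \<Longrightarrow> nz g \<Longrightarrow> nz (\<lambda>P. f P * g P)"
  unfolding nz_def by (erule (1) eventually_elim2) simp

lemma nz_const [simp]: "nz (\<lambda>P. c) \<longleftrightarrow> c \<noteq> 0"
  unfolding nz_def by (rule cof_const)

lemma nz_px_diff [simp]: "nz (\<lambda>P. px P - c)"
  using cof_px_neq[of c] by (simp add: nz_def)

lemma reg_imp_rat [simp]: "reg f \<Longrightarrow> rat f"
  unfolding rat_def by (intro exI[of _ f] exI[of _ "\<lambda>P. 1"]) simp

lemma rat_cong: "rat f \<Longrightarrow> \<forall>\<^sub>F P in cof. g P = f P \<Longrightarrow> rat g"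
  unfolding rat_def by (elim exE conjE, intro exI conjI, assumption+) (erule (1) eventually_elim2, simp)

lemma rat_add [simp]:
  assumes "rat f" "rat g"
  shows "rat (\<lambda>P. f P + g P)"
proof -
  from assms obtain F G F' G' where *: "reg F" "reg G" "nz G" "\<forall>\<^sub>F P in cof. f P = F P / G P"
      "reg F'" "reg G'" "nz G'" "\<forall>\<^sub>F P in cof. g P = F' P / G' P"
    unfolding rat_def by blast
  have "\<forall>\<^sub>F P in cof. f P + g P = (F P * G' P + F' P * G P) / (G P * G' P)"
    using *(4,8) *(3,7)[unfolded nz_def] by eventually_elim (simp add: field_simps)
  moreover have "nz (\<lambda>P. G P * G' P)"
    using * nz_mult by blast
  ultimately show ?thesis
    unfolding rat_def using *
    by (intro exI[of _ "\<lambda>P. F P * G' P + F' P * G P"] exI[of _ "\<lambda>P. G P * G' P"]) simp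
qed

lemma rat_mult [simp]:
  assumes "rat f" "rat g"
  shows "rat (\<lambda>P. f P * g P)"
proof -
  from assms obtain F G F' G' where *: "reg F" "reg G" "nz G" "\<forall>\<^sub>F P in cof. f P = F P / G P"
      "reg F'" "reg G'" "nz G'" "\<forall>\<^sub>F P in cof. g P = F' P / G' P"
    unfolding rat_def by blast
  have "\<forall>\<^sub>F P in cof. f P * g P = (F P * F' P) / (G P * G' P)"
    using *(4,8) by eventually_elim simp
  moreover have "nz (\<lambda>P. G P * G' P)"
    using * nz_mult by blast
  ultimately show ?thesis
    unfolding rat_def using *
    by (intro exI[of _ "\<lambda>P. F P * F' P"] exI[of _ "\<lambda>P. G P * G' P"]) simp
qed

lemma rat_const [simp]: "rat (\<lambda>P. c)"
  by simp

lemma rat_uminus [simp]: "rat f \<Longrightarrow> rat (\<lambda>P. - f P)"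
  using rat_mult[of "\<lambda>P. -1" f] by simp

lemma rat_diff [simp]: "rat f \<Longrightarrow> rat g \<Longrightarrow> rat (\<lambda>P. f P - g P)"
  using rat_add[OF _ rat_uminus, of f g] by simp

lemma rat_power [simp]: "rat f \<Longrightarrow> rat (\<lambda>P. f P ^ n)"
  by (induction n) simp_all

lemma rat_cases:
  assumes "rat f"
  shows "(\<forall>\<^sub>F P in cof. f P = 0) \<or> nz f"
proof -
  from assms obtain F G where *: "reg F" "reg G" "nz G" "\<forall>\<^sub>F P in cof. f P = F P / G P"
    unfolding rat_def by blast
  from reg_cases[OF *(1)] show ?thesis
  proof
    assume "\<forall>P\<in>aff. F P = 0"
    with *(4) cof_aff have "\<forall>\<^sub>F P in cof. f P = 0"
      by (auto elim: eventually_elim2)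
    then show ?thesis ..
  next
    assume "\<forall>\<^sub>F P in cof. F P \<noteq> 0"
    with *(4) *(3)[unfolded nz_def] have "\<forall>\<^sub>F P in cof. f P \<noteq> 0"
      by eventually_elim simp
    then show ?thesis
      by (simp add: nz_def)
  qed
qed

lemma rat_inverse [simp]:
  assumes "rat f"
  shows "rat (\<lambda>P. inverse (f P))"
proof -
  from assms obtain F G where *: "reg F" "reg G" "nz G" "\<forall>\<^sub>F P in cof. f P = F P / G P"
    unfolding rat_def by blast
  from reg_cases[OF *(1)] show ?thesis
  proof
    assume "\<forall>P\<in>aff. F P = 0"
    with *(4) cof_aff have "\<forall>\<^sub>F P in cof. inverse (f P) = 0"
      by (auto elim: eventually_elim2)
    then show ?thesis
      by (rule rat_cong[OF rat_const])
  next
    assume "\<forall>\<^sub>F P in cof. F P \<noteq> 0"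
    then have "nz F" by (simp add: nz_def)
    moreover have "\<forall>\<^sub>F P in cof. inverse (f P) = G P / F P"
      using *(4) by eventually_elim simp
    ultimately show ?thesis
      unfolding rat_def using * by blast
  qed
qed

lemma rat_divide [simp]: "rat f \<Longrightarrow> rat g \<Longrightarrow> rat (\<lambda>P. f P / g P)"
  unfolding divide_inverse by simp

subsection \<open>Orders at points\<close>

text \<open>A uniformizer at P. The function x - x_P fails to be one exactly at the ramification
  points of x, where \<open>dy P = 0\<close>; there smoothness gives \<open>dx P \<noteq> 0\<close>
  and y - y_P takes its place.\<close>

definition unif :: "'k ec_point \<Rightarrow> 'k ec_point \<Rightarrow> 'k" where
  "unif P Z = (if dy P \<noteq> 0 then px Z - px P else py Z - py P)"

lemma unif_self [simp]: "unif P P = 0"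
  by (simp add: unif_def)

lemma reg_unif [simp]: "reg (unif P)"
  unfolding unif_def by (cases "dy P = 0") simp_all

lemma nz_py_diff: "nz (\<lambda>Z. py Z - c)"
proof -
  have "\<forall>\<^sub>F Z in cof. lin [:-c:] 1 Z \<noteq> 0"
    by (rule lin_cof_nz) simp
  then show ?thesis
    by (simp add: nz_def lin_def algebra_simps)
qed

lemma nz_unif [simp]: "nz (unif P)"
  using nz_px_diff[of "px P"] nz_py_diff[of "py P"] unfolding unif_def by (cases "dy P = 0") simp_all

text \<open>The curve equation, minus its value at \<open>P\<close>, splits as \<open>(y - y\<^sub>P) \<alpha> - (x - x\<^sub>P) \<beta>\<close>.\<close>
definition alpha :: "'k ec_point \<Rightarrow> 'k ec_point \<Rightarrow> 'k" where
  "alpha P Z = py Z + py P + a1 * px Z + a3"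

definition beta :: "'k ec_point \<Rightarrow> 'k ec_point \<Rightarrow> 'k" where
  "beta P Z = px Z ^ 2 + px Z * px P + px P ^ 2 + a2 * (px Z + px P) + a4 - a1 * py P"

lemma alpha_beta:
  assumes "P \<in> aff" "Z \<in> aff"
  shows "(py Z - py P) * alpha P Z = (px Z - px P) * beta P Z"
  using curve_eqn[OF assms(1)] curve_eqn[OF assms(2)] unfolding alpha_def beta_def
  by Groebner_Basis.algebra

lemma alpha_self: "alpha P P = dy P"
  by (simp add: alpha_def dy_def)

lemma beta_self: "beta P P = dx P"
  by (simp add: beta_def dx_def power2_eq_square algebra_simps)

lemma reg_alpha [simp]: "reg (alpha P)"
  unfolding alpha_def by simp

lemma reg_beta [simp]: "reg (beta P)"
  unfolding beta_def by simp

lemma px_unif: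
  assumes P: "P \<in> aff"
  obtains w w' where "reg w" "reg w'" "w P \<noteq> 0" "w' P \<noteq> 0"
    "\<And>Z. Z \<in> aff \<Longrightarrow> (px Z - px P) * w Z = w' Z * unif P Z ^ (if dy P = 0 then 2 else 1)"
proof (cases "dy P = 0")
  case False
  then show ?thesis
    by (intro that[of "\<lambda>Z. 1" "\<lambda>Z. 1"]) (simp_all add: unif_def)
next
  case True
  \<comment> \<open>At a ramified point \<open>alpha P Z\<close> is (y - y_P) + a_1 (x - x_P), its
    constant part being \<open>dy P = 0\<close>. Hence x - x_P is the square of the uniformizer up
    to a unit, since \<open>beta P P = dx P\<close> is nonzero.\<close>
  have "(px Z - px P) * (beta P Z - a1 * unif P Z) = unif P Z ^ 2" if Z: "Z \<in> aff" for Z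
  proof -
    have *: "alpha P Z = (py Z - py P) + a1 * (px Z - px P)"
      using True unfolding alpha_def dy_def by Groebner_Basis.algebra
    have "(px Z - px P) * (beta P Z - a1 * (py Z - py P)) = (py Z - py P) ^ 2"
      using alpha_beta[OF P Z] unfolding * by Groebner_Basis.algebra
    then show ?thesis
      using True by (simp add: unif_def)
  qed
  then show ?thesis
    using True smooth[OF P]
    by (intro that[of "\<lambda>Z. beta P Z - a1 * unif P Z" "\<lambda>Z. 1"]) (simp_all add: beta_self)
qed

lemma poly_split: "\<exists>a'. \<forall>x. poly a x = poly a c + (x - c) * poly a' (x::'k)"
proof -
  have "poly (a - [:poly a c:]) c = 0"
    by simp
  then obtain a' where "a - [:poly a c:] = [:-c, 1:] * a'"
    unfolding poly_eq_0_iff_dvd by (elim dvdE)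
  then have "poly (a - [:poly a c:]) x = poly ([:-c, 1:] * a') x" for x
    by simp
  then show ?thesis
    by (intro exI[of _ a']) (simp add: algebra_simps)
qed

text \<open>The maximal ideal at P is generated by x - x_P and y - y_P, and the relation between
  \<open>alpha\<close> and \<open>beta\<close> expresses one generator through the other. The
  multiplier \<open>S\<close> is whichever of \<open>alpha P\<close>, \<open>beta P\<close> is
  nonzero at P.\<close>

lemma reg_factor_unif:
  assumes P: "P \<in> aff" and U: "reg U" "U P = 0"
  obtains S V where "reg S" "reg V" "S P \<noteq> 0" "\<And>Z. Z \<in> aff \<Longrightarrow> S Z * U Z = V Z * unif P Z"
proof -
  obtain a b where ab: "\<And>Z. Z \<in> aff \<Longrightarrow> U Z = lin a b Z"
    using U by (auto simp: reg_def)
  obtain a' b' where a': "\<And>x. poly a x = poly a (px P) + (x - px P) * poly a' x"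
    and b': "\<And>x. poly b x = poly b (px P) + (x - px P) * poly b' x"
    using poly_split by metis
  define A where "A = lin a' b'"
  define B where "B = poly b (px P)"
  have 0: "poly a (px P) + poly b (px P) * py P = 0"
    using ab[OF P] U(2) by (simp add: lin_def)
  have eq: "U Z = (px Z - px P) * A Z + (py Z - py P) * B" if Z: "Z \<in> aff" for Z
    unfolding ab[OF Z] lin_def A_def B_def a'[of "px Z"] b'[of "px Z"] using 0
    by Groebner_Basis.algebra
  show thesis
  proof (cases "dy P = 0")
    case False
    have "alpha P Z * U Z = (alpha P Z * A Z + beta P Z * B) * unif P Z" if Z: "Z \<in> aff" for Z
      using eq[OF Z] alpha_beta[OF P Z] False by (simp add: unif_def) Groebner_Basis.algebra
    then show thesis
      using False
      by (intro that[of "alpha P" "\<lambda>Z. alpha P Z * A Z + beta P Z * B"])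
        (simp_all add: alpha_self A_def)
  next
    case True
    have "beta P Z * U Z = (alpha P Z * A Z + beta P Z * B) * unif P Z" if Z: "Z \<in> aff" for Z
      using eq[OF Z] alpha_beta[OF P Z] True by (simp add: unif_def) Groebner_Basis.algebra
    then show thesis
      using True smooth[OF P]
      by (intro that[of "beta P" "\<lambda>Z. alpha P Z * A Z + beta P Z * B"])
        (simp_all add: beta_self A_def)
  qed
qed

text \<open>\<open>unif P\<close> is extracted as long as the cofactor vanishes at P. This stops: a
  power of \<open>unif P\<close> dividing F up to a unit also divides the norm of F, which contains
  x - x_P only \<open>k\<close> times, each worth \<open>e\<close> uniformizers.\<close>

lemma reg_order:
  assumes P: "P \<in> aff" and F: "reg F" "nz F"
  obtains n S U where "reg S" "reg U" "S P \<noteq> 0" "U P \<noteq> 0"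
    "\<And>Z. Z \<in> aff \<Longrightarrow> S Z * F Z = U Z * unif P Z ^ n"
proof -
  define Q where "Q n \<longleftrightarrow> (\<exists>S U. reg S \<and> reg U \<and> S P \<noteq> 0 \<and>
      (\<forall>Z\<in>aff. S Z * F Z = U Z * unif P Z ^ n))" for n
  obtain a b where ab: "\<And>Z. Z \<in> aff \<Longrightarrow> F Z = lin a b Z"
    using F by (auto simp: reg_def)
  have "nrm a b \<noteq> 0"
  proof
    assume "nrm a b = 0"
    then have "\<forall>\<^sub>F Z in cof. F Z = 0"
      using cof_aff by (auto simp: nrm_eq_0_iff ab lin_def elim!: eventually_mono)
    then have "\<forall>\<^sub>F Z in cof. False"
      using F(2)[unfolded nz_def] by eventually_elim simp
    then show False
      using cof_ne_bot by simp
  qed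
  then obtain q where q: "nrm a b = [:- px P, 1:] ^ Polynomial.order (px P) (nrm a b) * q"
      "\<not> [:- px P, 1:] dvd q"
    using order_decomp by blast
  define k where "k = Polynomial.order (px P) (nrm a b)"
  obtain w w' where w: "reg w" "reg w'" "w P \<noteq> 0" "w' P \<noteq> 0"
    "\<And>Z. Z \<in> aff \<Longrightarrow> (px Z - px P) * w Z = w' Z * unif P Z ^ (if dy P = 0 then 2 else 1)"
    by (rule px_unif[OF P]) blast
  define e :: nat where "e = (if dy P = 0 then 2 else 1)"
  have bound: "n \<le> e * k" if "Q n" for n
  proof (rule ccontr)
    assume "\<not> n \<le> e * k"
    then obtain d where d: "n = e * k + Suc d"
      by (metis add_Suc_right less_iff_Suc_add not_le)
    from \<open>Q n\<close> obtain S U where SU: "reg S" "reg U" "S P \<noteq> 0"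
        "\<And>Z. Z \<in> aff \<Longrightarrow> S Z * F Z = U Z * unif P Z ^ n"
      unfolding Q_def by blast
    have eq: "(S Z * poly q (px Z) * w' Z ^ k) * unif P Z ^ (e * k) =
        (U Z * F (neg Z) * w Z ^ k * unif P Z ^ Suc d) * unif P Z ^ (e * k)" if Z: "Z \<in> aff" for Z
    proof -
      have "F Z * F (neg Z) = (px Z - px P) ^ k * poly q (px Z)"
        using nrm_eval[OF Z, of a b] ab[of Z] ab[of "neg Z"] Z
        by (subst (asm) q(1)) (simp add: k_def)
      then have "S Z * ((px Z - px P) * w Z) ^ k * poly q (px Z) =
          (S Z * F Z) * F (neg Z) * w Z ^ k"
        by (simp add: power_mult_distrib)
      then show ?thesis
        unfolding w(5)[OF Z] SU(4)[OF Z] e_def[symmetric] d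
        by (simp add: power_mult_distrib power_mult power_add mult_ac)
    qed
    \<comment> \<open>With \<open>unif P ^ (e * k)\<close> cancelled, the identity extends to P
      itself. There the right side contains \<open>unif P P = 0\<close>, while every factor on the
      left is nonzero.\<close>
    have "\<forall>\<^sub>F Z in cof. S Z * poly q (px Z) * w' Z ^ k = U Z * F (neg Z) * w Z ^ k * unif P Z ^ Suc d"
      using cof_aff nz_unif[of P, unfolded nz_def]
    proof eventually_elim
      case (elim Z)
      then show ?case using eq[of Z] by (simp del: power_Suc)
    qed
    then have "S P * poly q (px P) * w' P ^ k = U P * F (neg P) * w P ^ k * unif P P ^ Suc d"
      by (intro reg_eq[OF _ _ _ P]) (simp_all add: SU w F)
    then show False
      using SU(3) w(4) q(2) by (simp add: poly_eq_0_iff_dvd)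
  qed
  have "Q 0"
    unfolding Q_def by (intro exI[of _ "\<lambda>Z. 1"] exI[of _ F]) (simp add: F)
  then obtain n where n: "Q n" "\<not> Q (Suc n)"
  proof -
    have "\<exists>n. Q n \<and> \<not> Q (Suc n)"
    proof (rule ccontr)
      assume "\<not> ?thesis"
      then have "Q n" for n
        using \<open>Q 0\<close> by (induction n) auto
      then show False
        using bound[of "Suc (e * k)"] by simp
    qed
    then show thesis using that by blast
  qed
  then obtain S U where SU: "reg S" "reg U" "S P \<noteq> 0"
      "\<And>Z. Z \<in> aff \<Longrightarrow> S Z * F Z = U Z * unif P Z ^ n"
    unfolding Q_def by blast
  have "U P \<noteq> 0"
  proof
    assume "U P = 0"
    then obtain S' V where S': "reg S'" "reg V" "S' P \<noteq> 0"
        "\<And>Z. Z \<in> aff \<Longrightarrow> S' Z * U Z = V Z * unif P Z"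
      by (rule reg_factor_unif[OF P SU(2)]) blast
    have "(S' Z * S Z) * F Z = V Z * unif P Z ^ Suc n" if "Z \<in> aff" for Z
    proof -
      have "(S' Z * S Z) * F Z = S' Z * (S Z * F Z)" by simp
      also have "\<dots> = (S' Z * U Z) * unif P Z ^ n"
        by (simp add: SU(4)[OF that])
      also have "\<dots> = V Z * unif P Z ^ Suc n"
        by (simp add: S'(4)[OF that])
      finally show ?thesis .
    qed
    then have "Q (Suc n)"
      unfolding Q_def using SU S'
      by (intro exI[of _ "\<lambda>Z. S' Z * S Z"] exI[of _ V]) simp
    with n(2) show False ..
  qed
  with SU show thesis
    using that by blast
qed

text \<open>\<open>pm1\<close> and \<open>pm2\<close> are the coordinates, in the basis 1, y over
  k[x], of the product of a + b y and c + d y once y^2 is replaced by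
  \<open>cub - tr * y\<close>.\<close>

definition pm1 :: "'k poly \<Rightarrow> 'k poly \<Rightarrow> 'k poly \<Rightarrow> 'k poly \<Rightarrow> 'k poly" where
  "pm1 a b c d = a * c + b * d * cub"

definition pm2 :: "'k poly \<Rightarrow> 'k poly \<Rightarrow> 'k poly \<Rightarrow> 'k poly \<Rightarrow> 'k poly" where
  "pm2 a b c d = a * d + b * c - b * d * tr"

lemma lin_pm: "P \<in> aff \<Longrightarrow> lin (pm1 a b c d) (pm2 a b c d) P = lin a b P * lin c d P"
  by (simp add: pm1_def pm2_def lin_mult)

lemma nrm_pm: "nrm (pm1 a b c d) (pm2 a b c d) = nrm a b * nrm c d"
proof (rule poly_eqI_infinite)
  fix x
  obtain P where P: "P \<in> aff" "px P = x"
    using point_over by blast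
  show "poly (nrm (pm1 a b c d) (pm2 a b c d)) x = poly (nrm a b * nrm c d) x"
    using P(1) unfolding P(2)[symmetric] poly_mult by (simp add: nrm_eval lin_pm)
qed

lemma pm_nz:
  assumes "a \<noteq> 0 \<or> b \<noteq> 0" "c \<noteq> 0 \<or> d \<noteq> 0"
  shows "pm1 a b c d \<noteq> 0 \<or> pm2 a b c d \<noteq> 0"
    and "dg (pm1 a b c d) (pm2 a b c d) = dg a b + dg c d"
proof -
  have "nrm (pm1 a b c d) (pm2 a b c d) \<noteq> 0"
    unfolding nrm_pm using nrm_degree(1) assms by simp
  then show *: "pm1 a b c d \<noteq> 0 \<or> pm2 a b c d \<noteq> 0"
    by (simp add: nrm_eq_0_iff)
  show "dg (pm1 a b c d) (pm2 a b c d) = dg a b + dg c d"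
    unfolding nrm_degree(2)[OF *, symmetric] nrm_degree(2)[OF assms(1), symmetric]
      nrm_degree(2)[OF assms(2), symmetric] nrm_pm
    using nrm_degree(1) assms by (simp add: degree_mult_eq)
qed

lemma lin_eqD:
  assumes "\<forall>\<^sub>F Z in cof. lin a b Z = lin c d Z"
  shows "a = c" "b = d"
proof -
  have "a - c = 0 \<and> b - d = 0"
  proof (rule ccontr)
    assume "\<not> ?thesis"
    then have "\<forall>\<^sub>F Z in cof. lin (a - c) (b - d) Z \<noteq> 0"
      by (intro lin_cof_nz) auto
    with assms have "\<forall>\<^sub>F Z in cof. False"
      by eventually_elim (simp add: lin_def algebra_simps)
    then show False
      using cof_ne_bot by simp
  qed
  then show "a = c" "b = d" by auto
qed

text \<open>The two candidates in \<open>dg\<close> have different parity, so exactly one of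
  \<open>a\<close>, \<open>b\<close> carries the leading pole, and a summand with smaller
  \<open>dg\<close> cannot cancel its leading coefficient.\<close>

lemma dg_add:
  assumes "dg c d < dg a b"
  shows "dg (a + c) (b + d) = dg a b" "a + c \<noteq> 0 \<or> b + d \<noteq> 0"
proof -
  let ?d = "Polynomial.degree"
  have "dg (a + c) (b + d) = dg a b \<and> (a + c \<noteq> 0 \<or> b + d \<noteq> 0)"
  proof (cases "b \<noteq> 0 \<and> 2 * ?d a \<le> 2 * ?d b + 3")
    case True
    have "d = 0 \<or> ?d d < ?d b"
      using assms True by (auto simp: dg_def split: if_splits)
    then have 1: "b + d \<noteq> 0" "?d (b + d) = ?d b"
      using True by (auto simp: degree_add_eq_left)
        (metis add_eq_0_iff degree_minus nat_neq_iff)+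
    have "2 * ?d c \<le> 2 * ?d b + 3"
      using assms True by (auto simp: dg_def split: if_splits)
    then have "2 * ?d (a + c) \<le> 2 * ?d b + 3"
      using True degree_add_le_max[of a c] by (auto simp: max_def split: if_splits)
    then show ?thesis
      using 1 True by (simp add: dg_def)
  next
    case False
    then have *: "dg a b = 2 * ?d a" "b = 0 \<or> 2 * ?d b + 3 < 2 * ?d a"
      by (auto simp: dg_def)
    have "?d c < ?d a"
      using assms * by (auto simp: dg_def split: if_splits)
    then have 1: "?d (a + c) = ?d a" "a + c \<noteq> 0"
      by (auto simp: degree_add_eq_left) (metis add_eq_0_iff degree_minus nat_neq_iff)
    have "b + d = 0 \<or> 2 * ?d (b + d) + 3 \<le> 2 * ?d a"
    proof (cases "b = 0 \<or> d = 0")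
      case True
      then show ?thesis
        using * assms by (auto simp: dg_def split: if_splits)
    next
      case False
      then show ?thesis
        using * assms degree_add_le_max[of b d]
        by (auto simp: dg_def max_def split: if_splits)
    qed
    then show ?thesis
      using 1 * by (auto simp: dg_def)
  qed
  then show "dg (a + c) (b + d) = dg a b" "a + c \<noteq> 0 \<or> b + d \<noteq> 0" by auto
qed

text \<open>A relation rather than a function: a derivable \<open>hord P f n\<close> already
  contains that f is rational and not almost everywhere zero, so the calculus needs no side
  conditions. At infinity x and y have poles of order 2 and 3, which makes \<open>dg\<close> the
  pole order of a representative; elsewhere f is a local unit \<open>U / S\<close> times a power of
  the uniformizer.\<close>

definition hord :: "'k ec_point \<Rightarrow> ('k ec_point \<Rightarrow> 'k) \<Rightarrow> int \<Rightarrow> bool" where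
  "hord P f n \<longleftrightarrow>
     (P = Infinity \<and> (\<exists>a b c d. (a \<noteq> 0 \<or> b \<noteq> 0) \<and> (c \<noteq> 0 \<or> d \<noteq> 0) \<and>
        (\<forall>\<^sub>F Z in cof. f Z * lin c d Z = lin a b Z) \<and> n = int (dg c d) - int (dg a b))) \<or>
     (P \<in> aff \<and> (\<exists>S U. reg S \<and> reg U \<and> S P \<noteq> 0 \<and> U P \<noteq> 0 \<and>
        (\<forall>\<^sub>F Z in cof. S Z * f Z = U Z * unif P Z powi n)))"

lemma hord_affI:
  assumes "P \<in> aff" "reg S" "reg U" "S P \<noteq> 0" "U P \<noteq> 0"
    "\<forall>\<^sub>F Z in cof. S Z * f Z = U Z * unif P Z powi n"
  shows "hord P f n"
  unfolding hord_def using assms by blast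

lemma hord_affE:
  assumes "hord P f n" "P \<in> aff"
  obtains S U where "reg S" "reg U" "S P \<noteq> 0" "U P \<noteq> 0"
    "\<forall>\<^sub>F Z in cof. S Z * f Z = U Z * unif P Z powi n"
  using assms unfolding hord_def by auto

lemma hord_infI:
  assumes "a \<noteq> 0 \<or> b \<noteq> 0" "c \<noteq> 0 \<or> d \<noteq> 0"
    "\<forall>\<^sub>F Z in cof. f Z * lin c d Z = lin a b Z" "n = int (dg c d) - int (dg a b)"
  shows "hord Infinity f n"
  unfolding hord_def using assms by blast

lemma hord_infE:
  assumes "hord Infinity f n"
  obtains a b c d where "a \<noteq> 0 \<or> b \<noteq> 0" "c \<noteq> 0 \<or> d \<noteq> 0"
    "\<forall>\<^sub>F Z in cof. f Z * lin c d Z = lin a b Z" "n = int (dg c d) - int (dg a b)"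
  using assms unfolding hord_def by auto

lemma hord_points: "hord P f n \<Longrightarrow> P \<in> points E"
  by (auto simp: hord_def points_eq)

lemma hord_cong:
  assumes "hord P f n" "\<forall>\<^sub>F Z in cof. f Z = g Z"
  shows "hord P g n"
  using hord_points[OF assms(1)] unfolding points_eq
proof (elim insertE)
  assume [simp]: "P = Infinity"
  obtain a b c d where *: "a \<noteq> 0 \<or> b \<noteq> 0" "c \<noteq> 0 \<or> d \<noteq> 0"
    "\<forall>\<^sub>F Z in cof. f Z * lin c d Z = lin a b Z" "n = int (dg c d) - int (dg a b)"
    using assms(1) unfolding \<open>P = Infinity\<close> by (rule hord_infE)
  have "\<forall>\<^sub>F Z in cof. g Z * lin c d Z = lin a b Z"
    using *(3) assms(2) by eventually_elim simp
  with * show ?thesis by (auto intro: hord_infI)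
next
  assume P: "P \<in> aff"
  obtain S U where *: "reg S" "reg U" "S P \<noteq> 0" "U P \<noteq> 0"
    "\<forall>\<^sub>F Z in cof. S Z * f Z = U Z * unif P Z powi n"
    by (rule hord_affE[OF assms(1) P])
  have "\<forall>\<^sub>F Z in cof. S Z * g Z = U Z * unif P Z powi n"
    using *(5) assms(2) by eventually_elim simp
  with * P show ?thesis by (auto intro: hord_affI)
qed

lemma hord_mult:
  assumes "hord P f m" "hord P g n"
  shows "hord P (\<lambda>Z. f Z * g Z) (m + n)"
  using hord_points[OF assms(1)] unfolding points_eq
proof (elim insertE)
  assume [simp]: "P = Infinity"
  obtain a b c d where 1: "a \<noteq> 0 \<or> b \<noteq> 0" "c \<noteq> 0 \<or> d \<noteq> 0"
    "\<forall>\<^sub>F Z in cof. f Z * lin c d Z = lin a b Z" "m = int (dg c d) - int (dg a b)"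
    using assms(1) unfolding \<open>P = Infinity\<close> by (rule hord_infE)
  obtain a' b' c' d' where 2: "a' \<noteq> 0 \<or> b' \<noteq> 0" "c' \<noteq> 0 \<or> d' \<noteq> 0"
    "\<forall>\<^sub>F Z in cof. g Z * lin c' d' Z = lin a' b' Z" "n = int (dg c' d') - int (dg a' b')"
    using assms(2) unfolding \<open>P = Infinity\<close> by (rule hord_infE)
  have "\<forall>\<^sub>F Z in cof. f Z * g Z * lin (pm1 c d c' d') (pm2 c d c' d') Z =
      lin (pm1 a b a' b') (pm2 a b a' b') Z"
    using cof_aff 1(3) 2(3)
  proof eventually_elim
    case (elim Z)
    have "f Z * g Z * (lin c d Z * lin c' d' Z) = (f Z * lin c d Z) * (g Z * lin c' d' Z)"
      by simp
    then show ?case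
      unfolding elim(2,3) lin_pm[OF elim(1)] .
  qed
  then show ?thesis
    using 1 2 pm_nz[OF 1(1) 2(1)] pm_nz[OF 1(2) 2(2)]
    by (auto intro!: hord_infI[where a = "pm1 a b a' b'" and b = "pm2 a b a' b'"
          and c = "pm1 c d c' d'" and d = "pm2 c d c' d'"])
next
  assume P: "P \<in> aff"
  obtain S U where 1: "reg S" "reg U" "S P \<noteq> 0" "U P \<noteq> 0"
    "\<forall>\<^sub>F Z in cof. S Z * f Z = U Z * unif P Z powi m"
    by (rule hord_affE[OF assms(1) P])
  obtain S' U' where 2: "reg S'" "reg U'" "S' P \<noteq> 0" "U' P \<noteq> 0"
    "\<forall>\<^sub>F Z in cof. S' Z * g Z = U' Z * unif P Z powi n"
    by (rule hord_affE[OF assms(2) P])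
  have "\<forall>\<^sub>F Z in cof. (S Z * S' Z) * (f Z * g Z) = (U Z * U' Z) * unif P Z powi (m + n)"
    using nz_unif[of P, unfolded nz_def] 1(5) 2(5)
  proof eventually_elim
    case (elim Z)
    have "(S Z * S' Z) * (f Z * g Z) = (S Z * f Z) * (S' Z * g Z)" by simp
    also have "\<dots> = (U Z * U' Z) * unif P Z powi (m + n)"
      using elim by (simp add: power_int_add)
    finally show ?case .
  qed
  then show ?thesis
    using 1 2 P by (intro hord_affI[where S = "\<lambda>Z. S Z * S' Z" and U = "\<lambda>Z. U Z * U' Z"]) simp_all
qed

lemma hord_nz:
  assumes "hord P f n"
  shows "nz f"
  using hord_points[OF assms(1)] unfolding points_eq
proof (elim insertE)
  assume [simp]: "P = Infinity"
  obtain a b c d where 1: "a \<noteq> 0 \<or> b \<noteq> 0" "c \<noteq> 0 \<or> d \<noteq> 0"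
    "\<forall>\<^sub>F Z in cof. f Z * lin c d Z = lin a b Z" "n = int (dg c d) - int (dg a b)"
    using assms(1) unfolding \<open>P = Infinity\<close> by (rule hord_infE)
  show ?thesis
    unfolding nz_def using lin_cof_nz[OF 1(1)] 1(3) by eventually_elim auto
next
  assume P: "P \<in> aff"
  obtain S U where 1: "reg S" "reg U" "S P \<noteq> 0" "U P \<noteq> 0"
    "\<forall>\<^sub>F Z in cof. S Z * f Z = U Z * unif P Z powi n"
    by (rule hord_affE[OF assms(1) P])
  have "\<forall>\<^sub>F Z in cof. U Z \<noteq> 0"
    using reg_cases[OF 1(2)] 1(4) P by auto
  with 1(5) nz_unif[of P, unfolded nz_def] show ?thesis
    unfolding nz_def by eventually_elim auto
qed

lemma hord_inverse:
  assumes "hord P f n"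
  shows "hord P (\<lambda>Z. inverse (f Z)) (- n)"
  using hord_points[OF assms(1)] unfolding points_eq
proof (elim insertE)
  assume [simp]: "P = Infinity"
  obtain a b c d where 1: "a \<noteq> 0 \<or> b \<noteq> 0" "c \<noteq> 0 \<or> d \<noteq> 0"
    "\<forall>\<^sub>F Z in cof. f Z * lin c d Z = lin a b Z" "n = int (dg c d) - int (dg a b)"
    using assms(1) unfolding \<open>P = Infinity\<close> by (rule hord_infE)
  have "\<forall>\<^sub>F Z in cof. inverse (f Z) * lin a b Z = lin c d Z"
    using hord_nz[OF assms, unfolded nz_def] 1(3) by eventually_elim (auto simp: field_simps)
  then show ?thesis
    using 1 by (auto intro: hord_infI[where a = c and b = d and c = a and d = b])
next
  assume P: "P \<in> aff"
  obtain S U where 1: "reg S" "reg U" "S P \<noteq> 0" "U P \<noteq> 0"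
    "\<forall>\<^sub>F Z in cof. S Z * f Z = U Z * unif P Z powi n"
    by (rule hord_affE[OF assms(1) P])
  have "\<forall>\<^sub>F Z in cof. U Z * inverse (f Z) = S Z * unif P Z powi (- n)"
    using hord_nz[OF assms, unfolded nz_def] 1(5) nz_unif[of P, unfolded nz_def]
    by eventually_elim (simp add: field_simps power_int_minus)
  then show ?thesis
    using 1 P by (intro hord_affI)
qed

lemma hord_reg_unit:
  assumes "P \<in> aff" "reg f" "f P \<noteq> 0"
  shows "hord P f 0"
  using assms by (intro hord_affI[where S = "\<lambda>Z. 1" and U = f]) simp_all

lemma hord_unif: "P \<in> aff \<Longrightarrow> hord P (unif P) 1"
  by (intro hord_affI[where S = "\<lambda>Z. 1" and U = "\<lambda>Z. 1"]) simp_all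

lemma hord_const: "P \<in> points E \<Longrightarrow> c \<noteq> 0 \<Longrightarrow> hord P (\<lambda>Z. c) 0"
  unfolding points_eq
proof (elim insertE)
  assume "P = Infinity" "c \<noteq> 0"
  then show ?thesis
    by (auto intro!: hord_infI[where a = "[:c:]" and b = 0 and c = 1 and d = 0] simp: lin_def dg_def)
qed (auto intro: hord_reg_unit)

lemma hord_divide: "hord P f m \<Longrightarrow> hord P g n \<Longrightarrow> hord P (\<lambda>Z. f Z / g Z) (m - n)"
  using hord_mult[OF _ hord_inverse, of P f m g n] by (simp add: divide_inverse)

lemma hord_uminus: "hord P f n \<Longrightarrow> hord P (\<lambda>Z. - f Z) n"
  using hord_mult[OF hord_const[of P "-1"], of f n] hord_points by fastforce

lemma hord_power: "hord P f n \<Longrightarrow> hord P (\<lambda>Z. f Z ^ k) (int k * n)"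
proof (induction k)
  case 0
  then show ?case
    using hord_const[of P 1] hord_points by fastforce
next
  case (Suc k)
  then show ?case
    using hord_mult[of P f n "\<lambda>Z. f Z ^ k" "int k * n"] by (simp add: algebra_simps)
qed

text \<open>Uniqueness of orders reduces to the constant 1 by dividing a function by itself. At an
  affine point with \<open>n \<noteq> 0\<close>, clearing a negative power leaves a factor
  \<open>unif P\<close> on one side only, which is refuted by evaluation at P.\<close>

lemma hord_one_unique:
  assumes "hord P (\<lambda>Z. 1) n"
  shows "n = 0"
  using hord_points[OF assms(1)] unfolding points_eq
proof (elim insertE)
  assume [simp]: "P = Infinity"
  obtain a b c d where 1: "a \<noteq> 0 \<or> b \<noteq> 0" "c \<noteq> 0 \<or> d \<noteq> 0"
    "\<forall>\<^sub>F Z in cof. 1 * lin c d Z = lin a b Z" "n = int (dg c d) - int (dg a b)"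
    using assms(1) unfolding \<open>P = Infinity\<close> by (rule hord_infE)
  then show ?thesis
    using lin_eqD[of c d a b] by simp
next
  assume P: "P \<in> aff"
  obtain S U where 1: "reg S" "reg U" "S P \<noteq> 0" "U P \<noteq> 0"
    "\<forall>\<^sub>F Z in cof. S Z * 1 = U Z * unif P Z powi n"
    by (rule hord_affE[OF assms(1) P])
  show ?thesis
  proof (rule ccontr)
    assume "n \<noteq> 0"
    then consider k where "n = int (Suc k)" | k where "n = - int (Suc k)"
      by (metis int_cases3 Suc_pred)
    then show False
    proof cases
      case (1 k)
      have "\<forall>\<^sub>F Z in cof. S Z = U Z * unif P Z ^ Suc k"
        using \<open>\<forall>\<^sub>F Z in cof. S Z * 1 = U Z * unif P Z powi n\<close>
        by eventually_elim (simp add: 1 power_int_def nat_add_distrib)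
      then have "S P = U P * unif P P ^ Suc k"
        using \<open>reg S\<close> \<open>reg U\<close> by (intro reg_eq[OF _ _ _ P]) simp_all
      then show False using \<open>S P \<noteq> 0\<close> by simp
    next
      case (2 k)
      have "\<forall>\<^sub>F Z in cof. S Z * unif P Z ^ Suc k = U Z"
        using \<open>\<forall>\<^sub>F Z in cof. S Z * 1 = U Z * unif P Z powi n\<close> nz_unif[of P, unfolded nz_def]
      proof eventually_elim
        case (elim Z)
        have "S Z * unif P Z ^ Suc k = U Z * (unif P Z powi n * unif P Z powi int (Suc k))"
          using elim by (simp only: mult.assoc[symmetric] power_int_of_nat) simp
        also have "unif P Z powi n * unif P Z powi int (Suc k) = 1"
          using elim(2) unfolding power_int_add[OF disjI1[OF elim(2)], symmetric] 2 by simp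
        finally show ?case by simp
      qed
      then have "S P * unif P P ^ Suc k = U P"
        using \<open>reg S\<close> \<open>reg U\<close> by (intro reg_eq[OF _ _ _ P]) simp_all
      then show False using \<open>U P \<noteq> 0\<close> by simp
    qed
  qed
qed

lemma hord_unique:
  assumes "hord P f m" "hord P f n"
  shows "m = n"
proof -
  have "hord P (\<lambda>Z. f Z / f Z) (m - n)"
    by (rule hord_divide[OF assms])
  then have "hord P (\<lambda>Z. 1) (m - n)"
    by (rule hord_cong) (use hord_nz[OF assms(1)] in \<open>auto simp: nz_def elim!: eventually_mono\<close>)
  then show ?thesis
    using hord_one_unique by force
qed

lemma hord_ex_reg:
  assumes "P \<in> aff" "reg f" "nz f"
  obtains n where "hord P f (int n)"
proof -
  obtain n S U where *: "reg S" "reg U" "S P \<noteq> 0" "U P \<noteq> 0"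
    "\<And>Z. Z \<in> aff \<Longrightarrow> S Z * f Z = U Z * unif P Z ^ n"
    by (rule reg_order[OF assms]) blast
  have "\<forall>\<^sub>F Z in cof. S Z * f Z = U Z * unif P Z powi (int n)"
    using cof_aff by eventually_elim (simp add: *(5))
  then have "hord P f (int n)"
    using * assms by (intro hord_affI)
  then show thesis ..
qed

lemma hord_inf_lin:
  assumes "a \<noteq> 0 \<or> b \<noteq> 0"
  shows "hord Infinity (lin a b) (- int (dg a b))"
  using assms by (auto intro!: hord_infI[where a = a and b = b and c = 1 and d = 0] simp: lin_def dg_def)

lemma nz_reg_lin:
  assumes "reg f" "nz f"
  obtains a b where "a \<noteq> 0 \<or> b \<noteq> 0" "\<And>Z. Z \<in> aff \<Longrightarrow> f Z = lin a b Z"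
proof -
  obtain a b where ab: "\<And>P. P \<in> aff \<Longrightarrow> f P = lin a b P"
    using assms by (auto simp: reg_def)
  obtain P where "P \<in> aff" "f P \<noteq> 0"
    using assms(2) unfolding nz_def by (rule cof_ex)
  then have "a \<noteq> 0 \<or> b \<noteq> 0"
    using ab by (auto simp: lin_def)
  with ab show thesis using that by blast
qed

lemma hord_ex:
  assumes "rat f" "nz f" "P \<in> points E"
  obtains n where "hord P f n"
proof -
  from assms(1) obtain F G where *: "reg F" "reg G" "nz G" "\<forall>\<^sub>F P in cof. f P = F P / G P"
    unfolding rat_def by blast
  have "nz F"
    unfolding nz_def using assms(2)[unfolded nz_def] *(4) by eventually_elim auto
  have "\<exists>n. hord P H n" if "reg H" "nz H" for H
  proof (cases "P = Infinity")
    case True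
    obtain a b where ab: "a \<noteq> 0 \<or> b \<noteq> 0" "\<And>Z. Z \<in> aff \<Longrightarrow> H Z = lin a b Z"
      by (rule nz_reg_lin[OF \<open>reg H\<close> \<open>nz H\<close>]) blast
    have "\<forall>\<^sub>F Z in cof. lin a b Z = H Z"
      using cof_aff by eventually_elim (simp add: ab)
    then show ?thesis
      using hord_cong[OF hord_inf_lin[OF ab(1)]] True by blast
  next
    case False
    then show ?thesis
      using hord_ex_reg[OF _ that] assms(3) by (metis insertE points_eq)
  qed
  then obtain m n where "hord P F m" "hord P G n"
    using * \<open>nz F\<close> by metis
  then have "hord P (\<lambda>Z. F Z / G Z) (m - n)"
    by (rule hord_divide)
  then have "hord P f (m - n)"
    by (rule hord_cong) (use *(4) in \<open>auto elim!: eventually_mono\<close>)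
  then show thesis ..
qed

lemma hord_rat:
  assumes "hord P f n"
  shows "rat f"
  using hord_points[OF assms(1)] unfolding points_eq
proof (elim insertE)
  assume [simp]: "P = Infinity"
  obtain a b c d where 1: "a \<noteq> 0 \<or> b \<noteq> 0" "c \<noteq> 0 \<or> d \<noteq> 0"
    "\<forall>\<^sub>F Z in cof. f Z * lin c d Z = lin a b Z" "n = int (dg c d) - int (dg a b)"
    using assms(1) unfolding \<open>P = Infinity\<close> by (rule hord_infE)
  have "\<forall>\<^sub>F Z in cof. f Z = lin a b Z / lin c d Z"
    using 1(3) lin_cof_nz[OF 1(2)] by eventually_elim (simp add: field_simps)
  then show ?thesis
    by (rule rat_cong[rotated]) simp
next
  assume P: "P \<in> aff"
  obtain S U where 1: "reg S" "reg U" "S P \<noteq> 0" "U P \<noteq> 0"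
    "\<forall>\<^sub>F Z in cof. S Z * f Z = U Z * unif P Z powi n"
    by (rule hord_affE[OF assms(1) P])
  have "\<forall>\<^sub>F Z in cof. S Z \<noteq> 0"
    using reg_cases[OF 1(1)] 1(3) P by auto
  then have "\<forall>\<^sub>F Z in cof. f Z = U Z * unif P Z powi n / S Z"
    using 1(5) by eventually_elim (simp add: field_simps)
  moreover have "rat (\<lambda>Z. unif P Z powi n)"
    by (cases n rule: int_cases3) (simp_all add: power_int_minus)
  ultimately show ?thesis
    using 1 by (auto intro: rat_cong[rotated])
qed

lemma hord_add:
  assumes "hord P f m" "hord P g n" "m < n"
  shows "hord P (\<lambda>Z. f Z + g Z) m"
  using hord_points[OF assms(1)] unfolding points_eq
proof (elim insertE)
  assume [simp]: "P = Infinity"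
  obtain a b c d where 1: "a \<noteq> 0 \<or> b \<noteq> 0" "c \<noteq> 0 \<or> d \<noteq> 0"
    "\<forall>\<^sub>F Z in cof. f Z * lin c d Z = lin a b Z" "m = int (dg c d) - int (dg a b)"
    using assms(1) unfolding \<open>P = Infinity\<close> by (rule hord_infE)
  obtain a' b' c' d' where 2: "a' \<noteq> 0 \<or> b' \<noteq> 0" "c' \<noteq> 0 \<or> d' \<noteq> 0"
    "\<forall>\<^sub>F Z in cof. g Z * lin c' d' Z = lin a' b' Z" "n = int (dg c' d') - int (dg a' b')"
    using assms(2) unfolding \<open>P = Infinity\<close> by (rule hord_infE)
  let ?a = "pm1 a b c' d'" and ?b = "pm2 a b c' d'" and ?a' = "pm1 a' b' c d" and ?b' = "pm2 a' b' c d"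
  have lt: "dg ?a' ?b' < dg ?a ?b"
    unfolding pm_nz(2)[OF 1(1) 2(2)] pm_nz(2)[OF 2(1) 1(2)] using 1(4) 2(4) assms(3) by simp
  have "\<forall>\<^sub>F Z in cof. (f Z + g Z) * lin (pm1 c d c' d') (pm2 c d c' d') Z = lin (?a + ?a') (?b + ?b') Z"
    using cof_aff 1(3) 2(3)
  proof eventually_elim
    case (elim Z)
    have "lin (?a + ?a') (?b + ?b') Z = lin ?a ?b Z + lin ?a' ?b' Z"
      by (simp add: lin_def algebra_simps)
    moreover have "(f Z + g Z) * (lin c d Z * lin c' d' Z) =
        (f Z * lin c d Z) * lin c' d' Z + (g Z * lin c' d' Z) * lin c d Z"
      by (simp add: algebra_simps)
    ultimately show ?case
      unfolding elim(2,3) lin_pm[OF elim(1)] by simp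
  qed
  then show ?thesis
    using 1(4) unfolding \<open>P = Infinity\<close>
    by (intro hord_infI[OF dg_add(2)[OF lt] pm_nz(1)[OF 1(2) 2(2)]])
      (simp_all add: pm_nz(2)[OF 1(2) 2(2)] dg_add(1)[OF lt] pm_nz(2)[OF 1(1) 2(2)])
next
  assume P: "P \<in> aff"
  obtain S U where 1: "reg S" "reg U" "S P \<noteq> 0" "U P \<noteq> 0"
    "\<forall>\<^sub>F Z in cof. S Z * f Z = U Z * unif P Z powi m"
    by (rule hord_affE[OF assms(1) P])
  obtain S' U' where 2: "reg S'" "reg U'" "S' P \<noteq> 0" "U' P \<noteq> 0"
    "\<forall>\<^sub>F Z in cof. S' Z * g Z = U' Z * unif P Z powi n"
    by (rule hord_affE[OF assms(2) P])
  obtain k where k: "n = m + int (Suc k)"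
    using assms(3) by (metis zless_iff_Suc_zadd)
  have "\<forall>\<^sub>F Z in cof. (S Z * S' Z) * (f Z + g Z) =
      (U Z * S' Z + U' Z * S Z * unif P Z ^ Suc k) * unif P Z powi m"
    using nz_unif[of P, unfolded nz_def] 1(5) 2(5)
  proof eventually_elim
    case (elim Z)
    have "unif P Z powi n = unif P Z powi m * unif P Z ^ Suc k"
      unfolding k power_int_add[OF disjI1[OF elim(1)]] by (simp only: power_int_of_nat)
    moreover have "(S Z * S' Z) * (f Z + g Z) = (S Z * f Z) * S' Z + (S' Z * g Z) * S Z"
      by (simp add: algebra_simps)
    ultimately show ?case
      using elim(2,3) by (simp add: algebra_simps)
  qed
  then show ?thesis
    using 1 2 P by (intro hord_affI[where S = "\<lambda>Z. S Z * S' Z"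
          and U = "\<lambda>Z. U Z * S' Z + U' Z * S Z * unif P Z ^ Suc k"]) simp_all
qed

lemma hord_add':
  assumes "hord P f m" "hord P g n" "n < m"
  shows "hord P (\<lambda>Z. f Z + g Z) n"
  using hord_add[OF assms(2,1,3)] by (simp add: add.commute)

lemma hord_add_ge:
  assumes "hord P f m" "hord P g n" "hord P (\<lambda>Z. f Z + g Z) l"
  shows "l \<ge> min m n"
proof (rule ccontr)
  assume "\<not> ?thesis"
  then have "l < m" "l < n" by auto
  have "hord P (\<lambda>Z. (f Z + g Z) + - g Z) l"
    using hord_add[OF assms(3) hord_uminus[OF assms(2)] \<open>l < n\<close>] .
  then show False
    using hord_unique[OF _ assms(1)] \<open>l < m\<close> by force
qed

lemma hord_reg_nonneg:
  assumes "P \<in> aff" "reg f" "hord P f n"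
  shows "n \<ge> 0"
  using hord_ex_reg[OF assms(1,2) hord_nz[OF assms(3)]] hord_unique[OF assms(3)]
  by (metis of_nat_0_le_iff)

lemma hord_reg_zero:
  assumes P: "P \<in> aff" and f: "reg f" "f P = 0" and n: "hord P f n"
  shows "n \<ge> 1"
proof -
  obtain S V where *: "reg S" "reg V" "S P \<noteq> 0" "\<And>Z. Z \<in> aff \<Longrightarrow> S Z * f Z = V Z * unif P Z"
    by (rule reg_factor_unif[OF P f]) blast
  have "hord P (\<lambda>Z. S Z * f Z / unif P Z) (0 + n - 1)"
    by (intro hord_divide hord_mult hord_reg_unit n hord_unif P *)
  moreover have "\<forall>\<^sub>F Z in cof. S Z * f Z / unif P Z = V Z"
    using cof_aff nz_unif[of P, unfolded nz_def] by eventually_elim (simp add: *)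
  ultimately have "hord P V (0 + n - 1)"
    by (rule hord_cong)
  from hord_reg_nonneg[OF P *(2) this] show ?thesis by simp
qed

lemma hord_px:
  assumes P: "P \<in> aff"
  shows "hord P (\<lambda>Z. px Z - px P) (if dy P = 0 then 2 else 1)"
proof -
  obtain w w' where w: "reg w" "reg w'" "w P \<noteq> 0" "w' P \<noteq> 0"
    "\<And>Z. Z \<in> aff \<Longrightarrow> (px Z - px P) * w Z = w' Z * unif P Z ^ (if dy P = 0 then 2 else 1)"
    by (rule px_unif[OF P]) blast
  have "\<forall>\<^sub>F Z in cof. w Z * (px Z - px P) = w' Z * unif P Z powi (if dy P = 0 then 2 else 1)"
    using cof_aff
  proof eventually_elim
    case (elim Z)
    then show ?case
      using w(5)[of Z] by (simp add: mult.commute split: if_splits)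
  qed
  then show ?thesis
    using w P by (intro hord_affI)
qed

lemma hord_px_inf: "hord Infinity (\<lambda>Z. px Z - c) (-2)"
proof -
  have "hord Infinity (lin [:-c, 1:] 0) (- int (dg [:-c, 1:] 0))"
    by (rule hord_inf_lin) simp
  then show ?thesis
    by (simp add: dg_def lin_def[abs_def])
qed

subsection \<open>Values and pullbacks\<close>

text \<open>The value at P of a function known only up to finitely many points, read off from a
  local representation \<open>U / S\<close>; the number \<open>f P\<close> itself may be
  arbitrary.\<close>

definition val :: "'k ec_point \<Rightarrow> ('k ec_point \<Rightarrow> 'k) \<Rightarrow> 'k \<Rightarrow> bool" where
  "val P f c \<longleftrightarrow> P \<in> aff \<and> (\<exists>S U. reg S \<and> reg U \<and> S P \<noteq> 0 \<and> U P = c * S P \<and>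
     (\<forall>\<^sub>F Z in cof. S Z * f Z = U Z))"

lemma val_reg: "P \<in> aff \<Longrightarrow> reg f \<Longrightarrow> val P f (f P)"
  unfolding val_def by (intro conjI exI[of _ "\<lambda>Z. 1"] exI[of _ f]) simp_all

lemma val_const: "P \<in> aff \<Longrightarrow> val P (\<lambda>Z. c) c"
  using val_reg[of P "\<lambda>Z. c"] by simp

lemma val_aff: "val P f c \<Longrightarrow> P \<in> aff"
  by (simp add: val_def)

lemma val_add:
  assumes "val P f c" "val P g d"
  shows "val P (\<lambda>Z. f Z + g Z) (c + d)"
proof -
  from assms obtain S U S' U' where *: "P \<in> aff" "reg S" "reg U" "S P \<noteq> 0" "U P = c * S P"
    "\<forall>\<^sub>F Z in cof. S Z * f Z = U Z" "reg S'" "reg U'" "S' P \<noteq> 0" "U' P = d * S' P"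
    "\<forall>\<^sub>F Z in cof. S' Z * g Z = U' Z"
    unfolding val_def by blast
  have "\<forall>\<^sub>F Z in cof. (S Z * S' Z) * (f Z + g Z) = U Z * S' Z + U' Z * S Z"
    using *(6,11)
  proof eventually_elim
    case (elim Z)
    have "(S Z * S' Z) * (f Z + g Z) = (S Z * f Z) * S' Z + (S' Z * g Z) * S Z"
      by (simp add: algebra_simps)
    then show ?case unfolding elim .
  qed
  then show ?thesis
    unfolding val_def using *
    by (intro conjI exI[of _ "\<lambda>Z. S Z * S' Z"] exI[of _ "\<lambda>Z. U Z * S' Z + U' Z * S Z"])
      (simp_all add: algebra_simps)
qed

lemma val_mult:
  assumes "val P f c" "val P g d"
  shows "val P (\<lambda>Z. f Z * g Z) (c * d)"
proof -
  from assms obtain S U S' U' where *: "P \<in> aff" "reg S" "reg U" "S P \<noteq> 0" "U P = c * S P"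
    "\<forall>\<^sub>F Z in cof. S Z * f Z = U Z" "reg S'" "reg U'" "S' P \<noteq> 0" "U' P = d * S' P"
    "\<forall>\<^sub>F Z in cof. S' Z * g Z = U' Z"
    unfolding val_def by blast
  have "\<forall>\<^sub>F Z in cof. (S Z * S' Z) * (f Z * g Z) = U Z * U' Z"
    using *(6,11)
  proof eventually_elim
    case (elim Z)
    have "(S Z * S' Z) * (f Z * g Z) = (S Z * f Z) * (S' Z * g Z)"
      by (simp add: algebra_simps)
    then show ?case unfolding elim .
  qed
  then show ?thesis
    unfolding val_def using *
    by (intro conjI exI[of _ "\<lambda>Z. S Z * S' Z"] exI[of _ "\<lambda>Z. U Z * U' Z"])
      (simp_all add: algebra_simps)
qed

lemma val_uminus: "val P f c \<Longrightarrow> val P (\<lambda>Z. - f Z) (- c)"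
  using val_mult[OF val_const[of P "-1"], of f c] by (simp add: val_aff)

lemma val_diff: "val P f c \<Longrightarrow> val P g d \<Longrightarrow> val P (\<lambda>Z. f Z - g Z) (c - d)"
  using val_add[OF _ val_uminus, of P f c g d] by simp

lemma val_power: "val P f c \<Longrightarrow> val P (\<lambda>Z. f Z ^ n) (c ^ n)"
  by (induction n) (simp_all add: val_const val_mult val_aff)

lemma val_inverse:
  assumes "val P f c" "c \<noteq> 0"
  shows "val P (\<lambda>Z. inverse (f Z)) (inverse c)"
proof -
  from assms obtain S U where *: "P \<in> aff" "reg S" "reg U" "S P \<noteq> 0" "U P = c * S P"
    "\<forall>\<^sub>F Z in cof. S Z * f Z = U Z"
    unfolding val_def by blast
  have "U P \<noteq> 0" using * assms(2) by simp
  then have "\<forall>\<^sub>F Z in cof. U Z \<noteq> 0"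
    using reg_cases[OF *(3)] *(1) by blast
  with *(6) have "\<forall>\<^sub>F Z in cof. U Z * inverse (f Z) = S Z"
  proof eventually_elim
    case (elim Z)
    then have "f Z \<noteq> 0" by auto
    with elim(1) show ?case by (simp add: field_simps)
  qed
  then show ?thesis
    unfolding val_def using * assms(2)
    by (intro conjI exI[of _ U] exI[of _ S]) simp_all
qed

lemma val_divide: "val P f c \<Longrightarrow> val P g d \<Longrightarrow> d \<noteq> 0 \<Longrightarrow> val P (\<lambda>Z. f Z / g Z) (c / d)"
  using val_mult[OF _ val_inverse, of P f c g d] by (simp add: divide_inverse)

lemma val_cong:
  assumes "val P f c" "\<forall>\<^sub>F Z in cof. f Z = g Z"
  shows "val P g c"
proof -
  from assms obtain S U where *: "P \<in> aff" "reg S" "reg U" "S P \<noteq> 0" "U P = c * S P"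
    "\<forall>\<^sub>F Z in cof. S Z * f Z = U Z"
    unfolding val_def by blast
  have "\<forall>\<^sub>F Z in cof. S Z * g Z = U Z"
    using *(6) assms(2) by eventually_elim simp
  with * show ?thesis
    unfolding val_def by blast
qed

lemma val_poly: "val P f c \<Longrightarrow> val P (\<lambda>Z. poly p (f Z)) (poly p c)"
proof (induction p)
  case 0
  then show ?case by (simp add: val_const val_aff)
next
  case (pCons a p)
  then show ?case by (auto simp: val_aff intro!: val_add val_mult val_const)
qed

lemma hord_val_nonzero:
  assumes "val P f c" "c \<noteq> 0"
  shows "hord P f 0"
proof -
  from assms obtain S U where *: "P \<in> aff" "reg S" "reg U" "S P \<noteq> 0" "U P = c * S P"
    "\<forall>\<^sub>F Z in cof. S Z * f Z = U Z"
    unfolding val_def by blast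
  then show ?thesis
    using assms(2) by (intro hord_affI[where S = S and U = U]) simp_all
qed

lemma hord_val_zero:
  assumes "val P f 0" "nz f"
  obtains n where "n \<ge> 1" "hord P f n"
proof -
  from assms(1) obtain S U where *: "P \<in> aff" "reg S" "reg U" "S P \<noteq> 0" "U P = 0 * S P"
    "\<forall>\<^sub>F Z in cof. S Z * f Z = U Z"
    unfolding val_def by blast
  have S: "\<forall>\<^sub>F Z in cof. S Z \<noteq> 0"
    using reg_cases[OF *(2)] *(1,4) by blast
  then have "nz U"
    using *(6) assms(2)[unfolded nz_def] unfolding nz_def by eventually_elim auto
  then obtain n where n: "hord P U (int n)"
    using hord_ex_reg[OF *(1,3)] by blast
  have "hord P (\<lambda>Z. U Z / S Z) (int n - 0)"
    by (intro hord_divide n hord_reg_unit *)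
  moreover have "\<forall>\<^sub>F Z in cof. U Z / S Z = f Z"
    using S *(6) by eventually_elim (auto simp: field_simps)
  ultimately have "hord P f (int n - 0)"
    by (rule hord_cong)
  then show thesis
    using that[of "int n"] hord_reg_zero[OF *(1,3) _ n] *(5) by simp
qed

lemma hord_powi:
  assumes "hord P f n"
  shows "hord P (\<lambda>Z. f Z powi k) (k * n)"
proof (cases k rule: int_cases2)
  case (nonneg j)
  then show ?thesis using hord_power[OF assms, of j] by simp
next
  case (nonpos j)
  then show ?thesis
    using hord_inverse[OF hord_power[OF assms, of j]] by (simp add: power_int_minus)
qed

lemma cof_compose:
  assumes "filterlim \<phi> cof cof" "\<forall>\<^sub>F Z in cof. Q Z"
  shows "\<forall>\<^sub>F Z in cof. Q (\<phi> Z)"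
  using assms by (simp add: filterlim_iff)

lemma nz_compose:
  assumes "filterlim \<phi> cof cof" "nz f"
  shows "nz (\<lambda>Z. f (\<phi> Z))"
  using cof_compose[OF assms(1), of "\<lambda>Z. f Z \<noteq> 0"] assms(2) by (simp add: nz_def)

lemma val_reg_compose:
  assumes "filterlim \<phi> cof cof" "val P (\<lambda>Z. px (\<phi> Z)) (px Q)" "val P (\<lambda>Z. py (\<phi> Z)) (py Q)"
    "Q \<in> aff" "reg f"
  shows "val P (\<lambda>Z. f (\<phi> Z)) (f Q)"
proof -
  obtain a b where ab: "\<And>P. P \<in> aff \<Longrightarrow> f P = lin a b P"
    using assms(5) by (auto simp: reg_def)
  have "val P (\<lambda>Z. lin a b (\<phi> Z)) (lin a b Q)"
    unfolding lin_def by (intro val_add val_mult val_poly assms)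
  moreover have "\<forall>\<^sub>F Z in cof. lin a b (\<phi> Z) = f (\<phi> Z)"
    using cof_compose[OF assms(1) cof_aff] by eventually_elim (simp add: ab)
  ultimately show ?thesis
    unfolding ab[OF assms(4)] by (rule val_cong)
qed

text \<open>\<open>e\<close> is the ramification index, the order at P of the pulled back
  uniformizer of Q. Local units at Q have nonzero values at P after composition, so all other orders
  are multiplied by the same \<open>e\<close>.\<close>

lemma pullback:
  assumes lim: "filterlim \<phi> cof cof" and v: "val P (\<lambda>Z. px (\<phi> Z)) (px Q)"
    "val P (\<lambda>Z. py (\<phi> Z)) (py Q)" and Q: "Q \<in> aff"
  shows "\<exists>e\<ge>1. \<forall>f n. hord Q f n \<longrightarrow> hord P (\<lambda>Z. f (\<phi> Z)) (e * n)"
proof -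
  have "val P (\<lambda>Z. unif Q (\<phi> Z)) 0"
    using val_reg_compose[OF lim v Q reg_unif[of Q]] by simp
  then obtain e where e: "e \<ge> 1" "hord P (\<lambda>Z. unif Q (\<phi> Z)) e"
    using nz_compose[OF lim nz_unif] by (rule hord_val_zero)
  have "hord P (\<lambda>Z. f (\<phi> Z)) (e * n)" if f: "hord Q f n" for f n
  proof -
    obtain S U where *: "reg S" "reg U" "S Q \<noteq> 0" "U Q \<noteq> 0"
      "\<forall>\<^sub>F Z in cof. S Z * f Z = U Z * unif Q Z powi n"
      by (rule hord_affE[OF f Q])
    have S: "hord P (\<lambda>Z. S (\<phi> Z)) 0"
      using val_reg_compose[OF lim v Q *(1)] *(3) by (rule hord_val_nonzero)
    have U: "hord P (\<lambda>Z. U (\<phi> Z)) 0"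
      using val_reg_compose[OF lim v Q *(2)] *(4) by (rule hord_val_nonzero)
    have "hord P (\<lambda>Z. U (\<phi> Z) * unif Q (\<phi> Z) powi n / S (\<phi> Z)) (0 + n * e - 0)"
      by (intro hord_divide hord_mult hord_powi S U e)
    moreover have "\<forall>\<^sub>F Z in cof. U (\<phi> Z) * unif Q (\<phi> Z) powi n / S (\<phi> Z) = f (\<phi> Z)"
      using cof_compose[OF lim *(5)] hord_nz[OF S, unfolded nz_def]
      by eventually_elim (simp add: field_simps)
    ultimately have "hord P (\<lambda>Z. f (\<phi> Z)) (0 + n * e - 0)"
      by (rule hord_cong)
    then show ?thesis
      by (simp add: mult.commute)
  qed
  with e(1) show ?thesis by auto
qed

lemma rat_poly: "rat f \<Longrightarrow> rat (\<lambda>Z. poly p (f Z))"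
  by (induction p) simp_all

lemma rat_compose:
  assumes "filterlim \<phi> cof cof" "rat (\<lambda>Z. px (\<phi> Z))" "rat (\<lambda>Z. py (\<phi> Z))" "rat f"
  shows "rat (\<lambda>Z. f (\<phi> Z))"
proof -
  have *: "rat (\<lambda>Z. g (\<phi> Z))" if "reg g" for g
  proof -
    obtain a b where ab: "\<And>P. P \<in> aff \<Longrightarrow> g P = lin a b P"
      using \<open>reg g\<close> by (auto simp: reg_def)
    have "rat (\<lambda>Z. lin a b (\<phi> Z))"
      unfolding lin_def by (intro rat_add rat_mult rat_poly assms)
    moreover have "\<forall>\<^sub>F Z in cof. g (\<phi> Z) = lin a b (\<phi> Z)"
      using cof_compose[OF assms(1) cof_aff] by eventually_elim (simp add: ab)
    ultimately show ?thesis
      by (rule rat_cong)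
  qed
  from assms(4) obtain F G where FG: "reg F" "reg G" "\<forall>\<^sub>F P in cof. f P = F P / G P"
    unfolding rat_def by blast
  show ?thesis
    by (rule rat_cong[OF rat_divide[OF *[OF FG(1)] *[OF FG(2)]] cof_compose[OF assms(1) FG(3)]])
qed

text \<open>A rational inverse rules out ramification: the uniformizer at P is itself a pullback, so
  its order 1 is a multiple of \<open>e\<close>.\<close>

lemma pullback_bij:
  assumes "filterlim \<phi> cof cof" "val P (\<lambda>Z. px (\<phi> Z)) (px Q)"
    "val P (\<lambda>Z. py (\<phi> Z)) (py Q)" "Q \<in> aff" "P \<in> aff"
    and \<psi>: "filterlim \<psi> cof cof" "rat (\<lambda>Z. px (\<psi> Z))" "rat (\<lambda>Z. py (\<psi> Z))"
    and inv: "\<forall>\<^sub>F Z in cof. \<psi> (\<phi> Z) = Z"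
    and f: "hord Q f n"
  shows "hord P (\<lambda>Z. f (\<phi> Z)) n"
proof -
  obtain e where e: "e \<ge> 1" "\<And>f n. hord Q f n \<Longrightarrow> hord P (\<lambda>Z. f (\<phi> Z)) (e * n)"
    using pullback[OF assms(1-4)] by auto
  have "rat (\<lambda>Z. unif P (\<psi> Z))"
    by (rule rat_compose[OF \<psi>]) simp
  moreover have "nz (\<lambda>Z. unif P (\<psi> Z))"
    by (rule nz_compose[OF \<psi>(1) nz_unif])
  moreover have "Q \<in> points E"
    using assms(4) by (simp add: points_eq)
  ultimately obtain k where "hord Q (\<lambda>Z. unif P (\<psi> Z)) k"
    by (rule hord_ex)
  then have "hord P (\<lambda>Z. unif P (\<psi> (\<phi> Z))) (e * k)"
    by (rule e)
  moreover have "\<forall>\<^sub>F Z in cof. unif P (\<psi> (\<phi> Z)) = unif P Z"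
    using inv by eventually_elim simp
  ultimately have "hord P (unif P) (e * k)"
    by (rule hord_cong)
  then have "e * k = 1"
    using hord_unif[OF assms(5)] by (rule hord_unique)
  then have "e = 1"
    using e(1) by (simp add: zmult_eq_1_iff)
  then show ?thesis
    using e(2)[OF f] by simp
qed

lemma cof_neg: "filterlim neg cof cof"
  unfolding filterlim_iff
proof (intro allI impI)
  fix Q assume "eventually Q cof"
  then have "finite (neg ` {P \<in> aff. \<not> Q P})"
    by (simp add: eventually_cof)
  moreover have "{P \<in> aff. \<not> Q (neg P)} \<subseteq> neg ` {P \<in> aff. \<not> Q P}"
  proof
    fix P assume "P \<in> {P \<in> aff. \<not> Q (neg P)}"
    then show "P \<in> neg ` {P \<in> aff. \<not> Q P}"
      by (intro image_eqI[of _ _ "neg P"]) simp_all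
  qed
  ultimately show "\<forall>\<^sub>F P in cof. Q (neg P)"
    unfolding eventually_cof by (rule rev_finite_subset)
qed

lemma neg_points [simp]: "neg P \<in> points E \<longleftrightarrow> P \<in> points E"
  using neg_aff[of P] unfolding points_eq by (cases P) auto

lemma hord_neg_aff:
  assumes "hord P f n" "P \<in> aff"
  shows "hord (neg P) (\<lambda>Z. f (neg Z)) n"
proof (rule pullback_bij[where \<psi> = neg and Q = P])
  have *: "reg (\<lambda>Z. px (neg Z))" "reg (\<lambda>Z. py (neg Z))"
    using reg_neg[OF reg_px] reg_neg[OF reg_py] .
  show "rat (\<lambda>Z. px (neg Z))" "rat (\<lambda>Z. py (neg Z))"
    using reg_imp_rat * by blast+
  show "val (neg P) (\<lambda>Z. px (neg Z)) (px P)" "val (neg P) (\<lambda>Z. py (neg Z)) (py P)"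
    using val_reg[OF _ *(1), of "neg P"] val_reg[OF _ *(2), of "neg P"] assms(2) by simp_all
qed (use assms cof_neg in simp_all)

subsection \<open>Functions without poles\<close>

lemma nz_poly_px: "p \<noteq> 0 \<Longrightarrow> nz (\<lambda>Z. poly p (px Z))"
  using lin_cof_nz[of p 0] by (simp add: lin_def nz_def)

text \<open>Above a root r of the denominator the numerator a + b y must vanish at least to the
  ramification order of x. This forces both a and b to vanish at r, so that x - r can be
  cancelled.\<close>

lemma regular_step:
  assumes H: "reg H" "nz H" and n: "n \<noteq> 0" "poly n r = 0"
    and f: "\<forall>\<^sub>F Z in cof. f Z = H Z / poly n (px Z)"
    and pos: "\<And>P k. P \<in> aff \<Longrightarrow> hord P f k \<Longrightarrow> k \<ge> 0"
  shows "\<exists>H'. reg H' \<and> (\<forall>Z\<in>aff. H Z = (px Z - r) * H' Z)"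
proof -
  obtain a b where ab: "\<And>Z. Z \<in> aff \<Longrightarrow> H Z = lin a b Z"
    using H by (auto simp: reg_def)
  obtain P where P: "P \<in> aff" "px P = r"
    using point_over by blast
  obtain n' where n': "n = [:-r, 1:] * n'"
    using n(2) unfolding poly_eq_0_iff_dvd by (elim dvdE)
  have ord: "\<exists>k. hord R H k \<and> k \<ge> (if dy R = 0 then 2 else 1)" if R: "R \<in> aff" "px R = r" for R
  proof -
    have "n' \<noteq> 0" using n(1) n' by auto
    then obtain j where j: "hord R (\<lambda>Z. poly n' (px Z)) (int j)"
      using hord_ex_reg[OF R(1) reg_poly nz_poly_px] by blast
    have j': "hord R (\<lambda>Z. poly n (px Z)) ((if dy R = 0 then 2 else 1) + int j)"
      using hord_mult[OF hord_px[OF R(1)] j] by (simp add: n' R algebra_simps)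
    obtain k where k: "hord R H (int k)"
      by (rule hord_ex_reg[OF R(1) H])
    have "\<forall>\<^sub>F Z in cof. H Z / poly n (px Z) = f Z"
      using f by eventually_elim simp
    then have "hord R f (int k - ((if dy R = 0 then 2 else 1) + int j))"
      by (rule hord_cong[OF hord_divide[OF k j']])
    with pos[OF R(1)] have "int k - ((if dy R = 0 then 2 else 1) + int j) \<ge> 0"
      by blast
    with k show ?thesis
      by (intro exI[of _ "int k"]) auto
  qed
  have zero: "H R = 0" if R: "R \<in> aff" "px R = r" for R
  proof (rule ccontr)
    assume "H R \<noteq> 0"
    then have 0: "hord R H 0"
      using hord_reg_unit R H by blast
    obtain k where "hord R H k" "k \<ge> (if dy R = 0 then 2 else 1)"
      using ord[OF R] by blast
    then show False
      using hord_unique[OF 0, of k] by (simp split: if_splits)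
  qed
  have 1: "poly a r + poly b r * py P = 0"
    using zero[OF P] ab[OF P(1)] by (simp add: lin_def P)
  \<comment> \<open>In an unramified fibre H vanishes at two points with different ordinates, which
    separates a(r) from b(r). A ramified fibre has one point only, but there y - y_P has order 1 and
    x - x_P order 2, so an order of at least 2 excludes a term in y - y_P with unit
    coefficient.\<close>
  have b0: "poly b r = 0"
  proof (cases "dy P = 0")
    case False
    have "poly a r + poly b r * py (neg P) = 0"
      using zero[of "neg P"] ab[of "neg P"] P by (simp add: lin_def)
    with 1 have "poly b r * (py P - py (neg P)) = 0"
      by Groebner_Basis.algebra
    moreover have "py P - py (neg P) = dy P"
      using P by (simp add: py_neg dy_def)
    ultimately show ?thesis
      using False by simp
  next
    case True
    define g where "g = a + smult (py P) b"
    show ?thesis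
    proof (rule ccontr)
      assume b: "poly b r \<noteq> 0"
      have u: "unif P = (\<lambda>Z. py Z - py P)"
        using True by (simp add: unif_def[abs_def])
      have 2: "hord P (\<lambda>Z. poly b (px Z) * (py Z - py P)) (0 + 1)"
        using b P by (intro hord_mult hord_reg_unit hord_unif[of P, unfolded u]) simp_all
      have eq: "\<forall>\<^sub>F Z in cof. poly g (px Z) + poly b (px Z) * (py Z - py P) = H Z"
        using cof_aff by eventually_elim (simp add: ab g_def lin_def algebra_simps)
      obtain k where k: "hord P H k" "k \<ge> 2"
        using ord[OF P] True by auto
      have "hord P (\<lambda>Z. poly g (px Z) + poly b (px Z) * (py Z - py P)) 1"
      proof (cases "g = 0")
        case True
        then show ?thesis
          using 2 by simp
      next
        case False
        have "poly g r = 0"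
          using 1 by (simp add: g_def mult.commute)
        then obtain g' where g': "g = [:-r, 1:] * g'"
          unfolding poly_eq_0_iff_dvd by (elim dvdE)
        then have "g' \<noteq> 0" using False by auto
        then obtain j where j: "hord P (\<lambda>Z. poly g' (px Z)) (int j)"
          using hord_ex_reg[OF P(1) reg_poly nz_poly_px] by blast
        have "hord P (\<lambda>Z. poly g (px Z)) (2 + int j)"
          using hord_mult[OF hord_px[OF P(1)] j] True by (simp add: g' P algebra_simps)
        from hord_add'[OF this 2] show ?thesis
          by simp
      qed
      then have "hord P H 1"
        using eq by (rule hord_cong)
      then show False
        using hord_unique[OF k(1)] k(2) by fastforce
    qed
  qed
  with 1 have "poly a r = 0" by simp
  with b0 obtain a' b' where a'b': "a = [:-r, 1:] * a'" "b = [:-r, 1:] * b'"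
    unfolding poly_eq_0_iff_dvd by (elim dvdE)
  have "\<forall>Z\<in>aff. H Z = (px Z - r) * lin a' b' Z"
    using ab unfolding lin_def a'b' poly_mult by (simp add: algebra_simps)
  then show ?thesis
    using reg_lin by blast
qed

text \<open>Multiplying by the conjugate of the denominator turns the denominator into its norm, a
  polynomial in x, whose linear factors are then cancelled one at a time.\<close>

lemma no_affine_poles:
  assumes f: "rat f" "nz f" and pos: "\<forall>P\<in>aff. \<forall>k. hord P f k \<longrightarrow> k \<ge> 0"
  obtains a b where "a \<noteq> 0 \<or> b \<noteq> 0" "\<forall>\<^sub>F Z in cof. f Z = lin a b Z"
proof -
  have *: "\<exists>H'. reg H' \<and> (\<forall>\<^sub>F Z in cof. f Z = H' Z)"
    if "reg H" "nz H" "n \<noteq> 0" "\<forall>\<^sub>F Z in cof. f Z = H Z / poly n (px Z)" for H n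
    using that
  proof (induction "Polynomial.degree n" arbitrary: n H)
    case 0
    then obtain c where c: "n = [:c:]"
      using degree_eq_zeroE by metis
    then show ?case
      using 0 by (intro exI[of _ "\<lambda>Z. H Z * inverse c"]) (simp add: divide_inverse)
  next
    case (Suc d)
    then obtain r where r: "poly n r = 0"
      using alg_closed_imp_poly_has_root[of n] by auto
    then obtain n' where n': "n = [:-r, 1:] * n'"
      unfolding poly_eq_0_iff_dvd by (elim dvdE)
    have "\<exists>H'. reg H' \<and> (\<forall>Z\<in>aff. H Z = (px Z - r) * H' Z)"
      by (rule regular_step[OF Suc.prems(1-3) r Suc.prems(4)]) (use pos in blast)
    then obtain H' where H': "reg H'" "\<forall>Z\<in>aff. H Z = (px Z - r) * H' Z"
      by blast
    have "n' \<noteq> 0" using n' Suc.prems by auto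
    have "Polynomial.degree n = Suc (Polynomial.degree n')"
      unfolding n' using \<open>n' \<noteq> 0\<close> by (subst degree_mult_eq) auto
    then have "d = Polynomial.degree n'"
      using Suc(2) by simp
    moreover have "nz H'"
      using Suc.prems(2) cof_aff unfolding nz_def by eventually_elim (use H' in auto)
    moreover have "\<forall>\<^sub>F Z in cof. f Z = H' Z / poly n' (px Z)"
      using Suc.prems(4) cof_aff nz_px_diff[of r, unfolded nz_def]
    proof eventually_elim
      case (elim Z)
      have "poly n (px Z) = (px Z - r) * poly n' (px Z)"
        by (simp add: n' algebra_simps)
      with elim H'(2) show ?case by simp
    qed
    ultimately show ?case
      using Suc(1)[of n' H'] H'(1) \<open>n' \<noteq> 0\<close> by blast
  qed
  from f(1) obtain F G where FG: "reg F" "reg G" "nz G" "\<forall>\<^sub>F P in cof. f P = F P / G P"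
    unfolding rat_def by blast
  obtain c d where cd: "c \<noteq> 0 \<or> d \<noteq> 0" "\<And>Z. Z \<in> aff \<Longrightarrow> G Z = lin c d Z"
    by (rule nz_reg_lin[OF FG(2,3)]) blast
  have G': "\<forall>\<^sub>F P in cof. G (neg P) \<noteq> 0"
    using nz_compose[OF cof_neg FG(3)] by (simp add: nz_def)
  have 1: "\<forall>\<^sub>F Z in cof. f Z = F Z * G (neg Z) / poly (nrm c d) (px Z)"
    using FG(4) G' cof_aff
  proof eventually_elim
    case (elim Z)
    then show ?case
      using cd(2)[of Z] cd(2)[of "neg Z"] by (simp add: nrm_eval)
  qed
  have 2: "nz (\<lambda>Z. F Z * G (neg Z))"
    using FG(4) G' f(2) unfolding nz_def by eventually_elim auto
  have 3: "reg (\<lambda>Z. F Z * G (neg Z))"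
    using FG by simp
  obtain H where H: "reg H" "\<forall>\<^sub>F Z in cof. f Z = H Z"
    using *[OF 3 2 nrm_degree(1)[OF cd(1)] 1] by blast
  have "nz H"
    using H(2) f(2) unfolding nz_def by eventually_elim auto
  from nz_reg_lin[OF H(1) this] obtain a b where
    ab: "a \<noteq> 0 \<or> b \<noteq> 0" "\<And>Z. Z \<in> aff \<Longrightarrow> H Z = lin a b Z" by blast
  have "\<forall>\<^sub>F Z in cof. f Z = lin a b Z"
    using H(2) cof_aff by eventually_elim (simp add: ab)
  then show thesis
    using that ab(1) by blast
qed

lemma no_poles_const:
  assumes f: "rat f" "nz f" and pos: "\<forall>P\<in>points E. \<forall>k. hord P f k \<longrightarrow> k \<ge> 0"
  obtains c where "c \<noteq> 0" "\<forall>\<^sub>F Z in cof. f Z = c"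
proof -
  have pos': "\<forall>P\<in>aff. \<forall>k. hord P f k \<longrightarrow> k \<ge> 0"
    using pos by (auto simp: points_eq)
  obtain a b where ab: "a \<noteq> 0 \<or> b \<noteq> 0" "\<forall>\<^sub>F Z in cof. f Z = lin a b Z"
    by (rule no_affine_poles[OF f pos'])
  have "\<forall>\<^sub>F Z in cof. lin a b Z = f Z"
    using ab(2) by eventually_elim simp
  then have "hord Infinity f (- int (dg a b))"
    by (rule hord_cong[OF hord_inf_lin[OF ab(1)]])
  then have "dg a b = 0"
    using pos by (force simp: points_eq)
  then have "b = 0" "Polynomial.degree a = 0"
    by (auto simp: dg_def split: if_splits)
  then obtain c where "a = [:c:]"
    by (metis degree_eq_zeroE)
  then show thesis
    using that[of c] ab \<open>b = 0\<close> by (auto simp: lin_def)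
qed

subsection \<open>The degree of a function\<close>

definition rord :: "'k ec_point \<Rightarrow> ('k ec_point \<Rightarrow> 'k) \<Rightarrow> int" where
  "rord P f = (THE n. hord P f n)"

lemma rord_eq: "hord P f n \<Longrightarrow> rord P f = n"
  unfolding rord_def using hord_unique by blast

text \<open>The degree of the affine part of the divisor. The set \<open>A\<close> is any finite set
  containing the affine support, so the sums for two functions can be formed over a common
  set.\<close>

definition adeg :: "('k ec_point \<Rightarrow> 'k) \<Rightarrow> int \<Rightarrow> bool" where
  "adeg f d \<longleftrightarrow> (\<exists>A. finite A \<and> A \<subseteq> aff \<and> (\<forall>P\<in>aff. hord P f (rord P f)) \<and>
     (\<forall>P\<in>aff - A. rord P f = 0) \<and> (\<Sum>P\<in>A. rord P f) = d)"

lemma adegI: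
  assumes "finite A" "A \<subseteq> aff" "\<And>P. P \<in> aff \<Longrightarrow> hord P f (D P)" "\<And>P. P \<in> aff - A \<Longrightarrow> D P = 0"
    "(\<Sum>P\<in>A. D P) = d"
  shows "adeg f d"
proof -
  have *: "rord P f = D P" if "P \<in> aff" for P
    using rord_eq assms(3) that by blast
  have "(\<Sum>P\<in>A. rord P f) = (\<Sum>P\<in>A. D P)"
    using assms(2) * by (intro sum.cong) auto
  then show ?thesis
    unfolding adeg_def using assms * by (intro exI[of _ A]) auto
qed

lemma adegE:
  assumes "adeg f d"
  obtains A where "finite A" "A \<subseteq> aff" "\<forall>P\<in>aff. hord P f (rord P f)"
    "\<forall>P\<in>aff - A. rord P f = 0" "(\<Sum>P\<in>A. rord P f) = d"
  using assms unfolding adeg_def by blast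

lemma adeg_unique:
  assumes "adeg f d" "adeg f d'"
  shows "d = d'"
proof -
  obtain A where A: "finite A" "A \<subseteq> aff" "\<forall>P\<in>aff. hord P f (rord P f)"
    "\<forall>P\<in>aff - A. rord P f = 0" "(\<Sum>P\<in>A. rord P f) = d"
    using assms(1) by (rule adegE)
  obtain B where B: "finite B" "B \<subseteq> aff" "\<forall>P\<in>aff. hord P f (rord P f)"
    "\<forall>P\<in>aff - B. rord P f = 0" "(\<Sum>P\<in>B. rord P f) = d'"
    using assms(2) by (rule adegE)
  have "(\<Sum>P\<in>A. rord P f) = (\<Sum>P\<in>A \<union> B. rord P f)"
    using A B by (intro sum.mono_neutral_left) auto
  moreover have "(\<Sum>P\<in>B. rord P f) = (\<Sum>P\<in>A \<union> B. rord P f)"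
    using A B by (intro sum.mono_neutral_left) auto
  ultimately show ?thesis using A(5) B(5) by simp
qed

lemma adeg_mult:
  assumes "adeg f d" "adeg g d'"
  shows "adeg (\<lambda>Z. f Z * g Z) (d + d')"
proof -
  obtain A where A: "finite A" "A \<subseteq> aff" "\<forall>P\<in>aff. hord P f (rord P f)"
    "\<forall>P\<in>aff - A. rord P f = 0" "(\<Sum>P\<in>A. rord P f) = d"
    using assms(1) by (rule adegE)
  obtain B where B: "finite B" "B \<subseteq> aff" "\<forall>P\<in>aff. hord P g (rord P g)"
    "\<forall>P\<in>aff - B. rord P g = 0" "(\<Sum>P\<in>B. rord P g) = d'"
    using assms(2) by (rule adegE)
  have 1: "(\<Sum>P\<in>A. rord P f) = (\<Sum>P\<in>A \<union> B. rord P f)"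
    using A B by (intro sum.mono_neutral_left) auto
  have 2: "(\<Sum>P\<in>B. rord P g) = (\<Sum>P\<in>A \<union> B. rord P g)"
    using A B by (intro sum.mono_neutral_left) auto
  have 3: "(\<Sum>P\<in>A \<union> B. rord P f + rord P g) = d + d'"
    using 1 2 A(5) B(5) by (simp add: sum.distrib)
  show ?thesis
    by (rule adegI[OF _ _ _ _ 3]) (use A B in \<open>auto intro!: hord_mult\<close>)
qed

lemma adeg_inverse:
  assumes "adeg f d"
  shows "adeg (\<lambda>Z. inverse (f Z)) (- d)"
proof -
  obtain A where A: "finite A" "A \<subseteq> aff" "\<forall>P\<in>aff. hord P f (rord P f)"
    "\<forall>P\<in>aff - A. rord P f = 0" "(\<Sum>P\<in>A. rord P f) = d"
    using assms(1) by (rule adegE)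
  show ?thesis
    by (rule adegI[of A _ "\<lambda>P. - rord P f"]) (use A in \<open>auto intro!: hord_inverse simp: sum_negf\<close>)
qed

lemma adeg_cong:
  assumes "adeg f d" "\<forall>\<^sub>F Z in cof. f Z = g Z"
  shows "adeg g d"
proof -
  obtain A where A: "finite A" "A \<subseteq> aff" "\<forall>P\<in>aff. hord P f (rord P f)"
    "\<forall>P\<in>aff - A. rord P f = 0" "(\<Sum>P\<in>A. rord P f) = d"
    using assms(1) by (rule adegE)
  show ?thesis
    by (rule adegI[of A _ "\<lambda>P. rord P f"]) (use A assms(2) hord_cong in auto)
qed

lemma adeg_neg:
  assumes "adeg f d"
  shows "adeg (\<lambda>Z. f (neg Z)) d"
proof -
  obtain A where A: "finite A" "A \<subseteq> aff" "\<forall>P\<in>aff. hord P f (rord P f)"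
    "\<forall>P\<in>aff - A. rord P f = 0" "(\<Sum>P\<in>A. rord P f) = d"
    using assms(1) by (rule adegE)
  have h: "hord P (\<lambda>Z. f (neg Z)) (rord (neg P) f)" if "P \<in> aff" for P
    using hord_neg_aff[OF A(3)[rule_format], of "neg P"] that by simp
  have "inj_on neg A"
    by (metis inj_on_inverseI neg_neg)
  then have s: "(\<Sum>P\<in>neg ` A. rord (neg P) f) = d"
    using A(5) by (simp add: sum.reindex)
  have z: "rord (neg P) f = 0" if "P \<in> aff - neg ` A" for P
    using A(4) that by (metis Diff_iff image_eqI neg_aff neg_neg)
  show ?thesis
    by (rule adegI[OF _ _ h z s]) (use A in auto)
qed

lemma hord_px_sub:
  assumes "P \<in> aff"
  shows "hord P (\<lambda>Z. px Z - c) (if px P = c then if dy P = 0 then 2 else 1 else 0)"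
  using hord_px[OF assms] hord_reg_unit[OF assms, of "\<lambda>Z. px Z - c"] by auto

lemma dy_neg: "P \<in> aff \<Longrightarrow> dy (neg P) = - dy P"
  by (simp add: dy_def py_neg algebra_simps)

lemma adeg_px: "adeg (\<lambda>Z. px Z - c) 2"
proof -
  obtain P where P: "P \<in> aff" "px P = c"
    using point_over by blast
  have *: "Q = P \<or> Q = neg P" if "Q \<in> aff" "px Q = c" for Q
    using same_px P that by metis
  have s: "(\<Sum>Q\<in>{P, neg P}. if px Q = c then if dy Q = 0 then 2 else 1 else 0 :: int) = 2"
  proof (cases "dy P = 0")
    case True
    then show ?thesis
      using neg_eq_iff[OF P(1)] P by simp
  next
    case False
    then have "P \<noteq> neg P"
      using neg_eq_iff[OF P(1)] by metis
    then show ?thesis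
      using False P by (simp add: dy_neg)
  qed
  show ?thesis
    by (rule adegI[OF _ _ hord_px_sub _ s]) (use P * in auto)
qed

lemma adeg_const: "c \<noteq> 0 \<Longrightarrow> adeg (\<lambda>Z. c) 0"
  by (rule adegI[of "{}" _ "\<lambda>_. 0"]) (auto simp: points_eq intro!: hord_const)

lemma adeg_poly: "p \<noteq> 0 \<Longrightarrow> adeg (\<lambda>Z. poly p (px Z)) (2 * int (Polynomial.degree p))"
proof (induction "Polynomial.degree p" arbitrary: p)
  case 0
  then obtain c where "p = [:c:]"
    using degree_eq_zeroE by metis
  then show ?case
    using 0 by (simp add: adeg_const)
next
  case (Suc d)
  then obtain r where "poly p r = 0"
    using alg_closed_imp_poly_has_root[of p] by auto
  then obtain p' where p': "p = [:-r, 1:] * p'"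
    unfolding poly_eq_0_iff_dvd by (elim dvdE)
  have "p' \<noteq> 0" using p' Suc by auto
  have deg: "Polynomial.degree p = Suc (Polynomial.degree p')"
    unfolding p' using \<open>p' \<noteq> 0\<close> by (subst degree_mult_eq) auto
  have "adeg (\<lambda>Z. (px Z - r) * poly p' (px Z)) (2 + 2 * int (Polynomial.degree p'))"
    using adeg_mult[OF adeg_px[of r] Suc(1)[of p']] Suc(2) \<open>p' \<noteq> 0\<close> deg by simp
  then show ?case
    by (simp add: deg) (simp add: p' algebra_simps)
qed

text \<open>Conjugation preserves the affine degree, so twice the degree of a + b y is that of its
  norm, a polynomial in x of degree \<open>dg a b\<close>, each of whose roots contributes
  2.\<close>

lemma adeg_lin:
  assumes "a \<noteq> 0 \<or> b \<noteq> 0"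
  shows "adeg (lin a b) (int (dg a b))"
proof -
  have nz: "nz (lin a b)"
    using lin_cof_nz[OF assms] by (simp add: nz_def)
  define A where "A = {P \<in> aff. lin a b P = 0}"
  have A: "finite A"
    using lin_cof_nz[OF assms] by (simp add: eventually_cof A_def)
  have h: "hord P (lin a b) (rord P (lin a b))" if "P \<in> aff" for P
    using hord_ex_reg[OF that reg_lin nz] rord_eq by metis
  have z: "rord P (lin a b) = 0" if "P \<in> aff - A" for P
    using that hord_reg_unit[of P "lin a b"] by (intro rord_eq) (auto simp: A_def)
  define d where "d = (\<Sum>P\<in>A. rord P (lin a b))"
  have d: "adeg (lin a b) d"
    by (rule adegI[OF A _ h z d_def[symmetric]]) (auto simp: A_def)
  have "adeg (\<lambda>Z. lin a b Z * lin a b (neg Z)) (d + d)"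
    by (intro adeg_mult d adeg_neg)
  moreover have "\<forall>\<^sub>F Z in cof. lin a b Z * lin a b (neg Z) = poly (nrm a b) (px Z)"
    using cof_aff by eventually_elim (simp add: nrm_eval)
  ultimately have "adeg (\<lambda>Z. poly (nrm a b) (px Z)) (d + d)"
    by (rule adeg_cong)
  with adeg_poly[OF nrm_degree(1)[OF assms]] have "2 * int (dg a b) = d + d"
    unfolding nrm_degree(2)[OF assms] by (rule adeg_unique)
  then show ?thesis
    using d by simp
qed

text \<open>The divisor of a rational function has degree zero, because \<open>dg\<close> counts
  both the affine zeros of a + b y and its pole at infinity.\<close>

lemma degree_zero:
  assumes "rat f" "nz f"
  shows "adeg f (- rord Infinity f)"
proof -
  obtain n where n: "hord Infinity f n"
    using hord_ex[OF assms] points_eq by blast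
  obtain a b c d where *: "a \<noteq> 0 \<or> b \<noteq> 0" "c \<noteq> 0 \<or> d \<noteq> 0"
    "\<forall>\<^sub>F Z in cof. f Z * lin c d Z = lin a b Z" "n = int (dg c d) - int (dg a b)"
    using n by (rule hord_infE)
  have "adeg (\<lambda>Z. lin a b Z * inverse (lin c d Z)) (int (dg a b) + - int (dg c d))"
    by (intro adeg_mult adeg_inverse adeg_lin *)
  moreover have "\<forall>\<^sub>F Z in cof. lin a b Z * inverse (lin c d Z) = f Z"
    using *(3) lin_cof_nz[OF *(2)] by eventually_elim (simp add: field_simps)
  ultimately have "adeg f (int (dg a b) + - int (dg c d))"
    by (rule adeg_cong)
  then show ?thesis
    using rord_eq[OF n] *(4) by simp
qed

subsection \<open>Principal divisors and the group law\<close>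

definition delta :: "'k ec_point \<Rightarrow> 'k ec_point \<Rightarrow> int" where
  "delta P R = of_bool (R = P)"

definition prin :: "('k ec_point \<Rightarrow> int) \<Rightarrow> bool" where
  "prin D \<longleftrightarrow> (\<exists>f. \<forall>P\<in>points E. hord P f (D P))"

lemma prinI: "(\<And>P. P \<in> points E \<Longrightarrow> hord P f (D P)) \<Longrightarrow> prin D"
  unfolding prin_def by blast

lemma prin_add:
  assumes "prin D" "prin D'"
  shows "prin (\<lambda>P. D P + D' P)"
proof -
  obtain f g where "\<forall>P\<in>points E. hord P f (D P)" "\<forall>P\<in>points E. hord P g (D' P)"
    using assms unfolding prin_def by blast
  then show ?thesis
    by (intro prinI[of "\<lambda>Z. f Z * g Z"] hord_mult) auto
qed

lemma prin_diff:
  assumes "prin D" "prin D'"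
  shows "prin (\<lambda>P. D P - D' P)"
proof -
  obtain f g where "\<forall>P\<in>points E. hord P f (D P)" "\<forall>P\<in>points E. hord P g (D' P)"
    using assms unfolding prin_def by blast
  then show ?thesis
    by (intro prinI[of "\<lambda>Z. f Z / g Z"] hord_divide) auto
qed

lemma prin_0: "prin (\<lambda>P. 0)"
  by (intro prinI[of "\<lambda>Z. 1"] hord_const) auto

lemma prin_cong: "prin D \<Longrightarrow> (\<And>P. P \<in> points E \<Longrightarrow> D P = D' P) \<Longrightarrow> prin D'"
  unfolding prin_def by metis

lemma prin_vertical:
  assumes P: "P \<in> aff"
  shows "prin (\<lambda>R. delta P R + delta (neg P) R - 2 * delta Infinity R)"
proof (rule prinI[of "\<lambda>Z. px Z - px P"])
  fix R assume R: "R \<in> points E"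
  show "hord R (\<lambda>Z. px Z - px P) (delta P R + delta (neg P) R - 2 * delta Infinity R)"
  proof (cases "R = Infinity")
    case True
    have "P \<noteq> Infinity" "neg P \<noteq> Infinity"
      using P by (auto elim!: affE)
    then show ?thesis
      using True hord_px_inf[of "px P"] by (auto simp: delta_def)
  next
    case False
    then have R': "R \<in> aff"
      using R by (simp add: points_eq)
    have "(if px R = px P then if dy R = 0 then 2 else 1 else 0) = delta P R + delta (neg P) R"
    proof (cases "px R = px P")
      case True
      then have "R = P \<or> R = neg P"
        using same_px[OF P R'] by metis
      then show ?thesis
        using neg_eq_iff[OF P] dy_neg[OF P] True by (auto simp: delta_def)
    next
      case False
      then show ?thesis
        by (auto simp: delta_def)
    qed
    then show ?thesis
      using hord_px_sub[OF R', of "px P"] False by (simp add: delta_def)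
  qed
qed

text \<open>The divisor of the line is recovered from its norm, minus the cubic in x. Where
  \<open>dy R\<close> is nonzero only one of the two conjugate factors vanishes at R; where it is
  zero both have the same order, and this doubling cancels the ramification index 2 of x.\<close>

lemma prin_line:
  assumes cubic: "\<And>x. x ^ 3 + a2 * x ^ 2 + a4 * x + a6 - (l * x + c) ^ 2 - (a1 * x + a3) * (l * x + c) =
      (x - x1) * (x - x2) * (x - x3)"
  shows "prin (\<lambda>R. delta (Affine x1 (l * x1 + c)) R + delta (Affine x2 (l * x2 + c)) R +
      delta (Affine x3 (l * x3 + c)) R - 3 * delta Infinity R)"
proof -
  define F where "F Z = py Z - l * px Z - c" for Z
  have F_lin: "F = lin [:-c, -l:] 1"
    by (simp add: F_def[abs_def] lin_def[abs_def] algebra_simps)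
  have reg: "reg F"
    by (simp add: F_lin)
  have nz: "nz F"
    using lin_cof_nz[of "[:-c, -l:]" 1] by (simp add: nz_def F_lin)
  have nrm: "F Z * F (neg Z) = - ((px Z - x1) * (px Z - x2) * (px Z - x3))" if "Z \<in> aff" for Z
    using curve_eqn[OF that] unfolding cubic[symmetric] F_def py_neg[OF that] px_neg
    by Groebner_Basis.algebra
  have F_neg: "F (neg Z) = F Z - dy Z" if "Z \<in> aff" for Z
    by (simp add: F_def py_neg[OF that] dy_def)
  show ?thesis
  proof (rule prinI[of F])
    fix R assume R: "R \<in> points E"
    let ?k = "delta (Affine x1 (l * x1 + c)) R + delta (Affine x2 (l * x2 + c)) R +
      delta (Affine x3 (l * x3 + c)) R"
    show "hord R F (?k - 3 * delta Infinity R)"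
    proof (cases "R = Infinity")
      case True
      have "hord Infinity F (- int (dg [:-c, -l:] 1))"
        unfolding F_lin by (rule hord_inf_lin) simp
      moreover have "dg [:-c, -l:] 1 = 3"
        by (simp add: dg_def)
      ultimately show ?thesis
        using True by (simp add: delta_def)
    next
      case False
      then have R': "R \<in> aff"
        using R by (simp add: points_eq)
      have "hord R F ?k"
      proof (cases "F R = 0")
        case zero: False
        then have "?k = 0"
          by (auto simp: delta_def F_def)
        then show ?thesis
          using hord_reg_unit[OF R' reg zero] by simp
      next
        case zero: True
        obtain n where n: "hord R F (int n)"
          by (rule hord_ex_reg[OF R' reg nz])
        define e :: int where "e = (if dy R = 0 then 2 else 1)"
        have h: "hord R (\<lambda>Z. px Z - c) (if px R = c then e else 0)" for c
          unfolding e_def by (rule hord_px_sub[OF R'])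
        let ?m = "(if px R = x1 then e else 0) + (if px R = x2 then e else 0) + (if px R = x3 then e else 0)"
        have "hord R (\<lambda>Z. - ((px Z - x1) * (px Z - x2) * (px Z - x3))) ?m"
          by (intro hord_uminus hord_mult h)
        then have "hord R (\<lambda>Z. F Z * F (neg Z)) ?m"
          by (rule hord_cong) (use cof_aff in eventually_elim, simp add: nrm)
        moreover have "hord R (\<lambda>Z. F (neg Z)) (if dy R = 0 then int n else 0)"
        proof (cases "dy R = 0")
          case True
          then have "neg R = R"
            using neg_eq_iff[OF R'] by simp
          then show ?thesis
            using hord_neg_aff[OF n R'] True by simp
        next
          case dy: False
          then have "F (neg R) \<noteq> 0"
            using zero F_neg[OF R'] by simp
          then show ?thesis
            using dy hord_reg_unit[OF R', of "\<lambda>Z. F (neg Z)"] reg by simp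
        qed
        then have "hord R (\<lambda>Z. F Z * F (neg Z)) (int n + (if dy R = 0 then int n else 0))"
          by (rule hord_mult[OF n])
        ultimately have m: "?m = int n + (if dy R = 0 then int n else 0)"
          by (rule hord_unique)
        have "delta (Affine x (l * x + c)) R = of_bool (px R = x)" for x
          using zero R' by (auto simp: delta_def F_def elim!: affE)
        with m have "int n = ?k"
          by (auto simp: e_def split: if_splits)
        with n show ?thesis by simp
      qed
      then show ?thesis
        using False by (simp add: delta_def)
    qed
  qed
qed

text \<open>Translates the addition formula into geometry: a line of slope \<open>l\<close> through
  both points, whose third intersection is the negative of the sum, and the factorization of the
  cubic cut out by it.\<close>

lemma ec_add_aff:
  assumes P: "curve x1 y1" and Q: "curve x2 y2" and ne: "\<not> (x1 = x2 \<and> y1 + y2 + a1 * x2 + a3 = 0)"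
  shows "\<exists>l c x3. y1 = l * x1 + c \<and> y2 = l * x2 + c \<and>
      ec_add E (Affine x1 y1) (Affine x2 y2) = neg (Affine x3 (l * x3 + c)) \<and> curve x3 (l * x3 + c) \<and>
      (\<forall>x. x ^ 3 + a2 * x ^ 2 + a4 * x + a6 - (l * x + c) ^ 2 - (a1 * x + a3) * (l * x + c) =
      (x - x1) * (x - x2) * (x - x3))"
proof -
  define l where "l = (if x1 = x2 then (3 * x1 ^ 2 + 2 * a2 * x1 + a4 - a1 * y1) / (2 * y1 + a1 * x1 + a3)
      else (y2 - y1) / (x2 - x1))"
  define x3 where "x3 = l ^ 2 + a1 * l - a2 - x1 - x2"
  define c where "c = y1 - l * x1"
  have eq: "ec_add E (Affine x1 y1) (Affine x2 y2) = neg (Affine x3 (l * x3 + c))"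
    using ne unfolding ec_add.simps Let_def
    by (simp only: if_False flip: l_def x3_def) (simp add: c_def algebra_simps)
  \<comment> \<open>The formula for \<open>x3\<close> cancels the quadratic coefficient of this
    difference of two monic cubics, so \<open>D\<close> has degree at most 1. It vanishes
    identically once it vanishes at both abscissas, or to second order at one in the tangent
    case.\<close>
  define D where "D x = x ^ 3 + a2 * x ^ 2 + a4 * x + a6 - (l * x + c) ^ 2 - (a1 * x + a3) * (l * x + c) -
      (x - x1) * (x - x2) * (x - x3)" for x
  have y1: "y1 = l * x1 + c"
    by (simp add: c_def)
  have D1: "D x1 = 0"
    using P unfolding D_def curve_def y1 by Groebner_Basis.algebra
  have "y2 = l * x2 + c \<and> (\<forall>x. D x = 0)"
  proof (cases "x1 = x2")
    case False
    have "l * (x2 - x1) = y2 - y1"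
      using False by (simp add: l_def)
    then have y2: "y2 = l * x2 + c"
      unfolding c_def by Groebner_Basis.algebra
    have D2: "D x2 = 0"
      using Q unfolding D_def curve_def y2 by Groebner_Basis.algebra
    have "D x * (x2 - x1) = D x1 * (x2 - x) + D x2 * (x - x1)" for x
      unfolding D_def x3_def by Groebner_Basis.algebra
    then show ?thesis
      using y2 D1 D2 False by simp
  next
    case True
    have dbl: "y2 = y1"
      using same_px[of "Affine x1 y1" "Affine x2 y2"] P Q True ne by auto
    then have "2 * y1 + a1 * x1 + a3 \<noteq> 0"
      using ne True by (auto simp: algebra_simps)
    then have "l * (2 * y1 + a1 * x1 + a3) = 3 * x1 ^ 2 + 2 * a2 * x1 + a4 - a1 * y1"
      using True by (simp add: l_def)
    then have 0: "3 * x1 ^ 2 + 2 * a2 * x1 + a4 - a1 * (l * x1 + c) - l * (2 * (l * x1 + c) + a1 * x1 + a3) = 0"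
      unfolding y1 by simp
    have "D x = D x1 + (x - x1) * (3 * x1 ^ 2 + 2 * a2 * x1 + a4 - a1 * (l * x1 + c)
        - l * (2 * (l * x1 + c) + a1 * x1 + a3))" for x
      unfolding D_def x3_def True[symmetric] by Groebner_Basis.algebra
    then show ?thesis
      unfolding 0 D1 using dbl True y1 by simp
  qed
  then have y2: "y2 = l * x2 + c" and D: "\<And>x. D x = 0"
    by auto
  have "curve x3 (l * x3 + c)"
    using D[of x3] unfolding D_def curve_def by Groebner_Basis.algebra
  then show ?thesis
    using y1 y2 eq D unfolding D_def by (intro exI[of _ l] exI[of _ c] exI[of _ x3]) simp
qed

lemma ec_add_Infinity2 [simp]: "ec_add E P Infinity = P"
  by (cases P) auto

lemma ec_add_eq_Infinity:
  assumes "P \<in> points E" "Q \<in> points E"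
  shows "ec_add E P Q = Infinity \<longleftrightarrow> Q = neg P"
proof (cases "P = Infinity \<or> Q = Infinity")
  case True
  then show ?thesis
    by (cases P; cases Q) auto
next
  case False
  then obtain x1 y1 x2 y2 where *: "P = Affine x1 y1" "Q = Affine x2 y2" "curve x1 y1" "curve x2 y2"
    using assms by (auto simp: points_eq elim!: affE)
  show ?thesis
  proof (cases "x1 = x2 \<and> y1 + y2 + a1 * x2 + a3 = 0")
    case True
    then have "y2 = - y1 - a1 * x1 - a3"
      by (simp add: algebra_simps eq_neg_iff_add_eq_0)
    then show ?thesis
      using True * by simp
  next
    case False
    then have "ec_add E P Q \<noteq> Infinity"
      unfolding * ec_add.simps Let_def by simp
    then show ?thesis
      using False * by (auto simp: algebra_simps)
  qed
qed

lemma ec_add_closed_prin: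
  assumes "P \<in> points E" "Q \<in> points E"
  shows "ec_add E P Q \<in> points E"
    and "prin (\<lambda>R. delta P R + delta Q R - delta (ec_add E P Q) R - delta Infinity R)"
proof -
  have "ec_add E P Q \<in> points E \<and> prin (\<lambda>R. delta P R + delta Q R - delta (ec_add E P Q) R - delta Infinity R)"
  proof (cases "P = Infinity \<or> Q = Infinity")
    case True
    then show ?thesis
      using assms prin_0 by auto
  next
    case False
    then obtain x1 y1 x2 y2 where *: "P = Affine x1 y1" "Q = Affine x2 y2" "curve x1 y1" "curve x2 y2"
      using assms by (auto simp: points_eq elim!: affE)
    show ?thesis
    proof (cases "x1 = x2 \<and> y1 + y2 + a1 * x2 + a3 = 0")
      case True
      then have "ec_add E P Q = Infinity"
        by (simp add: *)
      moreover from this have "Q = neg P"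
        using ec_add_eq_Infinity assms by blast
      ultimately show ?thesis
        using prin_vertical[of P] * by (simp add: points_eq)
    next
      case False
      obtain l c x3 where l: "y1 = l * x1 + c" "y2 = l * x2 + c"
        "ec_add E (Affine x1 y1) (Affine x2 y2) = neg (Affine x3 (l * x3 + c))" "curve x3 (l * x3 + c)"
        "\<forall>x. x ^ 3 + a2 * x ^ 2 + a4 * x + a6 - (l * x + c) ^ 2 - (a1 * x + a3) * (l * x + c) =
          (x - x1) * (x - x2) * (x - x3)"
        using ec_add_aff[OF *(3,4) False] by blast
      let ?S = "Affine x3 (l * x3 + c)"
      have "prin (\<lambda>R. delta P R + delta Q R + delta ?S R - 3 * delta Infinity R)"
        unfolding * using prin_line[of l c x1 x2 x3] l(5) by (simp flip: l(1,2))
      moreover have "prin (\<lambda>R. delta ?S R + delta (neg ?S) R - 2 * delta Infinity R)"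
        using prin_vertical[of ?S] l(4) by simp
      ultimately have "prin (\<lambda>R. (delta P R + delta Q R + delta ?S R - 3 * delta Infinity R) -
          (delta ?S R + delta (neg ?S) R - 2 * delta Infinity R))"
        by (rule prin_diff)
      then have "prin (\<lambda>R. delta P R + delta Q R - delta (neg ?S) R - delta Infinity R)"
        by (rule prin_cong) simp
      then show ?thesis
        using l(3,4) * neg_points[of ?S] by (simp add: points_eq del: neg_simps)
    qed
  qed
  then show "ec_add E P Q \<in> points E"
    "prin (\<lambda>R. delta P R + delta Q R - delta (ec_add E P Q) R - delta Infinity R)"
    by auto
qed

text \<open>A function whose only pole is a simple one at infinity would be a + b y with
  \<open>dg a b = 1\<close>, but \<open>dg\<close> is even or at least 3. This gap expresses that
  the genus is one.\<close>

lemma prin_single: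
  assumes "P \<in> points E" "prin (\<lambda>R. delta P R - delta Infinity R)"
  shows "P = Infinity"
proof (rule ccontr)
  assume ne: "P \<noteq> Infinity"
  obtain f where f: "\<forall>R\<in>points E. hord R f (delta P R - delta Infinity R)"
    using assms(2) unfolding prin_def by blast
  have inf: "hord Infinity f (-1)"
    using f ne by (auto simp: points_eq delta_def)
  have "hord R f (delta P R)" if R: "R \<in> aff" for R
  proof -
    have "delta Infinity R = 0"
      using R by (auto simp: delta_def)
    moreover have "hord R f (delta P R - delta Infinity R)"
      using f R by (simp add: points_eq)
    ultimately show ?thesis by simp
  qed
  then have "\<forall>R\<in>aff. \<forall>k. hord R f k \<longrightarrow> k \<ge> 0"
    using hord_unique by (fastforce simp: delta_def)
  then obtain a b where ab: "a \<noteq> 0 \<or> b \<noteq> 0" "\<forall>\<^sub>F Z in cof. f Z = lin a b Z"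
    by (rule no_affine_poles[OF hord_rat[OF inf] hord_nz[OF inf]])
  have "hord Infinity (lin a b) (-1)"
    by (rule hord_cong[OF inf ab(2)])
  then have "- int (dg a b) = -1"
    by (rule hord_unique[OF hord_inf_lin[OF ab(1)]])
  then show False
    by (auto simp: dg_def max_def split: if_splits)
qed

text \<open>Adding the principal divisor (Q) + (-Q) - 2 (O) and collecting (P) + (-Q) by the group
  law leaves (P + (-Q)) - (O), so P + (-Q) = O.\<close>

lemma prin_eq:
  assumes "P \<in> points E" "Q \<in> points E" "prin (\<lambda>R. delta P R - delta Q R)"
  shows "P = Q"
proof -
  let ?S = "ec_add E P (neg Q)"
  have Q': "neg Q \<in> points E"
    using assms by simp
  have Q0: "ec_add E Q (neg Q) = Infinity"
    using ec_add_eq_Infinity assms(2) Q' by blast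
  have "prin (\<lambda>R. delta Q R + delta (neg Q) R - delta Infinity R - delta Infinity R)"
    using ec_add_closed_prin(2)[OF assms(2) Q'] unfolding Q0 .
  then have "prin (\<lambda>R. (delta P R - delta Q R) + (delta Q R + delta (neg Q) R - delta Infinity R - delta Infinity R))"
    by (rule prin_add[OF assms(3)])
  from prin_diff[OF this ec_add_closed_prin(2)[OF assms(1) Q']]
  have "prin (\<lambda>R. delta ?S R - delta Infinity R)"
    by (rule prin_cong) simp
  then have "?S = Infinity"
    by (rule prin_single[OF ec_add_closed_prin(1)[OF assms(1) Q']])
  then have "neg Q = neg P"
    using ec_add_eq_Infinity assms(1) Q' by blast
  then show ?thesis
    by (metis neg_neg)
qed

lemma ec_add_commute:
  assumes "P \<in> points E" "Q \<in> points E"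
  shows "ec_add E P Q = ec_add E Q P"
proof (rule prin_eq)
  from prin_diff[OF ec_add_closed_prin(2)[OF assms(2,1)] ec_add_closed_prin(2)[OF assms]]
  show "prin (\<lambda>R. delta (ec_add E P Q) R - delta (ec_add E Q P) R)"
    by (rule prin_cong) simp
qed (use ec_add_closed_prin(1) assms in auto)

lemma ec_add_assoc:
  assumes "P \<in> points E" "Q \<in> points E" "S \<in> points E"
  shows "ec_add E (ec_add E P Q) S = ec_add E P (ec_add E Q S)"
proof (rule prin_eq)
  note c = ec_add_closed_prin(1)
  note pr = ec_add_closed_prin(2)
  have 1: "prin (\<lambda>R. (delta P R + delta Q R - delta (ec_add E P Q) R - delta Infinity R) +
      (delta (ec_add E P Q) R + delta S R - delta (ec_add E (ec_add E P Q) S) R - delta Infinity R))"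
    by (intro prin_add pr c assms)
  have 2: "prin (\<lambda>R. (delta Q R + delta S R - delta (ec_add E Q S) R - delta Infinity R) +
      (delta P R + delta (ec_add E Q S) R - delta (ec_add E P (ec_add E Q S)) R - delta Infinity R))"
    by (intro prin_add pr c assms)
  from prin_diff[OF 2 1]
  show "prin (\<lambda>R. delta (ec_add E (ec_add E P Q) S) R - delta (ec_add E P (ec_add E Q S)) R)"
    by (rule prin_cong) simp
qed (use ec_add_closed_prin(1) assms in auto)

definition grp :: "'k ec_point monoid" where
  "grp = \<lparr>carrier = points E, monoid.mult = ec_add E, one = Infinity\<rparr>"

lemma grp_simps [simp]:
  "carrier grp = points E" "x \<otimes>\<^bsub>grp\<^esub> y = ec_add E x y" "\<one>\<^bsub>grp\<^esub> = Infinity"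
  by (simp_all add: grp_def)

lemma Infinity_in_points [simp]: "Infinity \<in> points E"
  by (simp add: points_eq)

sublocale G: comm_group grp
proof (rule comm_groupI)
  fix x assume x: "x \<in> carrier grp"
  then have "ec_add E x (neg x) = Infinity"
    using ec_add_eq_Infinity by simp
  then show "\<exists>y\<in>carrier grp. y \<otimes>\<^bsub>grp\<^esub> x = \<one>\<^bsub>grp\<^esub>"
    using x ec_add_commute[of x "neg x"] by (intro bexI[of _ "neg x"]) auto
next
  fix x y assume "x \<in> carrier grp" "y \<in> carrier grp"
  then show "x \<otimes>\<^bsub>grp\<^esub> y = y \<otimes>\<^bsub>grp\<^esub> x"
    by (simp add: ec_add_commute)
qed (auto simp: ec_add_closed_prin(1) ec_add_assoc)

lemma G_inv: "P \<in> points E \<Longrightarrow> inv\<^bsub>grp\<^esub> P = neg P"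
  using G.inv_equality[of "neg P" P] ec_add_eq_Infinity[of "neg P" P] by simp

subsection \<open>Translations\<close>

abbreviation pt_add (infixl "\<boxplus>" 65) where
  "P \<boxplus> Q \<equiv> ec_add E P Q"

lemma padd_closed [simp]: "P \<in> points E \<Longrightarrow> Q \<in> points E \<Longrightarrow> P \<boxplus> Q \<in> points E"
  by (rule ec_add_closed_prin)

lemma aff_points [simp]: "P \<in> aff \<Longrightarrow> P \<in> points E"
  by (simp add: points_eq)

lemma padd_neg [simp]: "P \<in> points E \<Longrightarrow> P \<boxplus> neg P = Infinity"
  by (simp add: ec_add_eq_Infinity)

lemma neg_padd [simp]: "P \<in> points E \<Longrightarrow> neg P \<boxplus> P = Infinity"
  by (simp add: ec_add_eq_Infinity)

lemma padd_left_commute: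
  "P \<in> points E \<Longrightarrow> Q \<in> points E \<Longrightarrow> R \<in> points E \<Longrightarrow> P \<boxplus> (Q \<boxplus> R) = Q \<boxplus> (P \<boxplus> R)"
  using ec_add_assoc[of P Q R] ec_add_assoc[of Q P R] ec_add_commute[of P Q] by simp

lemmas padd_ac = ec_add_assoc ec_add_commute padd_left_commute

lemma padd_cancel [simp]:
  assumes "P \<in> points E" "Q \<in> points E"
  shows "P \<boxplus> (neg P \<boxplus> Q) = Q" "neg P \<boxplus> (P \<boxplus> Q) = Q" "Q \<boxplus> P \<boxplus> neg P = Q" "Q \<boxplus> neg P \<boxplus> P = Q"
proof -
  show "P \<boxplus> (neg P \<boxplus> Q) = Q" "neg P \<boxplus> (P \<boxplus> Q) = Q"
    using assms by (simp_all flip: ec_add_assoc)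
  show "Q \<boxplus> P \<boxplus> neg P = Q" "Q \<boxplus> neg P \<boxplus> P = Q"
    using assms by (simp_all add: ec_add_assoc)
qed

lemma neg_add: "P \<in> points E \<Longrightarrow> Q \<in> points E \<Longrightarrow> neg (P \<boxplus> Q) = neg P \<boxplus> neg Q"
  using G.inv_mult[of P Q] by (simp add: G_inv)

lemma padd_right_inj:
  assumes "P \<in> points E" "Q \<in> points E" "R \<in> points E"
  shows "P \<boxplus> R = Q \<boxplus> R \<longleftrightarrow> P = Q"
  using G.right_cancel[of R P Q] assms by simp

lemma padd_eq_iff:
  assumes "P \<in> points E" "Q \<in> points E" "R \<in> points E"
  shows "P \<boxplus> Q = R \<longleftrightarrow> P = R \<boxplus> neg Q"
  using padd_cancel(3,4) assms by metis

lemma not_aff_iff: "P \<in> points E \<Longrightarrow> P \<notin> aff \<longleftrightarrow> P = Infinity"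
  by (auto simp: points_eq)

definition tau :: "'k ec_point \<Rightarrow> 'k ec_point \<Rightarrow> 'k ec_point" where
  "tau S Z = Z \<boxplus> S"

lemma cof_tau:
  assumes S: "S \<in> points E"
  shows "filterlim (tau S) cof cof"
  unfolding filterlim_iff
proof (intro allI impI)
  fix Q assume "eventually Q cof"
  then have "finite (tau (neg S) ` insert Infinity {P \<in> aff. \<not> Q P})"
    by (simp add: eventually_cof)
  moreover have "{P \<in> aff. \<not> Q (tau S P)} \<subseteq> tau (neg S) ` insert Infinity {P \<in> aff. \<not> Q P}"
  proof
    fix P assume P: "P \<in> {P \<in> aff. \<not> Q (tau S P)}"
    then have "tau S P \<in> insert Infinity {P \<in> aff. \<not> Q P}"
      using padd_closed[of P S] S by (auto simp: tau_def points_eq)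
    moreover have "P = tau (neg S) (tau S P)"
      using P S by (simp add: tau_def)
    ultimately show "P \<in> tau (neg S) ` insert Infinity {P \<in> aff. \<not> Q P}"
      by (rule rev_image_eqI)
  qed
  ultimately show "\<forall>\<^sub>F P in cof. Q (tau S P)"
    unfolding eventually_cof by (rule rev_finite_subset)
qed

definition sl :: "'k ec_point \<Rightarrow> 'k ec_point \<Rightarrow> 'k" where
  "sl S Z = (py S - py Z) / (px S - px Z)"

definition tx :: "'k ec_point \<Rightarrow> 'k ec_point \<Rightarrow> 'k" where
  "tx S Z = sl S Z ^ 2 + a1 * sl S Z - a2 - px Z - px S"

definition ty :: "'k ec_point \<Rightarrow> 'k ec_point \<Rightarrow> 'k" where
  "ty S Z = - (sl S Z + a1) * tx S Z - (py Z - sl S Z * px Z) - a3"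

lemma tau_formula:
  assumes "S \<in> aff" "Z \<in> aff" "px Z \<noteq> px S"
  shows "tau S Z = Affine (tx S Z) (ty S Z)"
  using assms by (auto elim!: affE simp: tau_def tx_def ty_def sl_def Let_def)

lemma tau_eventually:
  assumes "S \<in> aff"
  shows "\<forall>\<^sub>F Z in cof. px (tau S Z) = tx S Z \<and> py (tau S Z) = ty S Z"
  using cof_aff cof_px_neq[of "px S"] by eventually_elim (simp add: tau_formula[OF assms])

lemma rat_sl [simp]: "rat (sl S)"
  unfolding sl_def by simp

lemma rat_tx [simp]: "rat (tx S)"
  unfolding tx_def by simp

lemma rat_ty [simp]: "rat (ty S)"
  unfolding ty_def by simp

lemma rat_tau:
  assumes "S \<in> points E"
  shows "rat (\<lambda>Z. px (tau S Z))" "rat (\<lambda>Z. py (tau S Z))"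
proof -
  have "rat (\<lambda>Z. px (tau S Z)) \<and> rat (\<lambda>Z. py (tau S Z))"
  proof (cases "S = Infinity")
    case True
    then show ?thesis by (simp add: tau_def)
  next
    case False
    then have S: "S \<in> aff"
      using assms by (simp add: points_eq)
    have "\<forall>\<^sub>F Z in cof. px (tau S Z) = tx S Z" "\<forall>\<^sub>F Z in cof. py (tau S Z) = ty S Z"
      using tau_eventually[OF S] by (auto elim: eventually_mono)
    then show ?thesis
      using rat_cong[OF rat_tx[of S], of "\<lambda>Z. px (tau S Z)"]
        rat_cong[OF rat_ty[of S], of "\<lambda>Z. py (tau S Z)"] by simp
  qed
  then show "rat (\<lambda>Z. px (tau S Z))" "rat (\<lambda>Z. py (tau S Z))" by auto
qed

lemma rat_tau_compose: "S \<in> points E \<Longrightarrow> rat f \<Longrightarrow> rat (\<lambda>Z. f (tau S Z))"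
  by (rule rat_compose[OF cof_tau rat_tau])

lemma tau_tau: "P \<in> points E \<Longrightarrow> Q \<in> points E \<Longrightarrow> Z \<in> points E \<Longrightarrow> tau Q (tau P Z) = tau (P \<boxplus> Q) Z"
  by (simp add: tau_def ec_add_assoc)

lemma tau_tau_ev:
  assumes "P \<in> points E" "Q \<in> points E"
  shows "\<forall>\<^sub>F Z in cof. tau Q (tau P Z) = tau (P \<boxplus> Q) Z"
  using cof_aff by eventually_elim (simp add: tau_tau assms)

lemma tau_neg_ev:
  assumes "P \<in> points E"
  shows "\<forall>\<^sub>F Z in cof. tau (neg P) (tau P Z) = Z" "\<forall>\<^sub>F Z in cof. tau P (tau (neg P) Z) = Z"
  using cof_aff by (eventually_elim, simp add: tau_def assms)+

text \<open>Translation by S preserves orders at P. This is stated for individual pairs because the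
  chord formula gives it only where it has values; the remaining pairs follow by composition and
  inversion.\<close>

definition good :: "'k ec_point \<Rightarrow> 'k ec_point \<Rightarrow> bool" where
  "good S P \<longleftrightarrow> (\<forall>f n. hord (P \<boxplus> S) f n \<longrightarrow> hord P (\<lambda>Z. f (tau S Z)) n)"

lemma good_comp:
  assumes "good U P" "good V (P \<boxplus> U)" "U \<in> points E" "V \<in> points E" "P \<in> points E"
  shows "good (U \<boxplus> V) P"
  unfolding good_def
proof (intro allI impI)
  fix f n assume "hord (P \<boxplus> (U \<boxplus> V)) f n"
  then have "hord (P \<boxplus> U \<boxplus> V) f n"
    using assms by (simp add: ec_add_assoc)
  then have "hord (P \<boxplus> U) (\<lambda>Z. f (tau V Z)) n"
    using assms(2) by (simp add: good_def)
  then have "hord P (\<lambda>Z. f (tau V (tau U Z))) n"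
    using assms(1) unfolding good_def by blast
  moreover have "\<forall>\<^sub>F Z in cof. f (tau V (tau U Z)) = f (tau (U \<boxplus> V) Z)"
    using tau_tau_ev[OF assms(3,4)] by eventually_elim simp
  ultimately show "hord P (\<lambda>Z. f (tau (U \<boxplus> V) Z)) n"
    by (rule hord_cong)
qed

lemma good_inv:
  assumes "good S P" "S \<in> points E" "P \<in> points E"
  shows "good (neg S) (P \<boxplus> S)"
  unfolding good_def
proof (intro allI impI)
  fix f n assume "hord (P \<boxplus> S \<boxplus> neg S) f n"
  then have f: "hord P f n"
    using assms by simp
  have "rat (\<lambda>Z. f (tau (neg S) Z))"
    using assms hord_rat[OF f] by (intro rat_tau_compose) auto
  moreover have "nz (\<lambda>Z. f (tau (neg S) Z))"
    using assms hord_nz[OF f] by (intro nz_compose[OF cof_tau]) auto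
  moreover have "P \<boxplus> S \<in> points E"
    using assms by simp
  ultimately obtain k where k: "hord (P \<boxplus> S) (\<lambda>Z. f (tau (neg S) Z)) k"
    by (rule hord_ex)
  have "hord P (\<lambda>Z. f (tau (neg S) (tau S Z))) k"
    using assms(1) k unfolding good_def by blast
  moreover have "\<forall>\<^sub>F Z in cof. f (tau (neg S) (tau S Z)) = f Z"
    using tau_neg_ev(1)[OF assms(2)] by eventually_elim simp
  ultimately have "hord P f k"
    by (rule hord_cong)
  then have "k = n"
    using f by (rule hord_unique)
  with k show "hord (P \<boxplus> S) (\<lambda>Z. f (tau (neg S) Z)) n"
    by simp
qed

text \<open>With distinct abscissas the coordinates of Z + S have values at P, and translation by -S
  is a rational inverse, so no ramification occurs.\<close>

lemma good_chord:
  assumes P: "P \<in> aff" and S: "S \<in> aff" and ne: "px P \<noteq> px S"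
  shows "good S P"
  unfolding good_def
proof (intro allI impI)
  fix f n assume f: "hord (P \<boxplus> S) f n"
  have eq: "P \<boxplus> S = Affine (tx S P) (ty S P)"
    using tau_formula[OF S P ne] by (simp add: tau_def)
  then have Q: "P \<boxplus> S \<in> aff"
    using P S not_aff_iff[of "P \<boxplus> S"] by (metis aff_points ec_point.distinct(1) padd_closed)
  have "val P (\<lambda>Z. (py S - py Z) / (px S - px Z)) ((py S - py P) / (px S - px P))"
    using P ne by (intro val_divide val_diff val_const val_reg) simp_all
  then have sl: "val P (sl S) (sl S P)"
    by (simp add: sl_def[abs_def])
  then have tx: "val P (tx S) (tx S P)"
    unfolding tx_def[abs_def] using P
    by (intro val_diff val_add val_mult val_power val_const val_reg[OF _ reg_px]) simp_all
  have ty: "val P (ty S) (ty S P)"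
    unfolding ty_def[abs_def] using P sl tx
    by (intro val_diff val_add val_mult val_const val_reg[OF _ reg_px] val_reg[OF _ reg_py] val_uminus)
      simp_all
  have 1: "val P (\<lambda>Z. px (tau S Z)) (px (P \<boxplus> S))"
    unfolding eq px.simps
    by (rule val_cong[OF tx]) (use tau_eventually[OF S] in eventually_elim, simp)
  have 2: "val P (\<lambda>Z. py (tau S Z)) (py (P \<boxplus> S))"
    unfolding eq py.simps
    by (rule val_cong[OF ty]) (use tau_eventually[OF S] in eventually_elim, simp)
  have S': "S \<in> points E" "neg S \<in> points E"
    using S by simp_all
  show "hord P (\<lambda>Z. f (tau S Z)) n"
    by (rule pullback_bij[OF cof_tau[OF S'(1)] 1 2 Q P cof_tau[OF S'(2)] rat_tau[OF S'(2)]
          tau_neg_ev(1)[OF S'(1)] f])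
qed

text \<open>\<open>dy\<close> could vanish identically only in characteristic 2 with
  \<open>a1 = a3 = 0\<close>, and then the discriminant is zero. Hence x is generically unramified
  in characteristic 2 as well.\<close>

lemma nz_dy: "nz dy"
proof -
  have eq: "dy = lin [:a3, a1:] [:2:]"
    by (auto simp: dy_def[abs_def] lin_def[abs_def])
  have "a3 \<noteq> 0 \<or> a1 \<noteq> 0 \<or> (2::'k) \<noteq> 0"
  proof (rule ccontr)
    assume "\<not> ?thesis"
    then have z: "a3 = 0" "a1 = 0" "(2::'k) = 0"
      by auto
    have "(4::'k) = 2 * 2" "(8::'k) = 2 * 4"
      by simp_all
    then have "(4::'k) = 0" "(8::'k) = 0"
      unfolding z(3) by simp_all
    then have "discriminant E = 0"
      by (simp add: discriminant_def z)
    then show False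
      using nonsing by simp
  qed
  then show ?thesis
    unfolding eq nz_def by (intro lin_cof_nz) auto
qed

lemma finite_two_torsion: "finite {T \<in> points E. T \<boxplus> T = Infinity}"
proof -
  have "{T \<in> points E. T \<boxplus> T = Infinity} \<subseteq> insert Infinity {T \<in> aff. dy T = 0}"
  proof
    fix T assume T: "T \<in> {T \<in> points E. T \<boxplus> T = Infinity}"
    then have "T = neg T"
      using ec_add_eq_Infinity by auto
    then show "T \<in> insert Infinity {T \<in> aff. dy T = 0}"
      using T neg_eq_iff[of T] by (auto simp: points_eq)
  qed
  moreover have "finite {T \<in> aff. dy T = 0}"
    using nz_dy by (simp add: nz_def eventually_cof)
  ultimately show ?thesis
    using finite_subset by blast
qed

lemma finite_halves:
  assumes W: "W \<in> points E"
  shows "finite {U \<in> points E. U \<boxplus> U = W}"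
proof (cases "{U \<in> points E. U \<boxplus> U = W} = {}")
  case False
  then obtain U0 where U0: "U0 \<in> points E" "U0 \<boxplus> U0 = W"
    by blast
  have "{U \<in> points E. U \<boxplus> U = W} \<subseteq> (\<lambda>T. T \<boxplus> U0) ` {T \<in> points E. T \<boxplus> T = Infinity}"
  proof
    fix U assume U: "U \<in> {U \<in> points E. U \<boxplus> U = W}"
    let ?T = "U \<boxplus> neg U0"
    have "?T \<boxplus> ?T = (U \<boxplus> U) \<boxplus> (neg U0 \<boxplus> neg U0)"
    proof -
      have "U \<in> points E" using U by simp
      then show ?thesis
        using U0(1) by (simp add: padd_ac)
    qed
    also have "\<dots> = (U \<boxplus> U) \<boxplus> neg (U0 \<boxplus> U0)"
      using U0(1) by (simp add: neg_add)
    also have "\<dots> = Infinity"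
      using U U0 W by simp
    finally have "?T \<boxplus> ?T = Infinity" .
    then show "U \<in> (\<lambda>T. T \<boxplus> U0) ` {T \<in> points E. T \<boxplus> T = Infinity}"
      using U U0 by (intro image_eqI[of _ _ ?T]) auto
  qed
  then show ?thesis
    using finite_two_torsion finite_subset by blast
next
  case True
  then show ?thesis by (simp only: True) simp
qed

text \<open>S is written as U + V with U generic, so that both translations are by chords: first
  from P by U, then from P + U by V. The conditions on U exclude P and U with equal abscissa, V = O,
  and V = P + U; the case V = -(P + U) would give P + S = O.\<close>

lemma good_aff:
  assumes P: "P \<in> aff" and S: "S \<in> points E" and PS: "P \<boxplus> S \<in> aff"
  shows "good S P"
proof -
  have P': "P \<in> points E" using P by simp
  have 1: "\<forall>\<^sub>F U in cof. U \<boxplus> U \<noteq> S \<boxplus> neg P"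
  proof -
    have "finite {U \<in> points E. U \<boxplus> U = S \<boxplus> neg P}"
      using S P by (intro finite_halves) simp
    moreover have "{U \<in> aff. \<not> U \<boxplus> U \<noteq> S \<boxplus> neg P} \<subseteq> {U \<in> points E. U \<boxplus> U = S \<boxplus> neg P}"
      by auto
    ultimately show ?thesis
      unfolding eventually_cof by (rule rev_finite_subset)
  qed
  have "\<forall>\<^sub>F U in cof. U \<boxplus> U \<noteq> S \<boxplus> neg P \<and> px U \<noteq> px P \<and> U \<noteq> S"
    using 1 cof_px_neq[of "px P"] cof_neq[of S] by eventually_elim simp
  then obtain U where U: "U \<in> aff" "U \<boxplus> U \<noteq> S \<boxplus> neg P" "px U \<noteq> px P" "U \<noteq> S"
    by (rule cof_ex) blast
  have U': "U \<in> points E" using U by simp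
  define V where "V = S \<boxplus> neg U"
  have V': "V \<in> points E"
    using S U' by (simp add: V_def)
  have "V \<noteq> Infinity"
  proof
    assume "V = Infinity"
    then have "neg U = neg S"
      using ec_add_eq_Infinity[of S "neg U"] S U' by (simp add: V_def)
    then show False
      using U(4) by (metis neg_neg)
  qed
  then have V: "V \<in> aff"
    using V' by (simp add: points_eq)
  have UV: "U \<boxplus> V = S"
    using S U' by (simp add: V_def padd_ac)
  have PU: "P \<boxplus> U \<in> aff"
    using tau_formula[OF U(1) P] U(3) P' U' not_aff_iff[of "P \<boxplus> U"]
    by (metis ec_point.distinct(1) padd_closed tau_def)
  have "px (P \<boxplus> U) \<noteq> px V"
  proof
    assume "px (P \<boxplus> U) = px V"
    then have "V = P \<boxplus> U \<or> V = neg (P \<boxplus> U)"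
      using same_px[OF PU V] by simp
    then show False
    proof
      assume *: "V = P \<boxplus> U"
      then have "S = U \<boxplus> U \<boxplus> P"
        using UV P' U' by (simp add: padd_ac)
      then have "S \<boxplus> neg P = U \<boxplus> U"
        using P' U' by simp
      with U(2) show False by simp
    next
      assume "V = neg (P \<boxplus> U)"
      then have "P \<boxplus> U \<boxplus> V = Infinity"
        using P' U' by simp
      then have "P \<boxplus> S = Infinity"
        using UV P' U' V' by (simp add: ec_add_assoc)
      then show False
        using PS by simp
    qed
  qed
  then have "good (U \<boxplus> V) P"
    using U V P PU U' V' P' by (intro good_comp good_chord) auto
  then show ?thesis
    by (simp add: UV)
qed

lemma hord_add_reg:
  assumes f: "hord P f n" "n < 0" and r: "reg r" and P: "P \<in> aff"
  shows "hord P (\<lambda>Z. f Z + r Z) n"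
  using reg_cases[OF r]
proof
  assume 0: "\<forall>P\<in>aff. r P = 0"
  have "\<forall>\<^sub>F Z in cof. f Z = f Z + r Z"
    using cof_aff by eventually_elim (simp add: 0)
  then show ?thesis
    by (rule hord_cong[OF f(1)])
next
  assume "\<forall>\<^sub>F P in cof. r P \<noteq> 0"
  then obtain k where "hord P r (int k)"
    using hord_ex_reg[OF P r] by (auto simp: nz_def)
  then show ?thesis
    using hord_add[OF f(1)] f(2) by force
qed

lemma hord_poly:
  assumes f: "hord P f n" "n < 0" and P: "P \<in> aff" and "p \<noteq> 0"
  shows "hord P (\<lambda>Z. poly p (f Z)) (int (Polynomial.degree p) * n)"
  using \<open>p \<noteq> 0\<close>
proof (induction p)
  case (pCons c p)
  show ?case
  proof (cases "p = 0")
    case True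
    then show ?thesis
      using pCons P by (simp add: hord_const)
  next
    case False
    have "hord P (\<lambda>Z. f Z * poly p (f Z)) (n + int (Polynomial.degree p) * n)"
      using pCons False f by (intro hord_mult) auto
    moreover have "n + int (Polynomial.degree p) * n < 0"
      using f(2) by (simp add: add_neg_nonpos mult_nonneg_nonpos)
    ultimately have "hord P (\<lambda>Z. f Z * poly p (f Z) + c) (n + int (Polynomial.degree p) * n)"
      using P by (intro hord_add_reg) auto
    then show ?thesis
      using False by (simp add: algebra_simps)
  qed
qed simp

text \<open>Near \<open>- V\<close> the coordinates of \<open>Z + V\<close> have poles of order exactly 2 and 3, as \<open>x\<close> and \<open>y\<close> have at
  infinity.\<close>
lemma good_infinity_base:
  assumes V: "V \<in> aff" "dy V \<noteq> 0"
  shows "good V (neg V)"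
proof -
  let ?P = "neg V"
  have P: "?P \<in> aff"
    using V by simp
  have dyP: "dy ?P \<noteq> 0"
    using V by (simp add: dy_neg)
  have "hord ?P (\<lambda>Z. px Z - px V) 1"
    using hord_px[OF P] dyP by simp
  then have "hord ?P (\<lambda>Z. - (px Z - px V)) 1"
    by (rule hord_uminus)
  then have d: "hord ?P (\<lambda>Z. px V - px Z) 1"
    by simp
  have "py V - py ?P = dy V"
    using V by (simp add: py_neg dy_def)
  then have "hord ?P (\<lambda>Z. py V - py Z) 0"
    using V P by (intro hord_reg_unit) auto
  from hord_divide[OF this d] have sl: "hord ?P (sl V) (-1)"
    by (simp add: sl_def[abs_def])
  have sl1: "hord ?P (\<lambda>Z. sl V Z + a1) (-1)"
    using sl P by (intro hord_add_reg) auto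
  have "hord ?P (\<lambda>Z. sl V Z * (sl V Z + a1) + (- a2 - px Z - px V)) (-1 + -1)"
    using P by (intro hord_add_reg hord_mult sl sl1) auto
  then have tx: "hord ?P (tx V) (-2)"
    by (simp add: tx_def[abs_def] algebra_simps power2_eq_square)
  have "nz px"
    using nz_px_diff[of 0] by simp
  then obtain k where k: "hord ?P px (int k)"
    using hord_ex_reg[OF P reg_px] by blast
  have "hord ?P (\<lambda>Z. - ((sl V Z + a1) * tx V Z) + sl V Z * px Z) (-1 + -2)"
    by (rule hord_add[OF hord_uminus[OF hord_mult[OF sl1 tx]] hord_mult[OF sl k]]) simp
  then have "hord ?P (\<lambda>Z. - ((sl V Z + a1) * tx V Z) + sl V Z * px Z + (- py Z - a3)) (-1 + -2)"
    by (rule hord_add_reg) (use P in auto)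
  then have ty: "hord ?P (ty V) (-3)"
    by (simp add: ty_def[abs_def] algebra_simps)
  have lin: "hord ?P (\<lambda>Z. lin a b (tau V Z)) (- int (dg a b))" if ab: "a \<noteq> 0 \<or> b \<noteq> 0" for a b
  proof -
    have A: "hord ?P (\<lambda>Z. poly a (tx V Z)) (int (Polynomial.degree a) * -2)" if "a \<noteq> 0"
      using hord_poly[OF tx _ P that] by simp
    have B: "hord ?P (\<lambda>Z. poly b (tx V Z) * ty V Z) (int (Polynomial.degree b) * -2 + -3)" if "b \<noteq> 0"
      using hord_mult[OF hord_poly[OF tx _ P that] ty] by simp
    have "hord ?P (\<lambda>Z. poly a (tx V Z) + poly b (tx V Z) * ty V Z) (- int (dg a b))"
    proof (cases "a = 0 \<or> b = 0")
      case True
      then show ?thesis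
        using A B ab by (auto simp: dg_def mult.commute)
    next
      case False
      have "int (Polynomial.degree a) * -2 \<noteq> int (Polynomial.degree b) * -2 + -3"
        by presburger
      then consider "int (Polynomial.degree a) * -2 < int (Polynomial.degree b) * -2 + -3" |
        "int (Polynomial.degree b) * -2 + -3 < int (Polynomial.degree a) * -2"
        by linarith
      then show ?thesis
      proof cases
        case 1
        then have "dg a b = 2 * Polynomial.degree a"
          using False by (simp add: dg_def)
        then show ?thesis
          using hord_add[OF A B 1] False by (simp add: mult.commute)
      next
        case 2
        then have "dg a b = 2 * Polynomial.degree b + 3"
          using False by (simp add: dg_def)
        then show ?thesis
          using hord_add'[OF A B 2] False by (simp add: mult.commute)
      qed
    qed
    then show ?thesis
      by (rule hord_cong) (use tau_eventually[OF V(1)] in eventually_elim, simp add: lin_def)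
  qed
  show ?thesis
    unfolding good_def
  proof (intro allI impI)
    fix f n assume "hord (?P \<boxplus> V) f n"
    then have "hord Infinity f n"
      using V by simp
    then obtain a b c d where *: "a \<noteq> 0 \<or> b \<noteq> 0" "c \<noteq> 0 \<or> d \<noteq> 0"
      "\<forall>\<^sub>F Z in cof. f Z * lin c d Z = lin a b Z" "n = int (dg c d) - int (dg a b)"
      by (rule hord_infE)
    have cd: "\<forall>\<^sub>F Z in cof. lin c d (tau V Z) \<noteq> 0"
      using hord_nz[OF lin[OF *(2)]] by (simp add: nz_def)
    have V': "V \<in> points E" using V by simp
    have "hord ?P (\<lambda>Z. lin a b (tau V Z) / lin c d (tau V Z)) (- int (dg a b) - - int (dg c d))"
      by (intro hord_divide lin *)
    moreover have "\<forall>\<^sub>F Z in cof. lin a b (tau V Z) / lin c d (tau V Z) = f (tau V Z)"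
      using cof_compose[OF cof_tau[OF V'] *(3)] cd by eventually_elim (simp add: field_simps)
    ultimately have "hord ?P (\<lambda>Z. f (tau V Z)) (- int (dg a b) - - int (dg c d))"
      by (rule hord_cong)
    then show "hord ?P (\<lambda>Z. f (tau V Z)) n"
      by (simp add: *(4))
  qed
qed

text \<open>The point O is reached through an auxiliary point: first O to -V, inverting the explicit
  computation of poles at -V, then -V to S between affine points.\<close>

lemma good_Infinity:
  assumes S: "S \<in> points E"
  shows "good S Infinity"
proof (cases "S = Infinity")
  case True
  then show ?thesis
    by (simp add: good_def tau_def)
next
  case False
  then have S': "S \<in> aff"
    using S by (simp add: points_eq)
  obtain V where V: "V \<in> aff" "dy V \<noteq> 0"
    using nz_dy unfolding nz_def by (rule cof_ex)
  then have V': "V \<in> points E" by simp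
  have 1: "good (neg V) Infinity"
    using good_inv[OF good_infinity_base[OF V]] V' by simp
  have "neg V \<boxplus> (V \<boxplus> S) \<in> aff"
    using V' S S' by simp
  then have 2: "good (V \<boxplus> S) (Infinity \<boxplus> neg V)"
    using V V' S by (intro good_aff) auto
  have "good (neg V \<boxplus> (V \<boxplus> S)) Infinity"
    using V' S by (intro good_comp 1 2) auto
  then show ?thesis
    using V' S by simp
qed

lemma hord_tau:
  assumes S: "S \<in> points E" and P: "P \<in> points E" and f: "hord (P \<boxplus> S) f n"
  shows "hord P (\<lambda>Z. f (tau S Z)) n"
proof -
  have "good S P"
  proof (cases "P = Infinity")
    case True
    then show ?thesis using good_Infinity[OF S] by simp
  next
    case False
    then have P': "P \<in> aff" using P by (simp add: points_eq)
    show ?thesis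
    proof (cases "P \<boxplus> S = Infinity")
      case True
      then have "S = neg P"
        using ec_add_eq_Infinity S P by blast
      then show ?thesis
        using good_inv[OF good_Infinity[OF P]] P by simp
    next
      case False
      then show ?thesis
        using good_aff[OF P' S] P S not_aff_iff[of "P \<boxplus> S"] by auto
    qed
  qed
  then show ?thesis
    using f by (simp add: good_def)
qed

subsection \<open>Multiplication by \<open>m\<close>\<close>

lemma mult_0 [simp]: "ec_mult E 0 P = Infinity"
  by (simp add: ec_mult_def)

lemma mult_Suc: "ec_mult E (Suc n) P = P \<boxplus> ec_mult E n P"
  by (simp add: ec_mult_def)

lemma mult_1 [simp]: "ec_mult E (Suc 0) P = P"
  by (simp add: mult_Suc)

lemma mult_closed [simp]: "P \<in> points E \<Longrightarrow> ec_mult E n P \<in> points E"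
  by (induction n) (simp_all add: mult_Suc)

lemma mult_Infinity [simp]: "ec_mult E n Infinity = Infinity"
  by (induction n) (simp_all add: mult_Suc)

lemma mult_add: "P \<in> points E \<Longrightarrow> ec_mult E (a + b) P = ec_mult E a P \<boxplus> ec_mult E b P"
  by (induction a) (simp_all add: mult_Suc ec_add_assoc)

lemma mult_mult: "P \<in> points E \<Longrightarrow> ec_mult E (a * b) P = ec_mult E a (ec_mult E b P)"
  by (induction a) (simp_all add: mult_Suc mult_add)

lemma mult_distrib:
  assumes "P \<in> points E" "Q \<in> points E"
  shows "ec_mult E n (P \<boxplus> Q) = ec_mult E n P \<boxplus> ec_mult E n Q"
proof (induction n)
  case (Suc n)
  then show ?case
    using assms by (simp add: mult_Suc padd_ac)
qed simp

lemma mult_neg: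
  assumes "P \<in> points E"
  shows "ec_mult E n (neg P) = neg (ec_mult E n P)"
  by (induction n) (simp_all add: mult_Suc neg_add assms)

lemma Affine_px_py: "P \<in> aff \<Longrightarrow> P = Affine (px P) (py P)"
  by (auto elim!: affE)

text \<open>Induction on the generic point, with no division polynomials. Two rational coordinates
  agree almost everywhere or differ almost everywhere, so one branch of the addition formula applies
  generically; the tangent branch needs \<open>dy\<close> to be nonzero generically.\<close>

lemma mult_map_rational:
  "(\<forall>\<^sub>F Z in cof. ec_mult E n Z = Infinity) \<or>
   (\<exists>u v. rat u \<and> rat v \<and> (\<forall>\<^sub>F Z in cof. ec_mult E n Z = Affine (u Z) (v Z)))"
proof (induction n)
  case 0
  then show ?case by simp
next
  case (Suc n)
  show ?case
  proof (cases "\<forall>\<^sub>F Z in cof. ec_mult E n Z = Infinity")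
    case True
    then have "\<forall>\<^sub>F Z in cof. ec_mult E (Suc n) Z = Affine (px Z) (py Z)"
      using cof_aff
    proof eventually_elim
      case (elim Z)
      then show ?case
        using Affine_px_py[of Z] by (simp add: mult_Suc)
    qed
    then show ?thesis
      using reg_imp_rat[OF reg_px] reg_imp_rat[OF reg_py] by blast
  next
    case False
    then obtain u v where uv: "rat u" "rat v" "\<forall>\<^sub>F Z in cof. ec_mult E n Z = Affine (u Z) (v Z)"
      using Suc by blast
    have on: "\<forall>\<^sub>F Z in cof. ec_mult E (Suc n) Z = Affine (px Z) (py Z) \<boxplus> Affine (u Z) (v Z) \<and>
        Z \<in> aff \<and> Affine (u Z) (v Z) \<in> aff"
      using uv(3) cof_aff
    proof eventually_elim
      case (elim Z)
      have "ec_mult E n Z \<in> points E"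
        using elim(2) by simp
      then have "Affine (u Z) (v Z) \<in> aff"
        using elim by (simp add: points_eq)
      then show ?case
        using elim by (simp add: mult_Suc flip: Affine_px_py)
    qed
    have "rat (\<lambda>Z. u Z - px Z)"
      using uv by simp
    from rat_cases[OF this] show ?thesis
    proof
      assume eq: "\<forall>\<^sub>F Z in cof. u Z - px Z = 0"
      have "rat (\<lambda>Z. v Z - py Z)"
        using uv by simp
      from rat_cases[OF this] show ?thesis
      proof
        assume eq2: "\<forall>\<^sub>F Z in cof. v Z - py Z = 0"
        define l where "l Z = (3 * px Z ^ 2 + 2 * a2 * px Z + a4 - a1 * py Z) / (2 * py Z + a1 * px Z + a3)" for Z
        define x3 where "x3 Z = l Z ^ 2 + a1 * l Z - a2 - px Z - px Z" for Z
        define y3 where "y3 Z = - (l Z + a1) * x3 Z - (py Z - l Z * px Z) - a3" for Z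
        have "\<forall>\<^sub>F Z in cof. ec_mult E (Suc n) Z = Affine (x3 Z) (y3 Z)"
          using on eq eq2 nz_dy[unfolded nz_def]
        proof eventually_elim
          case (elim Z)
          then have "u Z = px Z" "v Z = py Z" by auto
          moreover have "py Z + py Z + a1 * px Z + a3 \<noteq> 0"
            using elim(4) unfolding dy_def mult_2 .
          ultimately show ?case
            using elim(1) by (simp add: Let_def x3_def y3_def l_def)
        qed
        moreover have "rat l"
          unfolding l_def[abs_def] by simp
        then have "rat x3"
          unfolding x3_def[abs_def] by simp
        moreover from this \<open>rat l\<close> have "rat y3"
          unfolding y3_def[abs_def] by simp
        ultimately show ?thesis by blast
      next
        assume "nz (\<lambda>Z. v Z - py Z)"
        then have "\<forall>\<^sub>F Z in cof. ec_mult E (Suc n) Z = Infinity"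
          using on eq unfolding nz_def
        proof eventually_elim
          case (elim Z)
          then have Q: "Z \<in> aff" "Affine (u Z) (v Z) \<in> aff" "px Z = px (Affine (u Z) (v Z))"
            and sum: "ec_mult E (Suc n) Z = Affine (px Z) (py Z) \<boxplus> Affine (u Z) (v Z)"
            by simp_all
          have "Affine (u Z) (v Z) \<noteq> Z"
            using elim(1) by (metis diff_self py.simps(2))
          then have "Affine (u Z) (v Z) = neg Z"
            using same_px[OF Q] by blast
          then show ?case
            unfolding sum Affine_px_py[OF Q(1), symmetric] using Q(1) by simp
        qed
        then show ?thesis ..
      qed
    next
      assume ne: "nz (\<lambda>Z. u Z - px Z)"
      define l where "l Z = (v Z - py Z) / (u Z - px Z)" for Z
      define x3 where "x3 Z = l Z ^ 2 + a1 * l Z - a2 - px Z - u Z" for Z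
      define y3 where "y3 Z = - (l Z + a1) * x3 Z - (py Z - l Z * px Z) - a3" for Z
      have "\<forall>\<^sub>F Z in cof. ec_mult E (Suc n) Z = Affine (x3 Z) (y3 Z)"
        using on ne[unfolded nz_def]
      proof eventually_elim
        case (elim Z)
        then have "px Z \<noteq> u Z" by auto
        then show ?case
          using elim(1) by (simp add: Let_def x3_def y3_def l_def)
      qed
      moreover have "rat l"
        unfolding l_def[abs_def] using uv by simp
      then have "rat x3"
        unfolding x3_def[abs_def] using uv by simp
      moreover from this \<open>rat l\<close> have "rat y3"
        unfolding y3_def[abs_def] by simp
      ultimately show ?thesis by blast
    qed
  qed
qed

text \<open>Otherwise the inverse of u - w would have no poles and would be constant. The zero found
  may lie at infinity.\<close>

lemma rat_takes_value:
  assumes u: "rat u" and nonconst: "\<And>w. nz (\<lambda>Z. u Z - w)"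
  obtains P k where "P \<in> points E" "k > 0" "hord P (\<lambda>Z. u Z - w) k"
proof (rule ccontr)
  assume no: "\<not> thesis"
  let ?f = "\<lambda>Z. inverse (u Z - w)"
  have f: "rat ?f" "nz ?f"
    using u nonconst[of w] by (auto simp: nz_def)
  have "\<forall>P\<in>points E. \<forall>k. hord P ?f k \<longrightarrow> k \<ge> 0"
  proof (intro ballI allI impI)
    fix P k assume P: "P \<in> points E" and k: "hord P ?f k"
    have "hord P (\<lambda>Z. inverse (?f Z)) (- k)"
      by (rule hord_inverse[OF k])
    then have "hord P (\<lambda>Z. u Z - w) (- k)"
      by simp
    then have "\<not> - k > 0"
      using no that[OF P] by blast
    then show "k \<ge> 0" by simp
  qed
  with f obtain c where c: "c \<noteq> 0" "\<forall>\<^sub>F Z in cof. ?f Z = c"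
    by (rule no_poles_const)
  have "\<forall>\<^sub>F Z in cof. False"
    using c(2) nonconst[of w, unfolded nz_def] nonconst[of "w + inverse c", unfolded nz_def]
  proof eventually_elim
    case (elim Z)
    then have "u Z - w = inverse c"
      by (metis inverse_inverse_eq)
    then show ?case
      using elim(3) by (simp add: algebra_simps)
  qed
  then show False
    using cof_ne_bot by simp
qed

lemma hord_shift_nonpos:
  assumes "hord P f n" "n < 0" "P \<in> points E"
  shows "hord P (\<lambda>Z. f Z - c) n"
proof (cases "c = 0")
  case False
  then show ?thesis
    using hord_add[OF assms(1) hord_const[OF assms(3), of "-c"]] assms(2) by simp
qed (use assms in simp)

lemma hord_shift_pos:
  assumes "hord P f n" "n > 0" "c \<noteq> 0"
  shows "hord P (\<lambda>Z. f Z + c) 0"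
  using hord_add'[OF assms(1) hord_const[OF hord_points[OF assms(1)] assms(3)] assms(2)] .

end

text \<open>The count \<open>m * m\<close> is an assumption here, supplied later by the bijection in
  the definition of a torsion basis; it takes the place of a computation of the degree of
  [m].\<close>

locale ell_tor = ell E for E :: "'k::alg_closed_field weierstrass" +
  fixes m :: nat
  assumes fin_tor: "finite (torsion E m)" and card_tor: "card (torsion E m) = m * m"
begin

abbreviation mu :: "'k ec_point \<Rightarrow> 'k ec_point" where
  "mu \<equiv> ec_mult E m"

lemma tor_iff: "P \<in> torsion E m \<longleftrightarrow> P \<in> points E \<and> mu P = Infinity"
  by (simp add: torsion_def)

lemma tor_points [simp]: "P \<in> torsion E m \<Longrightarrow> P \<in> points E"
  by (simp add: tor_iff)

lemma finite_mu_fibre: "finite {Z \<in> points E. mu Z = A}"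
proof (cases "{Z \<in> points E. mu Z = A} = {}")
  case False
  then obtain Z0 where Z0: "Z0 \<in> points E" "mu Z0 = A"
    by blast
  have "{Z \<in> points E. mu Z = A} \<subseteq> (\<lambda>R. R \<boxplus> Z0) ` torsion E m"
  proof
    fix Z assume Z: "Z \<in> {Z \<in> points E. mu Z = A}"
    then have "Z \<boxplus> neg Z0 \<in> torsion E m"
      using Z0 by (auto simp: tor_iff mult_distrib mult_neg)
    then show "Z \<in> (\<lambda>R. R \<boxplus> Z0) ` torsion E m"
      using Z Z0 by (intro image_eqI[of _ _ "Z \<boxplus> neg Z0"]) auto
  qed
  then show ?thesis
    using fin_tor finite_subset by blast
next
  case True
  then show ?thesis by (simp only: True) simp
qed

text \<open>The function \<open>x \<circ> [m]\<close> takes almost every value, so the image of \<open>[m]\<close> is a cofinite subgroup.\<close>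
lemma mu_surj:
  assumes T: "T \<in> points E"
  obtains Z where "Z \<in> points E" "mu Z = T"
proof -
  have "\<not> (\<forall>\<^sub>F Z in cof. mu Z = Infinity)"
  proof
    assume "\<forall>\<^sub>F Z in cof. mu Z = Infinity"
    then have "finite {Z \<in> aff. mu Z \<noteq> Infinity}"
      by (simp add: eventually_cof)
    moreover have "aff \<subseteq> {Z \<in> aff. mu Z \<noteq> Infinity} \<union> {Z \<in> points E. mu Z = Infinity}"
      by auto
    ultimately have "finite aff"
      using finite_mu_fibre[of Infinity] finite_subset by blast
    then show False
      using infinite_aff by simp
  qed
  then obtain u v where uv: "rat u" "rat v" "\<forall>\<^sub>F Z in cof. mu Z = Affine (u Z) (v Z)"
    using mult_map_rational[of m] by blast
  have nonconst: "nz (\<lambda>Z. u Z - w)" for w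
  proof (rule ccontr)
    assume no: "\<not> nz (\<lambda>Z. u Z - w)"
    have "rat (\<lambda>Z. u Z - w)"
      using uv(1) by simp
    then have "\<forall>\<^sub>F Z in cof. u Z - w = 0"
      using rat_cases[of "\<lambda>Z. u Z - w"] no by blast
    then have "\<forall>\<^sub>F Z in cof. mu Z \<in> {A \<in> aff. px A = w}"
      using uv(3) cof_aff
    proof eventually_elim
      case (elim Z)
      have "mu Z \<in> points E"
        using elim(3) by simp
      then show ?case
        using elim by (simp add: points_eq)
    qed
    then have "finite {Z \<in> aff. \<not> mu Z \<in> {A \<in> aff. px A = w}}"
      by (simp add: eventually_cof)
    moreover have "finite (\<Union>A\<in>{A \<in> aff. px A = w}. {Z \<in> points E. mu Z = A})"
      using finite_fibre finite_mu_fibre by blast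
    moreover have "aff \<subseteq> {Z \<in> aff. \<not> mu Z \<in> {A \<in> aff. px A = w}} \<union>
        (\<Union>A\<in>{A \<in> aff. px A = w}. {Z \<in> points E. mu Z = A})"
      by auto
    ultimately have "finite aff"
      by (meson finite_Un finite_subset)
    then show False
      using infinite_aff by simp
  qed
  have "\<exists>P. P \<in> points E \<and> (\<exists>k>0. hord P (\<lambda>Z. u Z - w) k)" for w
    by (rule rat_takes_value[OF uv(1) nonconst]) blast
  \<comment> \<open>A choice of a zero of u - w for each w. Different w have different zeros, so
    only finitely many w are lost to the exceptional set \<open>B\<close>, outside which the
    rational representation and the actual point \<open>mu Z\<close> agree.\<close>
  then obtain zr where zr: "\<And>w. zr w \<in> points E" "\<And>w. \<exists>k>0. hord (zr w) (\<lambda>Z. u Z - w) k"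
    by metis
  have inj: "inj zr"
  proof (rule injI, rule ccontr)
    fix w w' assume eq: "zr w = zr w'" and ne: "w \<noteq> w'"
    obtain k where k: "k > 0" "hord (zr w) (\<lambda>Z. u Z - w) k"
      using zr(2) by blast
    obtain k' where k': "k' > 0" "hord (zr w) (\<lambda>Z. u Z - w') k'"
      using zr(2)[of w'] eq by auto
    have "hord (zr w) (\<lambda>Z. (u Z - w) + (w - w')) 0"
      by (rule hord_shift_pos[OF k(2,1)]) (use ne in simp)
    then have "hord (zr w) (\<lambda>Z. u Z - w') 0"
      by simp
    from hord_unique[OF this k'(2)] k'(1) show False by simp
  qed
  from uv(1) obtain F H where FH: "reg F" "reg H" "nz H" "\<forall>\<^sub>F P in cof. u P = F P / H P"
    unfolding rat_def by blast
  define B where "B = insert Infinity {Z \<in> aff. \<not> (H Z \<noteq> 0 \<and> u Z = F Z / H Z \<and> mu Z = Affine (u Z) (v Z))}"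
  have "\<forall>\<^sub>F Z in cof. H Z \<noteq> 0 \<and> u Z = F Z / H Z \<and> mu Z = Affine (u Z) (v Z)"
    using FH(3)[unfolded nz_def] FH(4) uv(3) by eventually_elim simp
  then have B: "finite B"
    by (simp add: B_def eventually_cof)
  have val: "mu (zr w) = Affine w (v (zr w))" if "zr w \<notin> B" for w
  proof -
    let ?P = "zr w"
    have P: "?P \<in> aff" "H ?P \<noteq> 0" "u ?P = F ?P / H ?P" "mu ?P = Affine (u ?P) (v ?P)"
      using that zr(1)[of w] by (auto simp: B_def points_eq)
    have "F ?P - w * H ?P = 0"
    proof (rule ccontr)
      assume "F ?P - w * H ?P \<noteq> 0"
      then have "hord ?P (\<lambda>Z. (F Z - w * H Z) / H Z) (0 - 0)"
        using P FH by (intro hord_divide hord_reg_unit) simp_all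
      moreover have "\<forall>\<^sub>F Z in cof. (F Z - w * H Z) / H Z = u Z - w"
        using FH(4) FH(3)[unfolded nz_def] by eventually_elim (simp add: field_simps)
      ultimately have "hord ?P (\<lambda>Z. u Z - w) (0 - 0)"
        by (rule hord_cong)
      moreover obtain k where "k > 0" "hord ?P (\<lambda>Z. u Z - w) k"
        using zr(2) by blast
      ultimately show False
        using hord_unique by fastforce
    qed
    then have "u ?P = w"
      using P(2,3) by (simp add: field_simps)
    then show ?thesis
      using P(4) by simp
  qed
  define I where "I = mu ` points E"
  have "\<forall>\<^sub>F A in cof. A \<in> I"
  proof -
    have W: "finite {w. zr w \<in> B}"
      using finite_vimageI[OF B inj] by (simp add: vimage_def)
    have "A \<in> I" if A: "A \<in> aff" "zr (px A) \<notin> B" for A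
    proof -
      let ?P = "zr (px A)"
      have eq: "mu ?P = Affine (px A) (v ?P)"
        by (rule val[OF A(2)])
      have P: "?P \<in> points E"
        by (rule zr)
      have "mu ?P \<in> points E"
        using P by simp
      then have "mu ?P \<in> aff"
        by (simp add: eq points_eq)
      then have "A = mu ?P \<or> A = neg (mu ?P)"
        using same_px[of "mu ?P" A] A eq by simp
      then have "A = mu ?P \<or> A = mu (neg ?P)"
        using P by (simp add: mult_neg)
      then show ?thesis
        using P unfolding I_def by (metis image_eqI neg_points)
    qed
    then have "{A \<in> aff. A \<notin> I} \<subseteq> {A \<in> aff. px A \<in> {w. zr w \<in> B}}"
      by auto
    then show ?thesis
      unfolding eventually_cof using finite_px_in[OF W] by (rule finite_subset)
  qed note I = this
  \<comment> \<open>A subgroup with finite complement is everything: for almost every Z both Z and T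
    - Z lie in the image of [m], hence so does their sum T.\<close>
  have "\<forall>\<^sub>F Z in cof. tau T (neg Z) \<in> I"
    by (rule cof_compose[OF cof_neg cof_compose[OF cof_tau[OF T] I]])
  with I have "\<forall>\<^sub>F Z in cof. Z \<in> I \<and> tau T (neg Z) \<in> I"
    by eventually_elim simp
  then obtain Z where Z: "Z \<in> aff" "Z \<in> I" "neg Z \<boxplus> T \<in> I"
    unfolding tau_def by (rule cof_ex) blast
  obtain A B where AB: "A \<in> points E" "Z = mu A" "B \<in> points E" "neg Z \<boxplus> T = mu B"
    using Z(2,3) unfolding I_def by blast
  have "mu (A \<boxplus> B) = Z \<boxplus> (neg Z \<boxplus> T)"
    using AB by (simp add: mult_distrib)
  also have "\<dots> = T"
    using Z(1) T by simp
  finally show thesis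
    using that[of "A \<boxplus> B"] AB by simp
qed

subsection \<open>Functions with divisor \<open>[m]\<^sup>*(T) - [m]\<^sup>*(O)\<close>\<close>

lemma prin_translate:
  assumes "finite A" "A \<subseteq> points E" "T \<in> points E"
  shows "prin (\<lambda>R. (\<Sum>Q\<in>A. delta (Q \<boxplus> T) R - delta Q R) -
    (delta (ec_mult E (card A) T) R - delta Infinity R))"
  using assms(1,2)
proof (induction A)
  case empty
  then show ?case
    using prin_0 by simp
next
  case (insert Q A)
  let ?n = "card A"
  have 1: "prin (\<lambda>R. delta Q R + delta T R - delta (Q \<boxplus> T) R - delta Infinity R)"
    using insert assms by (intro ec_add_closed_prin) auto
  have 2: "prin (\<lambda>R. delta T R + delta (ec_mult E ?n T) R - delta (T \<boxplus> ec_mult E ?n T) R - delta Infinity R)"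
    using assms by (intro ec_add_closed_prin) auto
  have 3: "prin (\<lambda>R. (\<Sum>Q\<in>A. delta (Q \<boxplus> T) R - delta Q R) -
      (delta (ec_mult E ?n T) R - delta Infinity R))"
    using insert by simp
  from prin_add[OF 3 prin_diff[OF 2 1]] show ?case
    by (rule prin_cong) (use insert in \<open>simp add: mult_Suc\<close>)
qed

definition isg :: "'k ec_point \<Rightarrow> ('k ec_point \<Rightarrow> 'k) \<Rightarrow> bool" where
  "isg T g \<longleftrightarrow> (\<forall>P\<in>points E. hord P g (of_bool (mu P = T) - of_bool (mu P = Infinity)))"

text \<open>Let T = m T'. The fibre of [m] over T is the translate of E[m] by T', so its divisor
  minus E[m] is equivalent to (N T') - (O) with N the number of torsion points. Since N = m^2 and
  m^2 T' = m T = O, it is principal.\<close>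

lemma isg_ex:
  assumes T: "T \<in> torsion E m"
  obtains g where "isg T g"
proof -
  obtain T' where T': "T' \<in> points E" "mu T' = T"
    using mu_surj[of T] T by auto
  let ?A = "torsion E m"
  have "ec_mult E (card ?A) T' = mu (mu T')"
    unfolding card_tor by (rule mult_mult[OF T'(1)])
  also have "\<dots> = Infinity"
    using T T'(2) by (simp add: tor_iff)
  finally have 0: "ec_mult E (card ?A) T' = Infinity" .
  have "prin (\<lambda>R. (\<Sum>Q\<in>?A. delta (Q \<boxplus> T') R - delta Q R) - (delta (ec_mult E (card ?A) T') R - delta Infinity R))"
    by (rule prin_translate[OF fin_tor _ T'(1)]) auto
  then have "prin (\<lambda>R. of_bool (mu R = T) - of_bool (mu R = Infinity))"
  proof (rule prin_cong)
    fix R assume R: "R \<in> points E"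
    have "(\<Sum>Q\<in>?A. delta (Q \<boxplus> T') R) = (\<Sum>Q\<in>?A. if Q = R \<boxplus> neg T' then 1 else 0)"
    proof (rule sum.cong)
      fix Q assume "Q \<in> ?A"
      then show "delta (Q \<boxplus> T') R = (if Q = R \<boxplus> neg T' then 1 else 0)"
        using padd_eq_iff[of Q T' R] R T' by (auto simp: delta_def)
    qed simp
    also have "\<dots> = of_bool (R \<boxplus> neg T' \<in> ?A)"
      using fin_tor by simp
    also have "R \<boxplus> neg T' \<in> ?A \<longleftrightarrow> mu R = T"
      using R T' T ec_add_eq_Infinity[of "mu R" "neg T"] neg_neg
      by (auto simp: tor_iff mult_distrib mult_neg) (metis neg_neg)
    finally have 1: "(\<Sum>Q\<in>?A. delta (Q \<boxplus> T') R) = of_bool (mu R = T)" .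
    have 2: "(\<Sum>Q\<in>?A. delta Q R) = of_bool (mu R = Infinity)"
      using fin_tor R by (simp add: delta_def of_bool_def sum.delta tor_iff)
    show "(\<Sum>Q\<in>?A. delta (Q \<boxplus> T') R - delta Q R) - (delta (ec_mult E (card ?A) T') R - delta Infinity R) =
        of_bool (mu R = T) - of_bool (mu R = Infinity)"
      unfolding sum_subtractf 1 2 0 by simp
  qed
  then show thesis
    using that unfolding isg_def prin_def by blast
qed

lemma isgD: "isg T g \<Longrightarrow> P \<in> points E \<Longrightarrow> hord P g (of_bool (mu P = T) - of_bool (mu P = Infinity))"
  by (simp add: isg_def)

lemma isg_rat: "isg T g \<Longrightarrow> rat g" and isg_nz: "isg T g \<Longrightarrow> nz g"
  unfolding isg_def using hord_rat hord_nz Infinity_in_points by blast+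

lemma same_divisor:
  assumes "\<And>P. P \<in> points E \<Longrightarrow> hord P f (D P)" "\<And>P. P \<in> points E \<Longrightarrow> hord P g (D P)"
  obtains c where "c \<noteq> 0" "\<forall>\<^sub>F Z in cof. f Z = c * g Z"
proof -
  have h: "hord P (\<lambda>Z. f Z / g Z) (D P - D P)" if "P \<in> points E" for P
    by (intro hord_divide assms that)
  have "\<forall>P\<in>points E. \<forall>k. hord P (\<lambda>Z. f Z / g Z) k \<longrightarrow> k \<ge> 0"
    using hord_unique h by fastforce
  then obtain c where c: "c \<noteq> 0" "\<forall>\<^sub>F Z in cof. f Z / g Z = c"
    by (rule no_poles_const[OF hord_rat[OF h[OF Infinity_in_points]] hord_nz[OF h[OF Infinity_in_points]]])
  have "\<forall>\<^sub>F Z in cof. f Z = c * g Z"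
    using c(2) hord_nz[OF assms(2)[OF Infinity_in_points], unfolded nz_def]
    by eventually_elim (simp add: field_simps)
  then show thesis
    using that c(1) by blast
qed

lemma isg_tau:
  assumes "isg T g" "S \<in> torsion E m"
  shows "isg T (\<lambda>Z. g (tau S Z))"
  unfolding isg_def
proof
  fix P assume P: "P \<in> points E"
  have "mu (P \<boxplus> S) = mu P"
    using P assms(2) by (simp add: mult_distrib tor_iff)
  moreover have "hord (P \<boxplus> S) g (of_bool (mu (P \<boxplus> S) = T) - of_bool (mu (P \<boxplus> S) = Infinity))"
    using assms P by (simp add: isg_def)
  ultimately show "hord P (\<lambda>Z. g (tau S Z)) (of_bool (mu P = T) - of_bool (mu P = Infinity))"
    using P assms(2) by (intro hord_tau) auto
qed

lemma isg_unique:
  assumes "isg T f" "isg T g"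
  obtains c where "c \<noteq> 0" "\<forall>\<^sub>F Z in cof. f Z = c * g Z"
  by (rule same_divisor[of f "\<lambda>P. of_bool (mu P = T) - of_bool (mu P = Infinity)" g])
    (use assms in \<open>auto simp: isg_def\<close>)

text \<open>The Weil pairing as the multiplier of g under translation by S, required almost
  everywhere so that no point has to be chosen; \<open>weil_pairing_eq\<close> identifies it with
  the pointwise definition.\<close>

definition ep :: "'k ec_point \<Rightarrow> 'k ec_point \<Rightarrow> 'k" where
  "ep S T = (THE z. \<exists>g. isg T g \<and> (\<forall>\<^sub>F Z in cof. g (tau S Z) = z * g Z))"

lemma ep_eq:
  assumes S: "S \<in> points E" and g: "isg T g" "\<forall>\<^sub>F Z in cof. g (tau S Z) = z * g Z"
  shows "ep S T = z"
  unfolding ep_def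
proof (rule the_equality)
  fix z' assume "\<exists>g. isg T g \<and> (\<forall>\<^sub>F Z in cof. g (tau S Z) = z' * g Z)"
  then obtain h where h: "isg T h" "\<forall>\<^sub>F Z in cof. h (tau S Z) = z' * h Z"
    by blast
  obtain c where c: "c \<noteq> 0" "\<forall>\<^sub>F Z in cof. h Z = c * g Z"
    by (rule isg_unique[OF h(1) g(1)])
  have "\<forall>\<^sub>F Z in cof. z' = z"
    using h(2) g(2) c(2) cof_compose[OF cof_tau[OF S] c(2)] isg_nz[OF g(1), unfolded nz_def]
  proof eventually_elim
    case (elim Z)
    have "c * (z * g Z) = z' * (c * g Z)"
      using elim by simp
    then show ?case
      using elim(5) c(1) by simp
  qed
  then show "z' = z"
    using cof_const by blast
qed (use g in blast)

lemma ep_spec: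
  assumes "S \<in> torsion E m" "isg T g"
  shows "ep S T \<noteq> 0" "\<forall>\<^sub>F Z in cof. g (tau S Z) = ep S T * g Z"
proof -
  obtain c where c: "c \<noteq> 0" "\<forall>\<^sub>F Z in cof. g (tau S Z) = c * g Z"
    by (rule isg_unique[OF isg_tau[OF assms(2,1)] assms(2)])
  then have "ep S T = c"
    using assms by (intro ep_eq) auto
  with c show "ep S T \<noteq> 0" "\<forall>\<^sub>F Z in cof. g (tau S Z) = ep S T * g Z" by auto
qed

section \<open>Bilinearity and alternation of the pairing\<close>

lemma tor_add [simp]: "S \<in> torsion E m \<Longrightarrow> T \<in> torsion E m \<Longrightarrow> S \<boxplus> T \<in> torsion E m"
  by (simp add: tor_iff mult_distrib)

lemma tor_Infinity [simp]: "Infinity \<in> torsion E m"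
  by (simp add: tor_iff)

lemma tor_neg [simp]: "S \<in> torsion E m \<Longrightarrow> neg S \<in> torsion E m"
  by (simp add: tor_iff mult_neg)

lemma tor_mult [simp]: "S \<in> torsion E m \<Longrightarrow> ec_mult E n S \<in> torsion E m"
  by (induction n) (simp_all add: mult_Suc)

lemma ep_add_left:
  assumes "S \<in> torsion E m" "S' \<in> torsion E m" "T \<in> torsion E m"
  shows "ep (S \<boxplus> S') T = ep S T * ep S' T"
proof -
  obtain g where g: "isg T g"
    by (rule isg_ex[OF assms(3)])
  have SS: "S \<in> points E" "S' \<in> points E" "S \<boxplus> S' \<in> points E"
    using assms by simp_all
  have "\<forall>\<^sub>F Z in cof. g (tau (S \<boxplus> S') Z) = (ep S T * ep S' T) * g Z"
    using tau_tau_ev[OF SS(1,2)] ep_spec(2)[OF assms(1) g]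
      cof_compose[OF cof_tau[OF SS(1)] ep_spec(2)[OF assms(2) g]]
    by eventually_elim (simp add: mult_ac)
  then show ?thesis
    by (rule ep_eq[OF SS(3) g])
qed

text \<open>A function for T + T' is the product of one for T and a translate of one for T'.
  Translating by Q with m Q = -T puts the poles of the second factor on the zeros of the
  first.\<close>

lemma ep_add_right:
  assumes "S \<in> torsion E m" "T \<in> torsion E m" "T' \<in> torsion E m"
  shows "ep S (T \<boxplus> T') = ep S T * ep S T'"
proof -
  obtain g where g: "isg T g"
    by (rule isg_ex[OF assms(2)])
  obtain g' where g': "isg T' g'"
    by (rule isg_ex[OF assms(3)])
  obtain Q where Q: "Q \<in> points E" "mu Q = neg T"
    using mu_surj[of "neg T"] assms by auto
  have TT: "T \<in> points E" "T' \<in> points E" "mu T = Infinity" "mu T' = Infinity"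
    using assms by (simp_all add: tor_iff)
  have S: "S \<in> points E"
    using assms by simp
  define h where "h Z = g Z * g' (tau Q Z)" for Z
  have "isg (T \<boxplus> T') h"
    unfolding isg_def
  proof
    fix P assume P: "P \<in> points E"
    have eq: "mu (P \<boxplus> Q) = mu P \<boxplus> neg T"
      using P Q by (simp add: mult_distrib)
    have eq1: "mu P \<boxplus> neg T = T' \<longleftrightarrow> mu P = T \<boxplus> T'"
      using padd_eq_iff[of "mu P" "neg T" T'] P TT ec_add_commute[of T T'] by simp
    have eq2: "mu P \<boxplus> neg T = Infinity \<longleftrightarrow> mu P = T"
      using padd_eq_iff[of "mu P" "neg T" Infinity] P TT by simp
    have "hord (P \<boxplus> Q) g' (of_bool (mu P = T \<boxplus> T') - of_bool (mu P = T))"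
      using isgD[OF g' padd_closed[OF P Q(1)]] unfolding eq eq1 eq2 .
    then have 1: "hord P (\<lambda>Z. g' (tau Q Z)) (of_bool (mu P = T \<boxplus> T') - of_bool (mu P = T))"
      by (rule hord_tau[OF Q(1) P])
    have 2: "hord P g (of_bool (mu P = T) - of_bool (mu P = Infinity))"
      using g P by (simp add: isg_def)
    show "hord P h (of_bool (mu P = T \<boxplus> T') - of_bool (mu P = Infinity))"
      using hord_mult[OF 2 1] by (simp add: h_def[abs_def])
  qed
  moreover have "\<forall>\<^sub>F Z in cof. h (tau S Z) = (ep S T * ep S T') * h Z"
    using ep_spec(2)[OF assms(1) g] cof_compose[OF cof_tau[OF Q(1)] ep_spec(2)[OF assms(1) g']]
      tau_tau_ev[OF S Q(1)] tau_tau_ev[OF Q(1) S]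
  proof eventually_elim
    case (elim Z)
    have "tau Q (tau S Z) = tau S (tau Q Z)"
      using elim(3,4) ec_add_commute[OF S Q(1)] by simp
    then show ?case
      using elim(1,2) by (simp add: h_def)
  qed
  ultimately show ?thesis
    using S by (intro ep_eq) auto
qed

lemma hord_prod:
  fixes n :: nat
  assumes "\<And>i. i < n \<Longrightarrow> hord P (f i) (d i)" "P \<in> points E"
  shows "hord P (\<lambda>Z. \<Prod>i<n. f i Z) (\<Sum>i<n. d i)"
  using assms
proof (induction n)
  case 0
  then show ?case
    by (simp add: hord_const)
next
  case (Suc n)
  then have "hord P (\<lambda>Z. (\<Prod>i<n. f i Z) * f n Z) ((\<Sum>i<n. d i) + d n)"
    by (intro hord_mult) auto
  then show ?case by simp
qed

text \<open>The divisors of the translates of \<open>g\<close> by multiples of \<open>T'\<close>, where \<open>m T' = T\<close>, telescope.\<close>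
lemma ep_self:
  assumes T: "T \<in> torsion E m"
  shows "ep T T = 1"
proof -
  have TT: "T \<in> points E" "mu T = Infinity"
    using T by (simp_all add: tor_iff)
  obtain T' where T': "T' \<in> points E" "mu T' = T"
    using mu_surj[of T] T by auto
  obtain g where g: "isg T g"
    by (rule isg_ex[OF T])
  define G where "G i Z = g (tau (ec_mult E i T') Z)" for i Z
  define h where "h Z = (\<Prod>i<m. G i Z)" for Z
  have "hord P h 0" if P: "P \<in> points E" for P
  proof -
    define b :: "nat \<Rightarrow> int" where "b i = of_bool (mu P \<boxplus> ec_mult E i T = T)" for i
    have mu_i: "mu (P \<boxplus> ec_mult E i T') = mu P \<boxplus> ec_mult E i T" for i
      using P T' mult_mult[OF T'(1), of m i] mult_mult[OF T'(1), of i m]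
      by (simp add: mult_distrib mult.commute)
    have b_Suc: "b (Suc i) = of_bool (mu P \<boxplus> ec_mult E i T = Infinity)" for i
    proof -
      have "mu P \<boxplus> ec_mult E (Suc i) T = (mu P \<boxplus> ec_mult E i T) \<boxplus> T"
        using P TT by (simp add: mult_Suc padd_ac)
      moreover have "(mu P \<boxplus> ec_mult E i T) \<boxplus> T = Infinity \<boxplus> T \<longleftrightarrow> mu P \<boxplus> ec_mult E i T = Infinity"
        using P TT by (intro padd_right_inj) auto
      ultimately show ?thesis
        by (simp add: b_def)
    qed
    have "hord P (G i) (b i - b (Suc i))" for i
    proof -
      have "hord (P \<boxplus> ec_mult E i T') g (b i - b (Suc i))"
        using isgD[OF g padd_closed[OF P mult_closed[OF T'(1)]]] unfolding b_Suc unfolding b_def mu_i .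
      then show ?thesis
        unfolding G_def[abs_def] using P T' by (intro hord_tau) auto
    qed
    then have "hord P h (\<Sum>i<m. b i - b (Suc i))"
      unfolding h_def[abs_def] using P by (intro hord_prod) auto
    moreover have "(\<Sum>i<m. b i - b (Suc i)) = b 0 - b m"
      by (rule sum_lessThan_telescope')
    moreover have "b m = b 0"
      using TT P by (simp add: b_def)
    ultimately show ?thesis by simp
  qed note h0 = this
  obtain c where c: "c \<noteq> 0" "\<forall>\<^sub>F Z in cof. h Z = c * 1"
    by (rule same_divisor[of h "\<lambda>P. 0" "\<lambda>Z. 1"]) (use h0 hord_const in auto)
  have "\<forall>\<^sub>F Z in cof. g (tau T Z) = 1 * g Z"
    using c(2) cof_compose[OF cof_tau[OF T'(1)] c(2)] cof_aff
  proof eventually_elim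
    case (elim Z)
    have sh: "G i (tau T' Z) = G (Suc i) Z" for i
      using T' elim(3) tau_tau[of T' "ec_mult E i T'" Z] by (simp add: G_def mult_Suc)
    \<comment> \<open>Translation by \<open>T'\<close> shifts the index, so two products over 0,
      ..., m are compared. The constant \<open>h\<close> cancels, leaving the outer factors g(Z) and
      g(Z + T).\<close>
    have "G 0 Z * h (tau T' Z) = (\<Prod>i<Suc m. G i Z)"
      unfolding h_def sh by (rule prod.lessThan_Suc_shift[symmetric])
    also have "\<dots> = h Z * G m Z"
      by (simp add: h_def)
    finally have "G 0 Z = G m Z"
      using elim(1,2) c(1) by simp
    then show ?case
      using T'(2) by (simp add: G_def tau_def)
  qed
  then show ?thesis
    by (rule ep_eq[OF TT(1) g])
qed

end

context ell_tor
begin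

subsection \<open>Nondegeneracy\<close>

lemma hord_exists: "rat f \<Longrightarrow> nz f \<Longrightarrow> P \<in> points E \<Longrightarrow> \<exists>n. hord P f n"
  by (erule (2) hord_ex) blast

context
  fixes T g
  assumes T: "T \<in> torsion E m" "T \<noteq> Infinity" and g: "isg T g"
    and inv: "\<And>S. S \<in> torsion E m \<Longrightarrow> \<forall>\<^sub>F Z in cof. g (tau S Z) = g Z"
begin

lemma shift_pole:
  assumes "P \<in> torsion E m"
  shows "hord P (\<lambda>Z. g Z - w) (-1)"
proof -
  have "hord P g (-1)"
    using isgD[OF g, of P] assms T(2) by (simp add: tor_iff)
  then show ?thesis
    using assms by (intro hord_shift_nonpos) auto
qed

lemma shift_rat: "rat (\<lambda>Z. g Z - w)" and shift_nz: "nz (\<lambda>Z. g Z - w)"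
  using shift_pole[OF tor_Infinity] hord_rat hord_nz by blast+

lemma shift_nonneg:
  assumes P: "P \<in> points E" "P \<notin> torsion E m" and n: "hord P (\<lambda>Z. g Z - w) n"
  shows "n \<ge> 0"
proof -
  have *: "hord P g (of_bool (mu P = T))"
    using isgD[OF g P(1)] P by (simp add: tor_iff)
  show ?thesis
  proof (cases "w = 0")
    case True
    then have "n = of_bool (mu P = T)"
      using hord_unique[OF _ *] n by simp
    then show ?thesis by simp
  next
    case False
    have "hord P (\<lambda>Z. g Z + - w) n"
      using n by simp
    then have "min (of_bool (mu P = T)) 0 \<le> n"
      using hord_add_ge[OF * hord_const[OF P(1), of "- w"]] False by simp
    then show ?thesis by (auto split: if_splits)
  qed
qed

lemma shift_coset:
  assumes "hord P (\<lambda>Z. g Z - w) n" "R \<in> torsion E m"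
  shows "hord (P \<boxplus> R) (\<lambda>Z. g Z - w) n"
proof -
  have P: "P \<in> points E"
    using assms(1) by (rule hord_points)
  have "P \<boxplus> R \<in> points E"
    using P assms(2) by simp
  then obtain k where k: "hord (P \<boxplus> R) (\<lambda>Z. g Z - w) k"
    using hord_exists[OF shift_rat shift_nz] by blast
  have "hord P (\<lambda>Z. g (tau R Z) - w) k"
    using hord_tau[OF _ P k] assms(2) by simp
  moreover have "\<forall>\<^sub>F Z in cof. g (tau R Z) - w = g Z - w"
    using inv[OF assms(2)] by eventually_elim simp
  ultimately have "hord P (\<lambda>Z. g Z - w) k"
    by (rule hord_cong)
  then have "k = n"
    using assms(1) by (rule hord_unique)
  with k show ?thesis by simp
qed

text \<open>A degree count. The poles of g - w are the m^2 points of E[m], all simple because T is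
  not O. By invariance one zero P0 brings its whole coset, again m^2 points of the same order
  \<open>k \<ge> 1\<close>, and the degree formula leaves room neither for \<open>k > 1\<close> nor
  for further zeros.\<close>

lemma shift_divisor:
  assumes P0: "hord P0 (\<lambda>Z. g Z - w) k" "k \<ge> 1" and P: "P \<in> points E"
  shows "hord P (\<lambda>Z. g Z - w) (of_bool (P \<boxplus> neg P0 \<in> torsion E m) - of_bool (P \<in> torsion E m))"
proof -
  let ?f = "\<lambda>Z. g Z - w" and ?N = "m * m" and ?t = "torsion E m"
  have P0': "P0 \<in> points E"
    using P0(1) by (rule hord_points)
  have P0_tor: "P0 \<notin> ?t"
    using hord_unique[OF P0(1) shift_pole] P0(2) by fastforce
  define C where "C = (\<lambda>R. P0 \<boxplus> R) ` ?t"
  have C_iff: "Q \<in> C \<longleftrightarrow> Q \<boxplus> neg P0 \<in> ?t" if Q: "Q \<in> points E" for Q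
  proof
    assume "Q \<in> C"
    then obtain R where R: "R \<in> ?t" "Q = P0 \<boxplus> R"
      by (auto simp: C_def)
    then have "Q \<boxplus> neg P0 = R"
      using P0' ec_add_commute[of P0 R] by simp
    then show "Q \<boxplus> neg P0 \<in> ?t"
      using R by simp
  next
    assume R: "Q \<boxplus> neg P0 \<in> ?t"
    have "P0 \<boxplus> (Q \<boxplus> neg P0) = Q"
      using P0' Q ec_add_commute[of P0 "Q \<boxplus> neg P0"] by simp
    then show "Q \<in> C"
      using R unfolding C_def by (metis image_eqI)
  qed
  have C_tor: "C \<inter> ?t = {}"
  proof (rule ccontr)
    assume "C \<inter> ?t \<noteq> {}"
    then obtain R where R: "R \<in> ?t" "P0 \<boxplus> R \<in> ?t"
      by (auto simp: C_def)
    have "P0 \<boxplus> R \<boxplus> neg R \<in> ?t"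
      using tor_add[OF R(2) tor_neg[OF R(1)]] by simp
    moreover have "P0 \<boxplus> R \<boxplus> neg R = P0"
      using P0' R(1) by (intro padd_cancel) auto
    ultimately show False
      using P0_tor by simp
  qed
  have C_points: "C \<subseteq> points E"
    using P0' by (auto simp: C_def)
  have C_aff: "C \<subseteq> aff"
    using C_points C_tor tor_Infinity by (auto simp: points_eq)
  have fC: "finite C"
    using fin_tor by (simp add: C_def)
  have "inj_on (\<lambda>R. P0 \<boxplus> R) ?t"
    by (rule inj_onI) (metis P0' padd_cancel(2) tor_points)
  then have cC: "card C = ?N"
    by (simp add: C_def card_image card_tor)
  have rC: "rord Q ?f = k" if "Q \<in> C" for Q
    using that shift_coset[OF P0(1)] by (auto simp: C_def intro: rord_eq)
  have rt: "rord Q ?f = -1" if "Q \<in> ?t" for Q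
    using shift_pole[OF that] by (rule rord_eq)
  have "adeg ?f (- rord Infinity ?f)"
    by (rule degree_zero[OF shift_rat shift_nz])
  then have "adeg ?f 1"
    using rt[OF tor_Infinity] by simp
  then obtain A where A: "finite A" "A \<subseteq> aff" "\<forall>P\<in>aff. hord P ?f (rord P ?f)"
    "\<forall>P\<in>aff - A. rord P ?f = 0" "(\<Sum>P\<in>A. rord P ?f) = 1"
    by (rule adegE)
  \<comment> \<open>The simple pole at infinity is absent from the affine degree, which is therefore
    1 and is balanced against only \<open>m * m - 1\<close> affine poles.\<close>
  define t' where "t' = ?t - {Infinity}"
  have t'_aff: "t' \<subseteq> aff"
    using tor_points by (auto simp: t'_def points_eq)
  have ft': "finite t'" and ct': "card t' = ?N - 1"
    using fin_tor card_tor by (simp_all add: t'_def)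
  have N: "?N > 0"
    unfolding card_tor[symmetric] card_gt_0_iff using fin_tor tor_Infinity by blast
  define D where "D = A - (C \<union> t')"
  have fD: "finite D"
    using A by (simp add: D_def)
  have D_nonneg: "rord Q ?f \<ge> 0" if "Q \<in> D" for Q
  proof -
    have "Q \<in> aff" "Q \<notin> ?t"
      using that A by (auto simp: D_def t'_def)
    then show ?thesis
      using shift_nonneg[of Q w] A(3) by auto
  qed
  have "1 = (\<Sum>P\<in>A \<union> (C \<union> t'). rord P ?f)"
    unfolding A(5)[symmetric] using A fC ft' C_aff t'_aff by (intro sum.mono_neutral_left) auto
  also have "A \<union> (C \<union> t') = D \<union> (C \<union> t')"
    by (auto simp: D_def)
  also have "(\<Sum>P\<in>D \<union> (C \<union> t'). rord P ?f) = (\<Sum>P\<in>D. rord P ?f) + (\<Sum>P\<in>C \<union> t'. rord P ?f)"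
    using fD fC ft' by (intro sum.union_disjoint) (auto simp: D_def)
  also have "(\<Sum>P\<in>C \<union> t'. rord P ?f) = (\<Sum>P\<in>C. rord P ?f) + (\<Sum>P\<in>t'. rord P ?f)"
    using fC ft' C_tor by (intro sum.union_disjoint) (auto simp: t'_def)
  also have "(\<Sum>P\<in>C. rord P ?f) = int ?N * k"
    using rC cC by simp
  also have "(\<Sum>P\<in>t'. rord P ?f) = - int (?N - 1)"
    using rt ct' by (simp add: t'_def)
  finally have eq: "(\<Sum>P\<in>D. rord P ?f) + int ?N * (k - 1) = 0"
    using N by (simp add: of_nat_diff algebra_simps)
  have ge1: "(\<Sum>P\<in>D. rord P ?f) \<ge> 0"
    using D_nonneg by (rule sum_nonneg)
  have ge2: "int ?N * (k - 1) \<ge> 0"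
    using P0(2) by simp
  have s0: "(\<Sum>P\<in>D. rord P ?f) = 0" and "int ?N * (k - 1) = 0"
    using eq unfolding add_nonneg_eq_0_iff[OF ge1 ge2] by blast+
  then have k1: "k = 1"
    using N by simp
  have D0: "rord Q ?f = 0" if "Q \<in> D" for Q
    using sum_nonneg_eq_0_iff[OF fD, of "\<lambda>P. rord P ?f"] D_nonneg s0 that by blast
  obtain n where n: "hord P ?f n"
    using hord_exists[OF shift_rat shift_nz P] by blast
  have "n = of_bool (P \<in> C) - of_bool (P \<in> ?t)"
  proof (cases "P \<in> ?t")
    case True
    then show ?thesis
      using rt rord_eq[OF n] C_tor by auto
  next
    case False
    then have aff: "P \<in> aff"
      using P tor_Infinity by (auto simp: points_eq)
    show ?thesis
    proof (cases "P \<in> C")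
      case True
      then show ?thesis
        using rC rord_eq[OF n] False k1 by simp
    next
      case F: False
      then have "P \<in> D \<or> P \<in> aff - A"
        using False aff by (auto simp: D_def t'_def)
      then have "rord P ?f = 0"
        using D0 A(4) by blast
      then show ?thesis
        using rord_eq[OF n] False F by simp
    qed
  qed
  with n show ?thesis
    using C_iff[OF P] by simp
qed

text \<open>Invariance would make \<open>g\<close> a bijection from \<open>E / E[m]\<close> onto the projective line, on which translation
  by a point \<open>T'\<close> with \<open>m T' = T\<close> acts as a Moebius transformation without fixed points.\<close>
lemma invariant_contradiction: False
proof -
  have TT: "T \<in> points E" "mu T = Infinity"
    using T by (simp_all add: tor_iff)
  obtain T' where T': "T' \<in> points E" "mu T' = T"
    using mu_surj[of T] TT by auto
  let ?R = "neg T'"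
  have R: "?R \<in> points E"
    using T' by simp
  have muR: "mu ?R = neg T"
    using T' by (simp add: mult_neg)
  have negT: "neg T \<noteq> Infinity"
    using T(2) by (metis neg_neg neg_simps(1))
  have "?R \<noteq> Infinity"
    using muR negT by auto
  then have R_aff: "?R \<in> aff"
    using R by (simp add: points_eq)
  obtain j :: nat where j: "hord ?R g (int j)"
    using isgD[OF g R] muR negT by (metis (full_types) diff_zero of_bool_eq(1) of_nat_of_bool)
  obtain S U where SU: "reg S" "reg U" "S ?R \<noteq> 0" "U ?R \<noteq> 0"
    "\<forall>\<^sub>F Z in cof. S Z * g Z = U Z * unif ?R Z powi (int j)"
    by (rule hord_affE[OF j R_aff])
  \<comment> \<open>The value of g at -T'. The exponent \<open>j\<close> is 1 exactly if -T = T,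
    when g has a zero at -T' and \<open>c\<close> becomes 0; otherwise the power is 1.\<close>
  define c where "c = U ?R * unif ?R ?R ^ j / S ?R"
  have "val ?R g c"
    unfolding val_def c_def using SU R_aff
    by (intro conjI exI[of _ S] exI[of _ "\<lambda>Z. U Z * unif ?R Z ^ j"]) simp_all
  then have "val ?R (\<lambda>Z. g Z - c) 0"
    using val_diff[OF _ val_const[OF R_aff], of g c c] by simp
  then obtain k where k: "k \<ge> 1" "hord ?R (\<lambda>Z. g Z - c) k"
    using shift_nz by (rule hord_val_zero)
  have div_c: "hord P (\<lambda>Z. g Z - c) (of_bool (mu P = neg T) - of_bool (mu P = Infinity))"
    if P: "P \<in> points E" for P
  proof -
    have "P \<boxplus> T' \<in> torsion E m \<longleftrightarrow> mu P \<boxplus> T = Infinity"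
      using P T' by (simp add: tor_iff mult_distrib)
    also have "\<dots> \<longleftrightarrow> mu P = neg T"
      using padd_eq_iff[of "mu P" T Infinity] P TT by simp
    finally have "P \<boxplus> T' \<in> torsion E m \<longleftrightarrow> mu P = neg T" .
    then show ?thesis
      using shift_divisor[OF k(2,1) P] P by (simp add: tor_iff)
  qed
  have div_tau: "hord P (\<lambda>Z. g (tau T' Z)) (of_bool (mu P = Infinity) - of_bool (mu P = neg T))"
    if P: "P \<in> points E" for P
  proof -
    have eq: "mu (P \<boxplus> T') = mu P \<boxplus> T"
      using P T' by (simp add: mult_distrib)
    have eq1: "mu P \<boxplus> T = T \<longleftrightarrow> mu P = Infinity"
      using padd_eq_iff[of "mu P" T T] P TT by simp
    have eq2: "mu P \<boxplus> T = Infinity \<longleftrightarrow> mu P = neg T"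
      using padd_eq_iff[of "mu P" T Infinity] P TT by simp
    have "hord (P \<boxplus> T') g (of_bool (mu P = Infinity) - of_bool (mu P = neg T))"
      using isgD[OF g padd_closed[OF P T'(1)]] unfolding eq eq1 eq2 .
    then show ?thesis
      by (rule hord_tau[OF T'(1) P])
  qed
  \<comment> \<open>The zeros of the translated g are the poles of g - c and conversely, so the
    product is a constant. Thus translation by T' acts on the values of g by sending v to l / (v -
    c).\<close>
  obtain l where l: "l \<noteq> 0" "\<forall>\<^sub>F Z in cof. g (tau T' Z) * (g Z - c) = l * 1"
  proof (rule same_divisor[of "\<lambda>Z. g (tau T' Z) * (g Z - c)" "\<lambda>P. 0" "\<lambda>Z. 1"])
    fix P assume P: "P \<in> points E"
    show "hord P (\<lambda>Z. g (tau T' Z) * (g Z - c)) 0"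
      using hord_mult[OF div_tau[OF P] div_c[OF P]] by simp
    show "hord P (\<lambda>Z. 1) 0"
      using hord_const[OF P] by simp
  qed
  \<comment> \<open>The roots of \<open>p\<close> are the fixed points of this Moebius
    transformation.\<close>
  define p :: "'k poly" where "p = [:- l, - c, 1:]"
  have "Polynomial.degree p > 0"
    by (simp add: p_def)
  then obtain w where "poly p w = 0"
    using alg_closed_imp_poly_has_root by blast
  then have w: "w * (w - c) = l"
    by (simp add: p_def algebra_simps)
  then have w_ne: "w \<noteq> 0" "w \<noteq> c"
    using l(1) by auto
  obtain P0 k0 where P0: "P0 \<in> points E" "k0 > 0" "hord P0 (\<lambda>Z. g Z - w) k0"
    by (rule rat_takes_value[OF isg_rat[OF g] shift_nz])
  have "hord P0 (\<lambda>Z. (g Z - w) + (w - c)) 0"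
    by (rule hord_shift_pos[OF P0(3,2)]) (use w_ne in simp)
  then have 1: "hord P0 (\<lambda>Z. g Z - c) 0"
    by simp
  have "hord P0 (\<lambda>Z. (- w) * ((g Z - w) / (g Z - c))) (0 + (k0 - 0))"
    by (intro hord_mult hord_divide hord_const P0 1) (use w_ne in simp)
  moreover have "\<forall>\<^sub>F Z in cof. (- w) * ((g Z - w) / (g Z - c)) = g (tau T' Z) - w"
    using l(2) shift_nz[of c, unfolded nz_def]
  proof eventually_elim
    case (elim Z)
    then have "g (tau T' Z) = w * (w - c) / (g Z - c)"
      unfolding w by (simp add: field_simps)
    then show ?case
      using elim(2) by (simp add: field_simps)
  qed
  ultimately have 2: "hord P0 (\<lambda>Z. g (tau T' Z) - w) (0 + (k0 - 0))"
    by (rule hord_cong)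
  have PT: "P0 \<boxplus> T' \<in> points E"
    using P0 T' by simp
  have k0: "k0 \<ge> 1"
    using P0(2) by simp
  \<comment> \<open>Since w is fixed, P0 + T' is again a zero of g - w. The zeros form a single
    coset of E[m], so T' lies in E[m] and T = m T' = O.\<close>
  have "hord (P0 \<boxplus> T') (\<lambda>Z. g Z - w)
      (of_bool (P0 \<boxplus> T' \<boxplus> neg P0 \<in> torsion E m) - of_bool (P0 \<boxplus> T' \<in> torsion E m))"
    by (rule shift_divisor[OF P0(3) k0 PT])
  from hord_unique[OF hord_tau[OF T'(1) P0(1) this] 2]
  have "P0 \<boxplus> T' \<boxplus> neg P0 \<in> torsion E m"
    using P0(2) by (auto simp: of_bool_def split: if_splits)
  moreover have "P0 \<boxplus> T' \<boxplus> neg P0 = T'"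
    using P0(1) T'(1) ec_add_commute[of P0 T'] by simp
  ultimately have "mu T' = Infinity"
    by (simp add: tor_iff)
  then show False
    using T' T(2) by simp
qed

end

lemma ep_nondegenerate:
  assumes T: "T \<in> torsion E m" and triv: "\<And>S. S \<in> torsion E m \<Longrightarrow> ep S T = 1"
  shows "T = Infinity"
proof (rule ccontr)
  assume ne: "T \<noteq> Infinity"
  obtain g where g: "isg T g"
    by (rule isg_ex[OF T])
  have "\<forall>\<^sub>F Z in cof. g (tau S Z) = g Z" if "S \<in> torsion E m" for S
    using ep_spec(2)[OF that g] triv[OF that] by simp
  then show False
    using invariant_contradiction[OF T ne g] by blast
qed

lemma ep_mult_left:
  assumes "S \<in> torsion E m" "T \<in> torsion E m"
  shows "ep (ec_mult E n S) T = ep S T ^ n"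
proof (induction n)
  case 0
  obtain g where g: "isg T g"
    by (rule isg_ex[OF assms(2)])
  then show ?case
    by (auto intro: ep_eq simp: tau_def)
next
  case (Suc n)
  then show ?case
    using assms by (simp add: mult_Suc ep_add_left)
qed

lemma ep_nonzero: "S \<in> torsion E m \<Longrightarrow> T \<in> torsion E m \<Longrightarrow> ep S T \<noteq> 0"
  using isg_ex ep_spec(1) by blast

lemma ep_mult_right:
  assumes "S \<in> torsion E m" "T \<in> torsion E m"
  shows "ep S (ec_mult E n T) = ep S T ^ n"
proof (induction n)
  case 0
  have "ep S (Infinity \<boxplus> Infinity) = ep S Infinity * ep S Infinity"
    using assms by (intro ep_add_right) auto
  then show ?case
    using ep_nonzero[OF assms(1) tor_Infinity] by simp
next
  case (Suc n)
  then show ?case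
    using assms by (simp add: mult_Suc ep_add_right)
qed

lemma ep_neg_left:
  assumes "S \<in> torsion E m" "T \<in> torsion E m"
  shows "ep (neg S) T * ep S T = 1"
  using ep_add_left[of "neg S" S T] ep_mult_left[of S T 0] assms by simp

text \<open>Any torsion point is a P + b Q, and since Q pairs trivially with itself, its pairing
  with d Q is a power of \<open>ep P Q ^ d\<close>. Nondegeneracy then makes the pairing of a basis
  a root of unity of exact order m.\<close>

lemma ep_basis_order:
  assumes "torsion_basis E m P Q" and one: "ep P Q ^ d = 1"
  shows "ec_mult E d Q = Infinity"
proof (rule ep_nondegenerate)
  have PQ: "P \<in> torsion E m" "Q \<in> torsion E m"
    and bij: "bij_betw (\<lambda>(a, b). ec_mult E a P \<boxplus> ec_mult E b Q) ({..<m} \<times> {..<m}) (torsion E m)"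
    using assms(1) by (auto simp: torsion_basis_def)
  show "ec_mult E d Q \<in> torsion E m"
    using PQ by simp
  fix S assume "S \<in> torsion E m"
  then obtain a b where S: "S = ec_mult E a P \<boxplus> ec_mult E b Q"
    using bij unfolding bij_betw_def by (metis (mono_tags, lifting) imageE case_prod_beta)
  have "ep S (ec_mult E d Q) = (ep P Q ^ a * ep Q Q ^ b) ^ d"
    unfolding S using PQ by (simp add: ep_add_left ep_mult_left ep_mult_right)
  also have "\<dots> = (ep P Q ^ d) ^ a"
    using ep_self[OF PQ(2)] by (simp flip: power_mult add: mult.commute)
  finally show "ep S (ec_mult E d Q) = 1"
    by (simp add: one)
qed

end

subsection \<open>The Weil pairing\<close>

context ell
begin

section \<open>Polynomials in X and Y as functions on the curve\<close>

definition ev :: "'k poly poly \<Rightarrow> 'k ec_point \<Rightarrow> 'k" where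
  "ev F P = eval2 F (px P) (py P)"

lemma eval2_simps [simp]:
  "eval2 (F + G) x y = eval2 F x y + eval2 G x y"
  "eval2 (F - G) x y = eval2 F x y - eval2 G x y"
  "eval2 (F * G) x y = eval2 F x y * eval2 G x y"
  "eval2 (F ^ n) x y = eval2 F x y ^ n"
  "eval2 0 x y = 0"
  by (simp_all add: eval2_def)

lemma eval2_sum: "eval2 (\<Sum>i\<in>A. F i) x y = (\<Sum>i\<in>A. eval2 (F i) x y)"
  by (simp add: eval2_def poly_sum)

lemma eval2_lin: "eval2 [:a, b:] x y = poly a x + poly b x * y"
  by (simp add: eval2_def mult.commute)

lemma ev_lin: "ev [:a, b:] = lin a b"
  by (simp add: ev_def[abs_def] eval2_lin lin_def[abs_def])

lemma eval2_curve: "P \<in> aff \<Longrightarrow> ev (curve_poly E) P = 0"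
proof -
  assume P: "P \<in> aff"
  have "ev (curve_poly E) P = py P ^ 2 + a1 * px P * py P + a3 * py P - (px P ^ 3 + a2 * px P ^ 2 + a4 * px P + a6)"
    by (simp add: ev_def eval2_def curve_poly_def algebra_simps power2_eq_square power3_eq_cube)
  then show ?thesis
    using curve_eqn[OF P] by simp
qed

definition ra :: "'k poly poly \<Rightarrow> 'k poly" where "ra F = Polynomial.coeff (pseudo_mod F (curve_poly E)) 0"

definition rb :: "'k poly poly \<Rightarrow> 'k poly" where "rb F = Polynomial.coeff (pseudo_mod F (curve_poly E)) 1"

lemma curve_poly_monic: "Polynomial.degree (curve_poly E) = 2" "lead_coeff (curve_poly E) = 1" "curve_poly E \<noteq> 0"
  by (simp_all add: curve_poly_def)

lemma pseudo_mod_curve: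
  "\<exists>q. F = curve_poly E * q + [:ra F, rb F:]" "pseudo_mod F (curve_poly E) = [:ra F, rb F:]"
proof -
  let ?C = "curve_poly E"
  obtain q where qr: "pseudo_divmod F ?C = (q, pseudo_mod F ?C)"
    unfolding pseudo_mod_def by (metis prod.collapse)
  have deg: "pseudo_mod F ?C = 0 \<or> Polynomial.degree (pseudo_mod F ?C) < 2"
    using pseudo_divmod(2)[OF curve_poly_monic(3) qr] curve_poly_monic(1) by simp
  show 1: "pseudo_mod F ?C = [:ra F, rb F:]"
  proof (rule poly_eqI)
    fix n
    show "Polynomial.coeff (pseudo_mod F ?C) n = Polynomial.coeff [:ra F, rb F:] n"
    proof (cases "n \<ge> 2")
      case True
      then have "Polynomial.coeff (pseudo_mod F ?C) n = 0"
        using deg by (auto intro: coeff_eq_0)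
      moreover have "Polynomial.coeff [:ra F, rb F:] n = 0"
        using True by (intro coeff_eq_0) auto
      ultimately show ?thesis by simp
    next
      case False
      then have "n = 0 \<or> n = 1" by auto
      then show ?thesis by (auto simp: ra_def rb_def)
    qed
  qed
  show "\<exists>q. F = ?C * q + [:ra F, rb F:]"
    using pseudo_divmod(1)[OF curve_poly_monic(3) qr] curve_poly_monic(2) unfolding 1[symmetric] by auto
qed

lemma ev_red:
  assumes "P \<in> aff"
  shows "ev F P = lin (ra F) (rb F) P"
proof -
  obtain q where "F = curve_poly E * q + [:ra F, rb F:]"
    using pseudo_mod_curve by blast
  then have "ev F P = ev (curve_poly E * q + [:ra F, rb F:]) P"
    by simp
  then show ?thesis
    using eval2_curve[OF assms] by (simp add: ev_def eval2_lin lin_def)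
qed

lemma reg_ev [simp]: "reg (ev F)"
  unfolding reg_def using ev_red by blast

text \<open>Division by the curve equation, monic in Y, leaves a remainder a + b y; such a function
  vanishes on the whole curve only for a = b = 0.\<close>

lemma curve_dvd_iff: "curve_poly E dvd F \<longleftrightarrow> (\<forall>P\<in>aff. ev F P = 0)"
proof
  assume "curve_poly E dvd F"
  then show "\<forall>P\<in>aff. ev F P = 0"
    using eval2_curve by (auto simp: ev_def)
next
  assume *: "\<forall>P\<in>aff. ev F P = 0"
  have "\<forall>\<^sub>F Z in cof. lin (ra F) (rb F) Z = lin 0 0 Z"
    using cof_aff by eventually_elim (use * ev_red in \<open>simp add: lin_def\<close>)
  from lin_eqD[OF this] have "[:ra F, rb F:] = 0"
    by simp
  then show "curve_poly E dvd F"
    using pseudo_mod_curve(1)[of F] by auto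
qed

lemma not_dvd_iff: "\<not> curve_poly E dvd F \<longleftrightarrow> nz (ev F)"
proof -
  have "\<not> (\<forall>P\<in>aff. ev F P = 0)" if nz: "nz (ev F)"
  proof -
    obtain P where "P \<in> aff" "ev F P \<noteq> 0"
      using nz unfolding nz_def by (rule cof_ex)
    then show ?thesis by blast
  qed
  then show ?thesis
    unfolding curve_dvd_iff using reg_cases[OF reg_ev, of F] nz_def by blast
qed

lemma reg_to_poly:
  assumes "reg f"
  obtains F where "\<forall>P\<in>aff. f P = ev F P"
  using assms unfolding reg_def by (metis ev_lin)

lemma reg_sum: "(\<And>i. i \<in> A \<Longrightarrow> reg (f i)) \<Longrightarrow> reg (\<lambda>Z. \<Sum>i\<in>A. f i Z)"
  by (induction A rule: infinite_finite_induct) simp_all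

text \<open>If F lies in the n-th power of the maximal ideal, then each monomial of degree n in x -
  x_P and y - y_P yields \<open>unif P ^ n\<close> up to local units, so n is at most the order.
  Conversely a single monomial suffices as witness, the pure power of the coordinate that serves as
  uniformizer.\<close>

lemma vanishes_iff:
  assumes P: "P = Affine x y" "P \<in> aff" and k: "hord P (ev F) (int k)"
  shows "vanishes_to_order E F x y n \<longleftrightarrow> n \<le> k"
proof
  have pxy [simp]: "px P = x" "py P = y"
    by (simp_all add: P)
  have ev_basic: "ev [:[:- x, 1:]:] Z = px Z - px P" "ev [:[:- y:], 1:] Z = py Z - py P" for Z
    by (simp_all add: ev_def eval2_def)
  {
    assume "vanishes_to_order E F x y n"
    then obtain S A where S: "eval2 S x y \<noteq> 0"
      and dvd: "curve_poly E dvd S * F - (\<Sum>i\<le>n. A i * [:[:- x, 1:]:] ^ i * [:[:- y:], 1:] ^ (n - i))"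
      unfolding vanishes_to_order_def by blast
    have eq: "ev S Z * ev F Z = (\<Sum>i\<le>n. ev (A i) Z * (px Z - px P) ^ i * (py Z - py P) ^ (n - i))"
      if "Z \<in> aff" for Z
    proof -
      have "ev (S * F - (\<Sum>i\<le>n. A i * [:[:- x, 1:]:] ^ i * [:[:- y:], 1:] ^ (n - i))) Z = 0"
        using dvd that unfolding curve_dvd_iff by blast
      then show ?thesis
        unfolding ev_basic[symmetric] by (simp add: ev_def eval2_sum)
    qed
    obtain s1 v1 where 1: "reg s1" "reg v1" "s1 P \<noteq> 0" "\<And>Z. Z \<in> aff \<Longrightarrow> s1 Z * (px Z - px P) = v1 Z * unif P Z"
      by (rule reg_factor_unif[OF P(2), of "\<lambda>Z. px Z - px P"]) (simp, simp, blast)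
    obtain s2 v2 where 2: "reg s2" "reg v2" "s2 P \<noteq> 0" "\<And>Z. Z \<in> aff \<Longrightarrow> s2 Z * (py Z - py P) = v2 Z * unif P Z"
      by (rule reg_factor_unif[OF P(2), of "\<lambda>Z. py Z - py P"]) (simp, simp, blast)
    define B where "B Z = (\<Sum>i\<le>n. ev (A i) Z * (s2 Z * v1 Z) ^ i * (s1 Z * v2 Z) ^ (n - i))" for Z
    have B: "reg B"
      unfolding B_def[abs_def] by (intro reg_sum) (use 1 2 in simp)
    have eq2: "(s1 Z * s2 Z) ^ n * ev S Z * ev F Z = B Z * unif P Z ^ n" if Z: "Z \<in> aff" for Z
    proof -
      have "(s1 Z * s2 Z) ^ n * (ev (A i) Z * (px Z - px P) ^ i * (py Z - py P) ^ (n - i)) =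
          ev (A i) Z * (s2 Z * v1 Z) ^ i * (s1 Z * v2 Z) ^ (n - i) * unif P Z ^ n" if "i \<le> n" for i
      proof -
        obtain d where d: "n = i + d"
          using \<open>i \<le> n\<close> le_Suc_ex by blast
        have "(s1 Z * s2 Z) ^ n * (ev (A i) Z * (px Z - px P) ^ i * (py Z - py P) ^ (n - i)) =
            ev (A i) Z * (s2 Z * (s1 Z * (px Z - px P))) ^ i * (s1 Z * (s2 Z * (py Z - py P))) ^ (n - i)"
          by (simp add: d power_add power_mult_distrib mult_ac)
        also have "\<dots> = ev (A i) Z * (s2 Z * v1 Z) ^ i * (s1 Z * v2 Z) ^ (n - i) * unif P Z ^ n"
          unfolding 1(4)[OF Z] 2(4)[OF Z] by (simp add: d power_add power_mult_distrib mult_ac)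
        finally show ?thesis .
      qed
      then show ?thesis
        unfolding mult.assoc eq[OF Z] B_def sum_distrib_left sum_distrib_right
        by (intro sum.cong) (simp_all add: mult.assoc)
    qed
    have SP: "ev S P \<noteq> 0"
      using S by (simp add: ev_def)
    have "hord P (\<lambda>Z. (s1 Z * s2 Z) ^ n * ev S Z * ev F Z / unif P Z ^ n) (0 + int k - int n * 1)"
      using P 1 2 SP by (intro hord_divide hord_mult hord_power hord_unif k hord_reg_unit) simp_all
    moreover have "\<forall>\<^sub>F Z in cof. (s1 Z * s2 Z) ^ n * ev S Z * ev F Z / unif P Z ^ n = B Z"
      using cof_aff nz_unif[of P, unfolded nz_def] by eventually_elim (simp add: eq2)
    ultimately have "hord P B (0 + int k - int n * 1)"
      by (rule hord_cong)
    from hord_reg_nonneg[OF P(2) B this] show "n \<le> k"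
      by simp
  }
  assume "n \<le> k"
  then obtain d where d: "k = n + d"
    using le_Suc_ex by blast
  obtain S U where SU: "reg S" "reg U" "S P \<noteq> 0" "U P \<noteq> 0"
    "\<forall>\<^sub>F Z in cof. S Z * ev F Z = U Z * unif P Z powi (int k)"
    by (rule hord_affE[OF k P(2)])
  have eq: "S Z * ev F Z = U Z * unif P Z ^ k" if "Z \<in> aff" for Z
    by (rule reg_eq[OF _ _ _ that]) (use SU in simp_all)
  obtain S' where S': "\<forall>P\<in>aff. S P = ev S' P"
    by (rule reg_to_poly[OF SU(1)])
  obtain U' where U': "\<forall>Z\<in>aff. U Z * unif P Z ^ d = ev U' Z"
    by (rule reg_to_poly[OF reg_mult[OF SU(2) reg_power[OF reg_unif]]])
  \<comment> \<open>The index counts factors X - x: the surviving term is i = n when x - x_P is the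
    uniformizer and i = 0 when y - y_P is.\<close>
  define A where "A i = (if i = (if dy P \<noteq> 0 then n else 0) then U' else 0)" for i
  have "S' * F - (\<Sum>i\<le>n. A i * [:[:- x, 1:]:] ^ i * [:[:- y:], 1:] ^ (n - i)) =
      S' * F - U' * (if dy P \<noteq> 0 then [:[:- x, 1:]:] ^ n else [:[:- y:], 1:] ^ n)"
    by (simp add: A_def if_distrib[of "\<lambda>u. u * _"] sum.delta cong: if_cong)
  moreover have "curve_poly E dvd S' * F - U' * (if dy P \<noteq> 0 then [:[:- x, 1:]:] ^ n else [:[:- y:], 1:] ^ n)"
    unfolding curve_dvd_iff
  proof
    fix Z assume Z: "Z \<in> aff"
    have "ev (S' * F - U' * (if dy P \<noteq> 0 then [:[:- x, 1:]:] ^ n else [:[:- y:], 1:] ^ n)) Z =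
        ev S' Z * ev F Z - ev U' Z * unif P Z ^ n"
      using ev_basic[of Z] by (simp add: ev_def unif_def)
    also have "\<dots> = S Z * ev F Z - U Z * unif P Z ^ k"
      using S' U' Z by (simp add: d power_add mult_ac)
    finally show "ev (S' * F - U' * (if dy P \<noteq> 0 then [:[:- x, 1:]:] ^ n else [:[:- y:], 1:] ^ n)) Z = 0"
      using eq[OF Z] by simp
  qed
  ultimately have "curve_poly E dvd S' * F - (\<Sum>i\<le>n. A i * [:[:- x, 1:]:] ^ i * [:[:- y:], 1:] ^ (n - i))"
    by simp
  moreover have "eval2 S' x y \<noteq> 0"
    using S' SU(3) P by (simp add: ev_def)
  ultimately show "vanishes_to_order E F x y n"
    unfolding vanishes_to_order_def by blast
qed

lemma hord_ord_at:
  assumes F: "nz (ev F)" and P: "P \<in> points E"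
  shows "hord P (ev F) (ord_at E F P)"
proof (cases "P = Infinity")
  case True
  have "\<forall>\<^sub>F Z in cof. lin (ra F) (rb F) Z = ev F Z"
    using cof_aff by eventually_elim (simp add: ev_red)
  moreover have "ra F \<noteq> 0 \<or> rb F \<noteq> 0"
  proof (rule ccontr)
    assume "\<not> ?thesis"
    then have "\<forall>P\<in>aff. ev F P = 0"
      by (simp add: ev_red lin_def)
    then show False
      using F not_dvd_iff curve_dvd_iff by blast
  qed
  ultimately have "hord Infinity (ev F) (- int (dg (ra F) (rb F)))"
    using hord_inf_lin hord_cong by blast
  moreover have "ord_at E F Infinity = - int (dg (ra F) (rb F))"
    by (simp add: Let_def dg_def ra_def rb_def)
  ultimately show ?thesis
    using True by simp
next
  case False
  then have P': "P \<in> aff"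
    using P by (simp add: points_eq)
  then obtain x y where xy: "P = Affine x y"
    by (auto elim: affE)
  obtain k where k: "hord P (ev F) (int k)"
    by (rule hord_ex_reg[OF P' reg_ev F])
  have "(GREATEST n. vanishes_to_order E F x y n) = k"
    unfolding vanishes_iff[OF xy P' k] by (rule Greatest_equality) auto
  then show ?thesis
    using k by (simp add: xy)
qed

lemma has_divisor_hord:
  assumes "has_divisor E F G D" "P \<in> points E"
  shows "hord P (\<lambda>Z. ev F Z / ev G Z) (D P)"
proof -
  have "nz (ev F)" "nz (ev G)" and D: "ord_at E F P - ord_at E G P = D P"
    using assms by (auto simp: has_divisor_def not_dvd_iff)
  then show ?thesis
    using hord_divide[OF hord_ord_at[OF _ assms(2)] hord_ord_at[OF _ assms(2)], of F G] by simp
qed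

lemma hord_has_divisor:
  assumes D: "\<And>P. P \<in> points E \<Longrightarrow> hord P g (D P)"
  obtains F G where "has_divisor E F G D" "nz (ev F)" "nz (ev G)" "\<forall>\<^sub>F Z in cof. g Z = ev F Z / ev G Z"
proof -
  have "rat g"
    using D[OF Infinity_in_points] by (rule hord_rat)
  then obtain f h where fh: "reg f" "reg h" "nz h" "\<forall>\<^sub>F Z in cof. g Z = f Z / h Z"
    unfolding rat_def by blast
  obtain F where F: "\<forall>P\<in>aff. f P = ev F P"
    by (rule reg_to_poly[OF fh(1)])
  obtain G where G: "\<forall>P\<in>aff. h P = ev G P"
    by (rule reg_to_poly[OF fh(2)])
  have eq: "\<forall>\<^sub>F Z in cof. g Z = ev F Z / ev G Z"
    using fh(4) cof_aff by eventually_elim (use F G in simp)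
  have nzG: "nz (ev G)"
    using fh(3) cof_aff unfolding nz_def by eventually_elim (use G in auto)
  have nzF: "nz (ev F)"
    using hord_nz[OF D[OF Infinity_in_points]] eq unfolding nz_def by eventually_elim auto
  have "ord_at E F P - ord_at E G P = D P" if P: "P \<in> points E" for P
  proof (rule hord_unique)
    show "hord P (\<lambda>Z. ev F Z / ev G Z) (ord_at E F P - ord_at E G P)"
      by (intro hord_divide hord_ord_at nzF nzG P)
    show "hord P (\<lambda>Z. ev F Z / ev G Z) (D P)"
      by (rule hord_cong[OF D[OF P] eq])
  qed
  then have "has_divisor E F G D"
    using nzF nzG by (simp add: has_divisor_def not_dvd_iff)
  then show thesis
    using that nzF nzG eq by blast
qed

end

context ell_tor
begin

text \<open>A generic point gives a witness. For uniqueness the witness point P is arbitrary, while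
  the multiplier relation holds only almost everywhere; orders bridge the gap. If the values at P
  and Q = P + S violated the relation, then g(Z + S) - g(Q) would have order 0 at P, although g -
  g(Q) has positive order at Q and translation preserves orders.\<close>

lemma weil_pairing_eq:
  assumes S: "S \<in> torsion E m" and T: "T \<in> torsion E m"
  shows "weil_pairing E m S T = ep S T"
  unfolding weil_pairing_def
proof (rule the_equality)
  let ?D = "\<lambda>Q. of_bool (mu Q = T) - of_bool (mu Q = Infinity) :: int"
  have S': "S \<in> points E"
    using S by simp
  obtain g where g: "isg T g"
    by (rule isg_ex[OF T])
  obtain F G where FG: "has_divisor E F G ?D" "nz (ev F)" "nz (ev G)" "\<forall>\<^sub>F Z in cof. g Z = ev F Z / ev G Z"
    by (rule hord_has_divisor[of g ?D]) (use isgD[OF g] in auto)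
  have both: "\<forall>\<^sub>F Z in cof. Z \<in> aff \<and> ev F Z \<noteq> 0 \<and> ev G Z \<noteq> 0 \<and> g Z = ev F Z / ev G Z"
    using cof_aff FG(2,3)[unfolded nz_def] FG(4) by eventually_elim simp
  have "\<forall>\<^sub>F Z in cof. (ev F Z \<noteq> 0 \<and> ev G Z \<noteq> 0 \<and> g Z = ev F Z / ev G Z) \<and>
      (tau S Z \<in> aff \<and> ev F (tau S Z) \<noteq> 0 \<and> ev G (tau S Z) \<noteq> 0 \<and> g (tau S Z) = ev F (tau S Z) / ev G (tau S Z)) \<and>
      g (tau S Z) = ep S T * g Z"
    using both cof_compose[OF cof_tau[OF S'] both] ep_spec(2)[OF S g] by eventually_elim simp
  then obtain Z where Z: "Z \<in> aff" "ev F Z \<noteq> 0" "ev G Z \<noteq> 0" "g Z = ev F Z / ev G Z"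
    "tau S Z \<in> aff" "ev F (tau S Z) \<noteq> 0" "ev G (tau S Z) \<noteq> 0" "g (tau S Z) = ev F (tau S Z) / ev G (tau S Z)"
    "g (tau S Z) = ep S T * g Z"
    by (rule cof_ex) blast
  obtain x y where xy: "Z = Affine x y"
    using Z(1) by (auto elim: affE)
  obtain x' y' where xy': "tau S Z = Affine x' y'"
    using Z(5) by (auto elim: affE)
  have "ep S T = (ev F (tau S Z) / ev G (tau S Z)) / (ev F Z / ev G Z)"
    unfolding Z(8)[symmetric] Z(9) Z(4)[symmetric] using Z(2-4) by simp
  then have "has_divisor E F G ?D \<and>
       Affine x y \<in> points E \<and> ec_add E (Affine x y) S = Affine x' y' \<and>
       eval2 F x y \<noteq> 0 \<and> eval2 G x y \<noteq> 0 \<and> eval2 F x' y' \<noteq> 0 \<and> eval2 G x' y' \<noteq> 0 \<and>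
       ep S T = (eval2 F x' y' / eval2 G x' y') / (eval2 F x y / eval2 G x y)"
    using FG(1) Z(1-3,5-7) xy' by (simp add: xy ev_def tau_def)
  then show "\<exists>F G x y x' y'. has_divisor E F G ?D \<and>
       Affine x y \<in> points E \<and> ec_add E (Affine x y) S = Affine x' y' \<and>
       eval2 F x y \<noteq> 0 \<and> eval2 G x y \<noteq> 0 \<and> eval2 F x' y' \<noteq> 0 \<and> eval2 G x' y' \<noteq> 0 \<and>
       ep S T = (eval2 F x' y' / eval2 G x' y') / (eval2 F x y / eval2 G x y)"
    by blast
next
  let ?D = "\<lambda>Q. of_bool (mu Q = T) - of_bool (mu Q = Infinity) :: int"
  fix z assume "\<exists>F G x y x' y'. has_divisor E F G ?D \<and>
       Affine x y \<in> points E \<and> ec_add E (Affine x y) S = Affine x' y' \<and>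
       eval2 F x y \<noteq> 0 \<and> eval2 G x y \<noteq> 0 \<and> eval2 F x' y' \<noteq> 0 \<and> eval2 G x' y' \<noteq> 0 \<and>
       z = (eval2 F x' y' / eval2 G x' y') / (eval2 F x y / eval2 G x y)"
  then obtain F G x y x' y' where *: "has_divisor E F G ?D" "Affine x y \<in> points E"
    "ec_add E (Affine x y) S = Affine x' y'" "eval2 F x y \<noteq> 0" "eval2 G x y \<noteq> 0"
    "eval2 F x' y' \<noteq> 0" "eval2 G x' y' \<noteq> 0"
    "z = (eval2 F x' y' / eval2 G x' y') / (eval2 F x y / eval2 G x y)"
    by blast
  define P where "P = Affine x y"
  define Q where "Q = Affine x' y'"
  have PQ: "P \<boxplus> S = Q"
    using *(3) by (simp add: P_def Q_def)
  have S': "S \<in> points E"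
    using S by simp
  have P': "P \<in> points E"
    using *(2) by (simp add: P_def)
  have P: "P \<in> aff"
    using P' by (simp add: P_def points_eq)
  have Q': "Q \<in> points E"
    using P' S' PQ by (metis padd_closed)
  then have Q: "Q \<in> aff"
    by (simp add: Q_def points_eq)
  have ne: "ev F P \<noteq> 0" "ev G P \<noteq> 0" "ev F Q \<noteq> 0" "ev G Q \<noteq> 0"
    using * by (simp_all add: ev_def P_def Q_def)
  have z: "z = (ev F Q / ev G Q) / (ev F P / ev G P)"
    using *(8) by (simp add: ev_def P_def Q_def)
  define g where "g Z = ev F Z / ev G Z" for Z
  have g: "isg T g"
    unfolding isg_def g_def[abs_def] using has_divisor_hord[OF *(1)] by simp
  have nzG: "\<forall>\<^sub>F Z in cof. ev G Z \<noteq> 0"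
    using *(1) by (simp add: has_divisor_def not_dvd_iff nz_def)
  define a where "a = g Q"
  let ?e = "ep S T"
  have "?e * ev F P - a * ev G P = 0"
  proof (rule ccontr)
    assume nonzero: "?e * ev F P - a * ev G P \<noteq> 0"
    have "hord P (\<lambda>Z. (?e * ev F Z - a * ev G Z) / ev G Z) (0 - 0)"
      by (intro hord_divide hord_reg_unit P nonzero ne) simp_all
    moreover have "\<forall>\<^sub>F Z in cof. (?e * ev F Z - a * ev G Z) / ev G Z = g (tau S Z) - a"
      using ep_spec(2)[OF S g] nzG by eventually_elim (simp add: g_def field_simps)
    ultimately have 0: "hord P (\<lambda>Z. g (tau S Z) - a) (0 - 0)"
      by (rule hord_cong)
    have negS: "neg S \<in> points E"
      using S' by simp
    have "nz (\<lambda>Z. g (tau S (tau (neg S) Z)) - a)"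
      by (rule nz_compose[OF cof_tau[OF negS] hord_nz[OF 0]])
    then have nz: "nz (\<lambda>Z. g Z - a)"
      unfolding nz_def using tau_neg_ev(2)[OF S'] by eventually_elim simp
    have "rat (\<lambda>Z. g Z - a)"
      using isg_rat[OF g] by simp
    then obtain n where n: "hord Q (\<lambda>Z. g Z - a) n"
      using hord_exists nz Q' by blast
    have "hord P (\<lambda>Z. g (tau S Z) - a) n"
      by (rule hord_tau[OF S' P']) (simp add: PQ n)
    then have n0: "n = 0"
      using hord_unique[OF 0] by simp
    have "hord Q (\<lambda>Z. (g Z - a) * ev G Z) (n + 0)"
      by (intro hord_mult n hord_reg_unit Q ne reg_ev)
    moreover have "\<forall>\<^sub>F Z in cof. (g Z - a) * ev G Z = ev F Z - a * ev G Z"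
      using nzG by eventually_elim (simp add: g_def field_simps)
    ultimately have "hord Q (\<lambda>Z. ev F Z - a * ev G Z) (n + 0)"
      by (rule hord_cong)
    moreover have "ev F Q - a * ev G Q = 0"
      using ne by (simp add: a_def g_def)
    ultimately have "n + 0 \<ge> 1"
      by (intro hord_reg_zero[OF Q]) simp_all
    then show False
      using n0 by simp
  qed
  then show "z = ?e"
    using ne unfolding z by (simp add: a_def g_def field_simps)
qed

end

subsection \<open>Extending isomorphisms of subfields\<close>

text \<open>A partial isomorphism is represented by its graph \<open>H\<close>, a subring of the product ring in which the two
  components of an element vanish simultaneously.\<close>
definition hgraph :: "('k::field \<times> 'k) set \<Rightarrow> bool" where
  "hgraph H \<longleftrightarrow> (1, 1) \<in> H \<and>
     (\<forall>a b c d. (a, b) \<in> H \<longrightarrow> (c, d) \<in> H \<longrightarrow> (a + c, b + d) \<in> H \<and> (a * c, b * d) \<in> H) \<and>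
     (\<forall>a b. (a, b) \<in> H \<longrightarrow> (- a, - b) \<in> H \<and> (a = 0 \<longleftrightarrow> b = 0))"

definition hpoly :: "('k::field \<times> 'k) set \<Rightarrow> 'k poly \<Rightarrow> 'k poly \<Rightarrow> bool" where
  "hpoly H p q \<longleftrightarrow> (\<forall>i. (Polynomial.coeff p i, Polynomial.coeff q i) \<in> H)"

lemma hgraphD:
  assumes "hgraph H"
  shows "(1, 1) \<in> H" "(0, 0) \<in> H"
    and "(a, b) \<in> H \<Longrightarrow> (c, d) \<in> H \<Longrightarrow> (a + c, b + d) \<in> H"
    and "(a, b) \<in> H \<Longrightarrow> (c, d) \<in> H \<Longrightarrow> (a * c, b * d) \<in> H"
    and "(a, b) \<in> H \<Longrightarrow> (- a, - b) \<in> H"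
    and "(a, b) \<in> H \<Longrightarrow> a = 0 \<longleftrightarrow> b = 0"
proof -
  have "(1 + - 1, 1 + - 1) \<in> H"
    using assms unfolding hgraph_def by blast
  then show "(0, 0) \<in> H" by simp
qed (use assms in \<open>unfold hgraph_def, blast+\<close>)

lemma hgraph_sum:
  assumes "hgraph H" "\<And>i. i \<in> A \<Longrightarrow> (f i, g i) \<in> H"
  shows "((\<Sum>i\<in>A. f i), (\<Sum>i\<in>A. g i)) \<in> H"
  using assms(2) by (induction A rule: infinite_finite_induct) (auto intro: hgraphD[OF assms(1)])

lemma hpoly_degree:
  assumes "hgraph H" "hpoly H p q"
  shows "p = 0 \<longleftrightarrow> q = 0" "Polynomial.degree p = Polynomial.degree q"
proof -
  have *: "Polynomial.coeff p i = 0 \<longleftrightarrow> Polynomial.coeff q i = 0" for i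
    using hgraphD(6)[OF assms(1)] assms(2) unfolding hpoly_def by blast
  then show "p = 0 \<longleftrightarrow> q = 0"
    by (simp add: poly_eq_iff)
  show "Polynomial.degree p = Polynomial.degree q"
    unfolding Polynomial.degree_def using * by simp
qed

lemma hpoly_add: "hgraph H \<Longrightarrow> hpoly H p q \<Longrightarrow> hpoly H p' q' \<Longrightarrow> hpoly H (p + p') (q + q')"
  unfolding hpoly_def by (auto intro: hgraphD)

lemma hpoly_uminus: "hgraph H \<Longrightarrow> hpoly H p q \<Longrightarrow> hpoly H (- p) (- q)"
  unfolding hpoly_def by (auto intro: hgraphD)

lemma hpoly_diff: "hgraph H \<Longrightarrow> hpoly H p q \<Longrightarrow> hpoly H p' q' \<Longrightarrow> hpoly H (p - p') (q - q')"
  using hpoly_add[OF _ _ hpoly_uminus, of H p q p' q'] by simp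

lemma hpoly_mult: "hgraph H \<Longrightarrow> hpoly H p q \<Longrightarrow> hpoly H p' q' \<Longrightarrow> hpoly H (p * p') (q * q')"
  unfolding hpoly_def coeff_mult by (auto intro!: hgraph_sum hgraphD(4))

lemma hpoly_monom: "hgraph H \<Longrightarrow> (a, b) \<in> H \<Longrightarrow> hpoly H (Polynomial.monom a n) (Polynomial.monom b n)"
  unfolding hpoly_def by (auto intro: hgraphD)

lemma hpoly_smult: "hgraph H \<Longrightarrow> (a, b) \<in> H \<Longrightarrow> hpoly H p q \<Longrightarrow> hpoly H (Polynomial.smult a p) (Polynomial.smult b q)"
  unfolding hpoly_def by (auto intro: hgraphD)

lemma hpoly_0: "hgraph H \<Longrightarrow> hpoly H 0 0"
  unfolding hpoly_def by (auto intro: hgraphD)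

text \<open>The graph is closed under ring operations only, so division works up to a nonzero factor
  \<open>c\<close>. Every step is performed on both components at once, which keeps quotients and
  remainders matched.\<close>

lemma hpoly_division:
  assumes H: "hgraph H" and p: "hpoly H p p'" "p \<noteq> 0" and q: "hpoly H q q'"
  shows "\<exists>c c' s s' r r'. (c, c') \<in> H \<and> c \<noteq> 0 \<and> hpoly H s s' \<and> hpoly H r r' \<and>
     Polynomial.smult c q = p * s + r \<and> Polynomial.smult c' q' = p' * s' + r' \<and>
     (r = 0 \<or> Polynomial.degree r < Polynomial.degree p)"
  using q
proof (induction "if q = 0 then 0 else Suc (Polynomial.degree q)" arbitrary: q q' rule: less_induct)
  case less
  show ?case
  proof (cases "q = 0 \<or> Polynomial.degree q < Polynomial.degree p")
    case True
    then show ?thesis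
      using less.prems hgraphD(1)[OF H] hpoly_0[OF H]
      by (intro exI[of _ 1] exI[of _ 0] exI[of _ q] exI[of _ q'] conjI) auto
  next
    case False
    let ?n = "Polynomial.degree q - Polynomial.degree p"
    have lead: "(lead_coeff p, lead_coeff p') \<in> H" "(lead_coeff q, lead_coeff q') \<in> H"
      using p(1) less.prems hpoly_degree(2)[OF H p(1)] hpoly_degree(2)[OF H less.prems]
      unfolding hpoly_def by metis+
    define q1 where "q1 = Polynomial.smult (lead_coeff p) q - Polynomial.monom (lead_coeff q) ?n * p"
    define q1' where "q1' = Polynomial.smult (lead_coeff p') q' - Polynomial.monom (lead_coeff q') ?n * p'"
    have q1: "hpoly H q1 q1'"
      unfolding q1_def q1'_def
      by (intro hpoly_diff hpoly_smult hpoly_mult hpoly_monom H lead p less.prems)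
    have small: "q1 = 0 \<or> Polynomial.degree q1 < Polynomial.degree q"
    proof -
      have "Polynomial.degree (Polynomial.smult (lead_coeff p) q) = Polynomial.degree q"
        using p(2) by simp
      moreover have "Polynomial.degree (Polynomial.monom (lead_coeff q) ?n * p) = Polynomial.degree q"
        using False p(2) by (simp add: degree_mult_eq degree_monom_eq monom_eq_0_iff)
      ultimately have le: "Polynomial.degree q1 \<le> Polynomial.degree q"
        unfolding q1_def by (metis degree_diff_le order_refl)
      have "Polynomial.coeff q1 (Polynomial.degree q) = 0"
        unfolding q1_def using False by (simp add: coeff_monom_mult)
      then show ?thesis
        using le by (metis le_neq_implies_less leading_coeff_0_iff)
    qed
    then have "(if q1 = 0 then 0 else Suc (Polynomial.degree q1)) < (if q = 0 then 0 else Suc (Polynomial.degree q))"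
      using False by auto
    from less.hyps[OF this q1] obtain c c' s s' r r' where
      *: "(c, c') \<in> H" "c \<noteq> 0" "hpoly H s s'" "hpoly H r r'" "Polynomial.smult c q1 = p * s + r"
        "Polynomial.smult c' q1' = p' * s' + r'" "r = 0 \<or> Polynomial.degree r < Polynomial.degree p"
      by blast
    have "Polynomial.smult (c * lead_coeff p) q = p * (s + Polynomial.smult c (Polynomial.monom (lead_coeff q) ?n)) + r"
      using *(5) unfolding q1_def by (simp add: smult_diff_right algebra_simps)
    moreover have "Polynomial.smult (c' * lead_coeff p') q' =
        p' * (s' + Polynomial.smult c' (Polynomial.monom (lead_coeff q') ?n)) + r'"
      using *(6) unfolding q1'_def by (simp add: smult_diff_right algebra_simps)
    moreover have "hpoly H (s + Polynomial.smult c (Polynomial.monom (lead_coeff q) ?n))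
        (s' + Polynomial.smult c' (Polynomial.monom (lead_coeff q') ?n))"
      by (intro hpoly_add hpoly_smult hpoly_monom H lead *)
    moreover have "(c * lead_coeff p, c' * lead_coeff p') \<in> H"
      by (intro hgraphD(4)[OF H] lead *)
    moreover have "c * lead_coeff p \<noteq> 0"
      using *(2) p(2) by simp
    ultimately show ?thesis
      using *(4,7) by blast
  qed
qed

text \<open>Here \<open>p\<close> plays the role of the minimal polynomial of z. It divides a
  multiple of every \<open>q\<close> vanishing at z, which gives one direction. For the other, take
  \<open>u\<close> of least degree whose image vanishes at w: it divides a multiple of
  \<open>p\<close>, and minimality of \<open>p\<close> forces u(z) = 0, since the cofactor is too
  small to vanish at z.\<close>

lemma hgraph_root:
  assumes H: "hgraph H" and p: "hpoly H p p'" "p \<noteq> 0" "poly p z = 0"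
    and min: "\<And>q q'. hpoly H q q' \<Longrightarrow> q \<noteq> 0 \<Longrightarrow> poly q z = 0 \<Longrightarrow> Polynomial.degree p \<le> Polynomial.degree q"
    and w: "poly p' w = 0" and q: "hpoly H q q'"
  shows "poly q z = 0 \<longleftrightarrow> poly q' w = 0"
proof
  assume qz: "poly q z = 0"
  obtain c c' s s' r r' where *: "(c, c') \<in> H" "c \<noteq> 0" "hpoly H s s'" "hpoly H r r'"
    "Polynomial.smult c q = p * s + r" "Polynomial.smult c' q' = p' * s' + r'"
    "r = 0 \<or> Polynomial.degree r < Polynomial.degree p"
    using hpoly_division[OF H p(1,2) q] by blast
  have "poly (Polynomial.smult c q) z = poly (p * s + r) z"
    using *(5) by simp
  then have "poly r z = 0"
    using qz p(3) by simp
  then have "r = 0"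
    using min[OF *(4)] *(7) by force
  then have "r' = 0"
    using hpoly_degree(1)[OF H *(4)] by simp
  have "poly (Polynomial.smult c' q') w = poly (p' * s' + r') w"
    using *(6) by simp
  then have "c' * poly q' w = 0"
    using w \<open>r' = 0\<close> by simp
  then show "poly q' w = 0"
    using *(1,2) hgraphD(6)[OF H] by fastforce
next
  assume qw: "poly q' w = 0"
  define Q where "Q n \<longleftrightarrow> (\<exists>u u'. hpoly H u u' \<and> u \<noteq> 0 \<and> poly u' w = 0 \<and> Polynomial.degree u = n)" for n
  have "Q (Polynomial.degree p)"
    unfolding Q_def using p w by blast
  then have "Q (LEAST n. Q n)"
    by (rule LeastI)
  then obtain u u' where u: "hpoly H u u'" "u \<noteq> 0" "poly u' w = 0" "Polynomial.degree u = (LEAST n. Q n)"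
    unfolding Q_def by blast
  have umin: "r = 0" if "hpoly H r r'" "poly r' w = 0" "r = 0 \<or> Polynomial.degree r < Polynomial.degree u" for r r'
  proof (rule ccontr)
    assume "r \<noteq> 0"
    then have "Q (Polynomial.degree r)"
      unfolding Q_def using that by blast
    then have "Polynomial.degree u \<le> Polynomial.degree r"
      unfolding u(4) by (rule Least_le)
    with that(3) \<open>r \<noteq> 0\<close> show False by simp
  qed
  have uz: "poly u z = 0"
  proof -
    obtain c c' s s' r r' where *: "(c, c') \<in> H" "c \<noteq> 0" "hpoly H s s'" "hpoly H r r'"
      "Polynomial.smult c p = u * s + r" "Polynomial.smult c' p' = u' * s' + r'"
      "r = 0 \<or> Polynomial.degree r < Polynomial.degree u"
      using hpoly_division[OF H u(1,2) p(1)] by blast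
    have "poly (Polynomial.smult c' p') w = poly (u' * s' + r') w"
      using *(6) by simp
    then have "poly r' w = 0"
      using u(3) w by simp
    then have r: "r = 0"
      using umin[OF *(4) _ *(7)] by blast
    then have eq: "Polynomial.smult c p = u * s"
      using *(5) by simp
    then have "s \<noteq> 0"
      using *(2) p(2) by auto
    have "poly (Polynomial.smult c p) z = poly (u * s) z"
      using eq by simp
    then have "poly u z = 0 \<or> poly s z = 0"
      using p(3) by simp
    moreover have False if "poly s z = 0"
    proof -
      have "Polynomial.degree p \<le> Polynomial.degree s"
        using min[OF *(3) \<open>s \<noteq> 0\<close> that] .
      moreover have "Polynomial.degree p = Polynomial.degree u + Polynomial.degree s"
        using arg_cong[OF eq, of Polynomial.degree] *(2) u(2) \<open>s \<noteq> 0\<close> by (simp add: degree_mult_eq)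
      ultimately have "Polynomial.degree u' = 0"
        using hpoly_degree(2)[OF H u(1)] by simp
      then obtain b where "u' = [:b:]"
        by (metis degree_eq_zeroE)
      then show False
        using u hpoly_degree(1)[OF H u(1)] by simp
    qed
    ultimately show ?thesis by blast
  qed
  obtain c c' s s' r r' where *: "(c, c') \<in> H" "c \<noteq> 0" "hpoly H s s'" "hpoly H r r'"
    "Polynomial.smult c q = u * s + r" "Polynomial.smult c' q' = u' * s' + r'"
    "r = 0 \<or> Polynomial.degree r < Polynomial.degree u"
    using hpoly_division[OF H u(1,2) q] by blast
  have "poly (Polynomial.smult c' q') w = poly (u' * s' + r') w"
    using *(6) by simp
  then have "poly r' w = 0"
    using u(3) qw by simp
  then have "r = 0"
    using umin[OF *(4) _ *(7)] by blast
  then have "poly (Polynomial.smult c q) z = poly (u * s) z"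
    using *(5) by simp
  then show "poly q z = 0"
    using uz *(2) by simp
qed

text \<open>The hypothesis says exactly that sending q(z) to q'(w) is well defined and
  injective.\<close>

lemma hgraph_adjoin:
  assumes H: "hgraph H" and zw: "\<And>q q'. hpoly H q q' \<Longrightarrow> poly q z = 0 \<longleftrightarrow> poly q' w = 0"
  obtains H' where "hgraph H'" "H \<subseteq> H'" "(z, w) \<in> H'"
proof -
  define H' where "H' = {(poly q z, poly q' w) |q q'. hpoly H q q'}"
  have const: "hpoly H [:a:] [:b:]" if "(a, b) \<in> H" for a b
    using hpoly_monom[OF H that, of 0] by (simp add: monom_0)
  have "hgraph H'"
    unfolding hgraph_def
  proof (intro conjI allI impI)
    show "(1, 1) \<in> H'"
      unfolding H'_def using const[OF hgraphD(1)[OF H]] by force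
  next
    fix a b c d assume "(a, b) \<in> H'" "(c, d) \<in> H'"
    then obtain q q' r r' where *: "a = poly q z" "b = poly q' w" "hpoly H q q'"
      "c = poly r z" "d = poly r' w" "hpoly H r r'"
      unfolding H'_def by blast
    show "(a + c, b + d) \<in> H'"
      unfolding H'_def using hpoly_add[OF H *(3,6)] * poly_add by (metis (mono_tags, lifting) mem_Collect_eq)
    show "(a * c, b * d) \<in> H'"
      unfolding H'_def using hpoly_mult[OF H *(3,6)] * poly_mult by (metis (mono_tags, lifting) mem_Collect_eq)
  next
    fix a b assume "(a, b) \<in> H'"
    then obtain q q' where *: "a = poly q z" "b = poly q' w" "hpoly H q q'"
      unfolding H'_def by blast
    show "(- a, - b) \<in> H'"
      unfolding H'_def using hpoly_uminus[OF H *(3)] * poly_minus by (metis (mono_tags, lifting) mem_Collect_eq)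
    show "a = 0 \<longleftrightarrow> b = 0"
      using zw[OF *(3)] * by simp
  qed
  moreover have "H \<subseteq> H'"
    unfolding H'_def using const by force
  moreover have "hpoly H [:0, 1:] [:0, 1:]"
    using hpoly_monom[OF H hgraphD(1)[OF H], of 1] by (simp add: monom_altdef)
  then have "(z, w) \<in> H'"
    unfolding H'_def by force
  ultimately show thesis
    by (rule that)
qed

section \<open>Subfields and automorphisms over them\<close>

definition is_subfield :: "'k::field set \<Rightarrow> bool" where
  "is_subfield L \<longleftrightarrow> 1 \<in> L \<and> (\<forall>x\<in>L. \<forall>y\<in>L. x + y \<in> L \<and> x * y \<in> L) \<and> (\<forall>x\<in>L. - x \<in> L \<and> inverse x \<in> L)"

lemma subfieldD:
  assumes "is_subfield L"
  shows "1 \<in> L" "0 \<in> L"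
    and "x \<in> L \<Longrightarrow> y \<in> L \<Longrightarrow> x + y \<in> L" "x \<in> L \<Longrightarrow> y \<in> L \<Longrightarrow> x * y \<in> L"
    and "x \<in> L \<Longrightarrow> - x \<in> L" "x \<in> L \<Longrightarrow> inverse x \<in> L"
    and "x \<in> L \<Longrightarrow> y \<in> L \<Longrightarrow> x - y \<in> L" "x \<in> L \<Longrightarrow> y \<in> L \<Longrightarrow> x / y \<in> L"
    and "x \<in> L \<Longrightarrow> x ^ n \<in> L"
proof -
  have L: "1 \<in> L" "\<And>x y. x \<in> L \<Longrightarrow> y \<in> L \<Longrightarrow> x + y \<in> L" "\<And>x y. x \<in> L \<Longrightarrow> y \<in> L \<Longrightarrow> x * y \<in> L"
    "\<And>x. x \<in> L \<Longrightarrow> - x \<in> L" "\<And>x. x \<in> L \<Longrightarrow> inverse x \<in> L"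
    using assms unfolding is_subfield_def by blast+
  show "1 \<in> L" "x \<in> L \<Longrightarrow> y \<in> L \<Longrightarrow> x + y \<in> L" "x \<in> L \<Longrightarrow> y \<in> L \<Longrightarrow> x * y \<in> L"
    "x \<in> L \<Longrightarrow> - x \<in> L" "x \<in> L \<Longrightarrow> inverse x \<in> L"
    using L by blast+
  show "0 \<in> L"
    using L(2)[OF L(1) L(4)[OF L(1)]] by simp
  show "x \<in> L \<Longrightarrow> y \<in> L \<Longrightarrow> x - y \<in> L"
    using L(2)[OF _ L(4), of x y] by simp
  show "x \<in> L \<Longrightarrow> y \<in> L \<Longrightarrow> x / y \<in> L"
    using L(3)[OF _ L(5), of x y] by (simp add: divide_inverse)
  show "x \<in> L \<Longrightarrow> x ^ n \<in> L"
    by (induction n) (use L in auto)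
qed

definition pol :: "'k::field set \<Rightarrow> 'k poly \<Rightarrow> bool" where
  "pol L p \<longleftrightarrow> (\<forall>i. Polynomial.coeff p i \<in> L)"

lemma hgraph_diag: "is_subfield L \<Longrightarrow> hgraph ((\<lambda>x. (x, x)) ` L)"
  unfolding hgraph_def by (auto simp: is_subfield_def)

lemma hpoly_diag: "hpoly ((\<lambda>x. (x, x)) ` L) p q \<longleftrightarrow> p = q \<and> pol L p"
  unfolding hpoly_def pol_def poly_eq_iff by (auto simp: image_iff)

definition field_aut :: "('k::field \<Rightarrow> 'k) \<Rightarrow> bool" where
  "field_aut \<sigma> \<longleftrightarrow> bij \<sigma> \<and> (\<forall>x y. \<sigma> (x + y) = \<sigma> x + \<sigma> y \<and> \<sigma> (x * y) = \<sigma> x * \<sigma> y)"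

definition alg_over :: "'k::field set \<Rightarrow> bool" where
  "alg_over L \<longleftrightarrow> (\<forall>z. \<exists>p. pol L p \<and> p \<noteq> 0 \<and> poly p z = 0)"

text \<open>A maximal graph extending z to w exists by Zorn's lemma. It is total because any element
  can be adjoined, matched with a root of the image of its minimal polynomial.\<close>

lemma extend_to_automorphism:
  fixes L :: "'k::alg_closed_field set"
  assumes L: "is_subfield L" and alg: "alg_over L"
    and zw: "\<And>q. pol L q \<Longrightarrow> poly q z = 0 \<longleftrightarrow> poly q w = 0"
  obtains \<sigma> where "field_aut \<sigma>" "\<forall>x\<in>L. \<sigma> x = x" "\<sigma> z = w"
proof -
  let ?D = "(\<lambda>x. (x, x)) ` L"
  have D: "hgraph ?D"
    by (rule hgraph_diag[OF L])
  obtain H0 where H0: "hgraph H0" "?D \<subseteq> H0" "(z, w) \<in> H0"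
    by (rule hgraph_adjoin[OF D, of z w]) (use zw in \<open>auto simp: hpoly_diag\<close>)
  define A where "A = {H. hgraph H \<and> H0 \<subseteq> H}"
  have "\<exists>M\<in>A. \<forall>H\<in>A. M \<subseteq> H \<longrightarrow> H = M"
  proof (rule subset_Zorn_nonempty)
    show "A \<noteq> {}"
      using H0 by (auto simp: A_def)
  next
    fix C assume ne: "C \<noteq> {}" and ch: "subset.chain A C"
    have CA: "C \<subseteq> A" and tot: "\<And>H1 H2. H1 \<in> C \<Longrightarrow> H2 \<in> C \<Longrightarrow> H1 \<subseteq> H2 \<or> H2 \<subseteq> H1"
      using ch unfolding subset_chain_def by blast+
    have "hgraph (\<Union>C)"
      unfolding hgraph_def
    proof (intro conjI allI impI)
      show "(1, 1) \<in> \<Union>C"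
        using ne CA hgraphD(1) by (auto simp: A_def)
    next
      fix a b c d assume "(a, b) \<in> \<Union>C" "(c, d) \<in> \<Union>C"
      then obtain H1 H2 where "H1 \<in> C" "(a, b) \<in> H1" "H2 \<in> C" "(c, d) \<in> H2"
        by blast
      then obtain H where H: "H \<in> C" "(a, b) \<in> H" "(c, d) \<in> H"
        using tot[of H1 H2] by blast
      then have "hgraph H"
        using CA by (auto simp: A_def)
      then show "(a + c, b + d) \<in> \<Union>C" "(a * c, b * d) \<in> \<Union>C"
        using H hgraphD(3,4) by blast+
    next
      fix a b assume "(a, b) \<in> \<Union>C"
      then obtain H where H: "H \<in> C" "(a, b) \<in> H"
        by blast
      then have "hgraph H"
        using CA by (auto simp: A_def)
      then show "(- a, - b) \<in> \<Union>C" "a = 0 \<longleftrightarrow> b = 0"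
        using H hgraphD(5,6) by blast+
    qed
    moreover have "H0 \<subseteq> \<Union>C"
      using ne CA by (auto simp: A_def)
    ultimately show "\<Union>C \<in> A"
      by (simp add: A_def)
  qed
  then obtain M where MA: "M \<in> A" and MA_max: "\<forall>H\<in>A. M \<subseteq> H \<longrightarrow> H = M"
    by (elim bexE)
  have M: "hgraph M" "H0 \<subseteq> M"
    using MA by (auto simp: A_def)
  have max: "H = M" if "hgraph H" "M \<subseteq> H" for H
  proof -
    have "H \<in> A"
      using that M(2) by (auto simp: A_def)
    then show ?thesis
      using MA_max that(2) by blast
  qed
  have diag: "(x, x) \<in> M" if "x \<in> L" for x
    using that H0(2) M(2) by blast
  have total: "\<exists>v. (u, v) \<in> M" for u
  proof -
    define Q where "Q n \<longleftrightarrow> (\<exists>p p'. hpoly M p p' \<and> p \<noteq> 0 \<and> poly p u = 0 \<and> Polynomial.degree p = n)" for n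
    obtain p0 where p0: "pol L p0" "p0 \<noteq> 0" "poly p0 u = 0"
      using alg unfolding alg_over_def by blast
    then have "hpoly M p0 p0"
      unfolding hpoly_def pol_def using diag by blast
    with p0 have "Q (Polynomial.degree p0)"
      unfolding Q_def by blast
    then have "Q (LEAST n. Q n)"
      by (rule LeastI)
    then obtain p p' where p: "hpoly M p p'" "p \<noteq> 0" "poly p u = 0" "Polynomial.degree p = (LEAST n. Q n)"
      unfolding Q_def by blast
    have min: "Polynomial.degree p \<le> Polynomial.degree q" if "hpoly M q q'" "q \<noteq> 0" "poly q u = 0" for q q'
      unfolding p(4) by (rule Least_le) (use that in \<open>auto simp: Q_def\<close>)
    have "Polynomial.degree p > 0"
    proof (rule ccontr)
      assume "\<not> Polynomial.degree p > 0"
      then obtain b where "p = [:b:]"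
        by (metis degree_eq_zeroE gr0I)
      then show False
        using p by simp
    qed
    then obtain v where v: "poly p' v = 0"
      using alg_closed_imp_poly_has_root[of p'] hpoly_degree(2)[OF M(1) p(1)] by auto
    have "poly q u = 0 \<longleftrightarrow> poly q' v = 0" if "hpoly M q q'" for q q'
      by (rule hgraph_root[OF M(1) p(1-3) min v that])
    then obtain H where H: "hgraph H" "M \<subseteq> H" "(u, v) \<in> H"
      using hgraph_adjoin[OF M(1)] by metis
    then show ?thesis
      using max by blast
  qed
  have single: "v = v'" if "(u, v) \<in> M" "(u, v') \<in> M" for u v v'
  proof -
    have "(u + - u, v + - v') \<in> M"
      using hgraphD(3,5)[OF M(1)] that by blast
    then show ?thesis
      using hgraphD(6)[OF M(1)] by fastforce
  qed
  define \<sigma> where "\<sigma> u = (THE v. (u, v) \<in> M)" for u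
  have \<sigma>: "(u, \<sigma> u) \<in> M" for u
    unfolding \<sigma>_def using total[of u] single by (metis theI)
  have \<sigma>_eq: "\<sigma> u = v" if "(u, v) \<in> M" for u v
    using single[OF \<sigma> that] .
  have add: "\<sigma> (x + y) = \<sigma> x + \<sigma> y" and mult: "\<sigma> (x * y) = \<sigma> x * \<sigma> y" for x y
    using \<sigma>_eq hgraphD(3,4)[OF M(1)] \<sigma> by blast+
  have fixL: "\<sigma> x = x" if "x \<in> L" for x
    using \<sigma>_eq diag[OF that] by blast
  have "inj \<sigma>"
  proof (rule injI)
    fix x y assume "\<sigma> x = \<sigma> y"
    then have "(x + - y, 0) \<in> M"
      using hgraphD(3)[OF M(1) \<sigma>[of x] hgraphD(5)[OF M(1) \<sigma>[of y]]] by simp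
    then show "x = y"
      using hgraphD(6)[OF M(1)] by fastforce
  qed
  moreover have "surj \<sigma>"
    unfolding surj_def
  proof
    fix y
    obtain p where p: "pol L p" "p \<noteq> 0" "poly p y = 0"
      using alg unfolding alg_over_def by blast
    \<comment> \<open>Surjectivity comes from algebraicity: the finite root set of a polynomial over
      L is mapped injectively into itself, hence onto itself.\<close>
    let ?R = "{x. poly p x = 0}"
    have fin: "finite ?R"
      by (rule poly_roots_finite[OF p(2)])
    have sum: "\<sigma> (\<Sum>i\<in>B. f i) = (\<Sum>i\<in>B. \<sigma> (f i))" if "finite B" for B and f :: "nat \<Rightarrow> 'k"
      using that by (induction B) (use fixL[OF subfieldD(2)[OF L]] add in auto)
    have pow: "\<sigma> (x ^ n) = \<sigma> x ^ n" for x n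
      by (induction n) (use fixL[OF subfieldD(1)[OF L]] mult in auto)
    have "\<sigma> (poly p x) = poly p (\<sigma> x)" for x
      unfolding poly_altdef using p(1) by (simp add: sum mult pow fixL pol_def)
    then have "\<sigma> ` ?R \<subseteq> ?R"
      using fixL[OF subfieldD(2)[OF L]] by (auto) metis
    then have "\<sigma> ` ?R = ?R"
      using fin \<open>inj \<sigma>\<close> by (metis endo_inj_surj inj_on_subset subset_UNIV)
    then show "\<exists>x. y = \<sigma> x"
      using p(3) by blast
  qed
  ultimately have "field_aut \<sigma>"
    using add mult by (simp add: field_aut_def bij_def)
  moreover have "\<sigma> z = w"
    using \<sigma>_eq H0(3) M(2) by blast
  ultimately show thesis
    using that fixL by blast
qed

text \<open>Every root of the minimal polynomial of z is the image of z under an automorphism over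
  L, hence z itself. The polynomial is therefore a power of X - z, with \<open>d > 1\<close> in the
  inseparable case.\<close>

lemma fixed_minimal_polynomial:
  fixes L :: "'k::alg_closed_field set"
  assumes L: "is_subfield L" and alg: "alg_over L"
    and fixed: "\<forall>\<sigma>. field_aut \<sigma> \<longrightarrow> (\<forall>x\<in>L. \<sigma> x = x) \<longrightarrow> \<sigma> z = z"
  obtains d where "d > 0" "pol L ([:- z, 1:] ^ d)"
    "\<And>q. pol L q \<Longrightarrow> poly q z = 0 \<Longrightarrow> \<exists>s. pol L s \<and> q = [:- z, 1:] ^ d * s"
proof -
  let ?D = "(\<lambda>x. (x, x)) ` L"
  have D: "hgraph ?D"
    by (rule hgraph_diag[OF L])
  define Q where "Q n \<longleftrightarrow> (\<exists>p. pol L p \<and> p \<noteq> 0 \<and> poly p z = 0 \<and> Polynomial.degree p = n)" for n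
  have "\<exists>n. Q n"
    using alg unfolding alg_over_def Q_def by blast
  then have "Q (LEAST n. Q n)"
    by (rule LeastI_ex)
  then obtain p where p: "pol L p" "p \<noteq> 0" "poly p z = 0" "Polynomial.degree p = (LEAST n. Q n)"
    unfolding Q_def by blast
  have min: "Polynomial.degree p \<le> Polynomial.degree q" if "pol L q" "q \<noteq> 0" "poly q z = 0" for q
    unfolding p(4) by (rule Least_le) (use that in \<open>auto simp: Q_def\<close>)
  have root: "w = z" if w: "poly p w = 0" for w
  proof -
    have "poly q z = 0 \<longleftrightarrow> poly q w = 0" if "pol L q" for q
      by (rule hgraph_root[OF D _ p(2,3) _ w]) (use p(1) min that in \<open>auto simp: hpoly_diag\<close>)
    then obtain \<sigma> where "field_aut \<sigma>" "\<forall>x\<in>L. \<sigma> x = x" "\<sigma> z = w"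
      using extend_to_automorphism[OF L alg, of z w] by metis
    then show ?thesis
      using fixed by metis
  qed
  obtain A where A: "size A = Polynomial.degree p" "p = Polynomial.smult (lead_coeff p) (\<Prod>x\<in>#A. [:-x, 1:])"
    using alg_closed_imp_factorization[OF p(2)] by blast
  have "x = z" if "x \<in># A" for x
  proof (rule root)
    have "[:-x, 1:] dvd (\<Prod>x\<in>#A. [:-x, 1:])"
      using that by (intro dvd_prod_mset) auto
    then have "[:-x, 1:] dvd p"
      by (subst A(2)) (rule dvd_smult)
    then show "poly p x = 0"
      by (simp add: poly_eq_0_iff_dvd)
  qed
  then have "A = replicate_mset (size A) z"
    by (metis set_mset_subset_singletonD singleton_iff subsetI)
  then obtain d where d: "A = replicate_mset d z"
    by blast
  have p_eq: "p = Polynomial.smult (lead_coeff p) ([:- z, 1:] ^ d)"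
    by (subst A(2)) (simp add: d)
  have lead: "lead_coeff p \<noteq> 0" "lead_coeff p \<in> L"
    using p(1,2) by (simp_all add: pol_def)
  have mon: "[:- z, 1:] ^ d = Polynomial.smult (inverse (lead_coeff p)) p"
    using lead(1) by (subst p_eq) simp
  show thesis
  proof (rule that)
    show "d > 0"
    proof (rule ccontr)
      assume "\<not> d > 0"
      then have "p = [:lead_coeff p:]"
        using p_eq by simp
      then have "poly p z = lead_coeff p"
        by (metis poly_const_conv)
      then show False
        using p(3) lead(1) by simp
    qed
    show "pol L ([:- z, 1:] ^ d)"
      unfolding mon pol_def using p(1) lead(2) by (auto simp: pol_def intro: subfieldD[OF L])
  next
    fix q assume q: "pol L q" "poly q z = 0"
    have "hpoly ?D p p" "hpoly ?D q q"
      using p(1) q(1) by (simp_all add: hpoly_diag)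
    from hpoly_division[OF D this(1) p(2) this(2)] obtain c s r where
      *: "c \<in> L" "c \<noteq> 0" "pol L s" "pol L r" "Polynomial.smult c q = p * s + r"
        "r = 0 \<or> Polynomial.degree r < Polynomial.degree p"
      unfolding hpoly_diag by blast
    have "poly (Polynomial.smult c q) z = poly (p * s + r) z"
      using *(5) by simp
    then have "poly r z = 0"
      using q(2) p(3) by simp
    then have "r = 0"
      using min[OF *(4)] *(6) by force
    then have "Polynomial.smult c q = p * s"
      using *(5) by simp
    then have "q = Polynomial.smult (inverse c) (p * s)"
      using *(2) by (metis field_class.field_inverse smult_1_left smult_smult)
    also have "\<dots> = [:- z, 1:] ^ d * Polynomial.smult (inverse c * lead_coeff p) s"
      by (subst p_eq) (simp add: mult_ac)
    finally have "q = [:- z, 1:] ^ d * Polynomial.smult (inverse c * lead_coeff p) s" .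
    moreover have "pol L (Polynomial.smult (inverse c * lead_coeff p) s)"
      using *(1,3) lead(2) by (auto simp: pol_def intro!: subfieldD[OF L])
    ultimately show "\<exists>s. pol L s \<and> q = [:- z, 1:] ^ d * s"
      by blast
  qed
qed

text \<open>A polynomial over L with a simple root at z is divisible by the minimal polynomial (X -
  z)^d, so d = 1.\<close>

lemma fixed_separable:
  fixes L :: "'k::alg_closed_field set"
  assumes L: "is_subfield L" and alg: "alg_over L"
    and fixed: "\<forall>\<sigma>. field_aut \<sigma> \<longrightarrow> (\<forall>x\<in>L. \<sigma> x = x) \<longrightarrow> \<sigma> z = z"
    and q: "pol L q" "poly q z = 0" "poly (pderiv q) z \<noteq> 0"
  shows "z \<in> L"
proof -
  obtain d where d: "d > 0" "pol L ([:- z, 1:] ^ d)"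
    "\<exists>s. pol L s \<and> q = [:- z, 1:] ^ d * s"
    by (rule fixed_minimal_polynomial[OF L alg fixed]) (use q(1,2) in blast)
  then obtain s where s: "q = [:- z, 1:] ^ d * s"
    by blast
  have "d = 1"
  proof (rule ccontr)
    assume "d \<noteq> 1"
    then obtain k where k: "d = Suc (Suc k)"
      using d(1) by (metis One_nat_def Suc_pred gr0I not0_implies_Suc)
    have "q = [:- z, 1:] * ([:- z, 1:] * ([:- z, 1:] ^ k * s))"
      unfolding s k by (simp only: power_Suc mult.assoc)
    then have "poly (pderiv q) z = 0"
      by (simp only: pderiv_mult) simp
    with q(3) show False by simp
  qed
  then have "Polynomial.coeff [:- z, 1:] 0 \<in> L"
    using d(2) unfolding pol_def by (metis power_one_right)
  then have "- z \<in> L" by simp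
  from subfieldD(5)[OF L this] show ?thesis by simp
qed

subsection \<open>Galois equivariance\<close>

lemma field_autD:
  fixes \<sigma> :: "'k::field \<Rightarrow> 'k"
  assumes "field_aut \<sigma>"
  shows "\<sigma> (x + y) = \<sigma> x + \<sigma> y" "\<sigma> (x * y) = \<sigma> x * \<sigma> y" "\<sigma> x = \<sigma> y \<longleftrightarrow> x = y" "\<sigma> 0 = 0" "\<sigma> 1 = 1"
    "\<sigma> (- x) = - \<sigma> x" "\<sigma> (x - y) = \<sigma> x - \<sigma> y" "\<sigma> (inverse x) = inverse (\<sigma> x)" "\<sigma> (x / y) = \<sigma> x / \<sigma> y"
    "\<sigma> (x ^ n) = \<sigma> x ^ n" "\<sigma> (numeral v) = numeral v" "\<sigma> x = 0 \<longleftrightarrow> x = 0" "\<sigma> (x powi k) = \<sigma> x powi k"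
proof -
  have add: "\<sigma> (x + y) = \<sigma> x + \<sigma> y" and mult: "\<sigma> (x * y) = \<sigma> x * \<sigma> y" and bij: "bij \<sigma>" for x y
    using assms unfolding field_aut_def by blast+
  have inj: "\<sigma> x = \<sigma> y \<longleftrightarrow> x = y" for x y
    using bij by (simp add: bij_def inj_eq)
  have zero: "\<sigma> 0 = 0"
    using add[of 0 0] by (metis add.right_neutral add_left_cancel)
  have eq0: "\<sigma> x = 0 \<longleftrightarrow> x = 0" for x
    using inj[of x 0] zero by simp
  have one: "\<sigma> 1 = 1"
    using mult[of 1 1] eq0[of 1] by simp
  have uminus: "\<sigma> (- x) = - \<sigma> x" for x
    using add[of x "- x"] zero by (simp add: eq_neg_iff_add_eq_0 add.commute)
  have inverse: "\<sigma> (inverse x) = inverse (\<sigma> x)" for x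
  proof (cases "x = 0")
    case False
    then have "\<sigma> x * \<sigma> (inverse x) = 1"
      using mult[of x "inverse x"] one by simp
    then show ?thesis
      by (metis inverse_unique)
  qed (simp add: zero)
  have pow: "\<sigma> (x ^ n) = \<sigma> x ^ n" for x n
    by (induction n) (simp_all add: one mult)
  have nat: "\<sigma> (of_nat n) = of_nat n" for n
    by (induction n) (simp_all add: zero one add)
  show "\<sigma> (x + y) = \<sigma> x + \<sigma> y" "\<sigma> (x * y) = \<sigma> x * \<sigma> y" "\<sigma> x = \<sigma> y \<longleftrightarrow> x = y" "\<sigma> 0 = 0" "\<sigma> 1 = 1"
    "\<sigma> (- x) = - \<sigma> x" "\<sigma> (inverse x) = inverse (\<sigma> x)" "\<sigma> (x ^ n) = \<sigma> x ^ n" "\<sigma> x = 0 \<longleftrightarrow> x = 0"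
    by (fact add mult inj zero one uminus inverse pow eq0)+
  show "\<sigma> (x - y) = \<sigma> x - \<sigma> y"
    using add[of x "- y"] uminus by simp
  show "\<sigma> (x / y) = \<sigma> x / \<sigma> y"
    by (simp add: divide_inverse mult inverse)
  show "\<sigma> (numeral v) = numeral v"
    using nat[of "numeral v"] by simp
  show "\<sigma> (x powi k) = \<sigma> x powi k"
    by (simp add: power_int_def pow inverse)
qed

lemma field_aut_inv:
  assumes "field_aut \<sigma>"
  shows "field_aut (inv_into UNIV \<sigma>)" "\<sigma> (inv_into UNIV \<sigma> x) = x" "inv_into UNIV \<sigma> (\<sigma> x) = x"
proof -
  have bij: "bij \<sigma>"
    using assms by (simp add: field_aut_def)
  show 1: "\<sigma> (inv_into UNIV \<sigma> x) = x" for x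
    using bij by (simp add: bij_def surj_f_inv_f)
  show 2: "inv_into UNIV \<sigma> (\<sigma> x) = x" for x
    using bij by (simp add: bij_def)
  have "inv_into UNIV \<sigma> (x + y) = inv_into UNIV \<sigma> x + inv_into UNIV \<sigma> y"
    "inv_into UNIV \<sigma> (x * y) = inv_into UNIV \<sigma> x * inv_into UNIV \<sigma> y" for x y
    using field_autD(1,2)[OF assms, of "inv_into UNIV \<sigma> x" "inv_into UNIV \<sigma> y"] 1 2 by metis+
  then show "field_aut (inv_into UNIV \<sigma>)"
    using bij bij_imp_bij_inv by (auto simp: field_aut_def)
qed

lemma poly_map_aut:
  assumes "field_aut \<sigma>"
  shows "\<sigma> (poly p x) = poly (map_poly \<sigma> p) (\<sigma> x)"
  by (induction p) (simp_all add: map_poly_pCons field_autD[OF assms])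

lemma map_poly_aut_degree:
  assumes "field_aut \<sigma>"
  shows "Polynomial.degree (map_poly \<sigma> p) = Polynomial.degree p" "map_poly \<sigma> p = 0 \<longleftrightarrow> p = 0"
proof -
  have c: "Polynomial.coeff (map_poly \<sigma> p) i = \<sigma> (Polynomial.coeff p i)" for i
    by (simp add: coeff_map_poly field_autD[OF assms])
  show "Polynomial.degree (map_poly \<sigma> p) = Polynomial.degree p"
    unfolding Polynomial.degree_def c field_autD(12)[OF assms] ..
  show "map_poly \<sigma> p = 0 \<longleftrightarrow> p = 0"
    unfolding poly_eq_iff c by (simp add: field_autD[OF assms])
qed

context ell
begin

definition adm :: "('k \<Rightarrow> 'k) \<Rightarrow> bool" where
  "adm \<sigma> \<longleftrightarrow> field_aut \<sigma> \<and> \<sigma> a1 = a1 \<and> \<sigma> a2 = a2 \<and> \<sigma> a3 = a3 \<and> \<sigma> a4 = a4 \<and> \<sigma> a6 = a6"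

abbreviation sp :: "('k \<Rightarrow> 'k) \<Rightarrow> 'k ec_point \<Rightarrow> 'k ec_point" where
  "sp \<equiv> map_ec_point"

lemma adm_inv:
  assumes "adm \<sigma>"
  shows "adm (inv_into UNIV \<sigma>)"
  using assms field_aut_inv[of \<sigma>] unfolding adm_def by metis

lemma adm_aut: "adm \<sigma> \<Longrightarrow> field_aut \<sigma>"
  by (simp add: adm_def)

lemma sp_sp:
  assumes "adm \<sigma>"
  shows "sp \<sigma> (sp (inv_into UNIV \<sigma>) P) = P" "sp (inv_into UNIV \<sigma>) (sp \<sigma> P) = P"
  by (cases P; simp add: field_aut_inv[OF adm_aut[OF assms]])+

lemma sp_eq_iff: "adm \<sigma> \<Longrightarrow> sp \<sigma> P = sp \<sigma> Q \<longleftrightarrow> P = Q"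
  by (metis sp_sp(2))

lemma sp_eq_Infinity [simp]: "sp \<sigma> P = Infinity \<longleftrightarrow> P = Infinity"
  by (cases P) auto

lemma curve_sp:
  assumes "adm \<sigma>" "curve x y"
  shows "curve (\<sigma> x) (\<sigma> y)"
proof -
  have "\<sigma> (y ^ 2 + a1 * x * y + a3 * y) = \<sigma> (x ^ 3 + a2 * x ^ 2 + a4 * x + a6)"
    using assms(2) by (simp add: curve_def)
  then show ?thesis
    using assms(1) unfolding curve_def adm_def by (simp add: field_autD)
qed

lemma sp_aff [simp]:
  assumes "adm \<sigma>"
  shows "sp \<sigma> P \<in> aff \<longleftrightarrow> P \<in> aff"
proof -
  have *: "sp \<tau> Q \<in> aff" if "adm \<tau>" "Q \<in> aff" for \<tau> Q
    using that curve_sp by (auto elim!: affE)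
  show ?thesis
    using *[OF assms, of P] *[OF adm_inv[OF assms], of "sp \<sigma> P"] sp_sp(2)[OF assms] by auto
qed

lemma sp_points [simp]: "adm \<sigma> \<Longrightarrow> sp \<sigma> P \<in> points E \<longleftrightarrow> P \<in> points E"
  by (simp add: points_eq)

lemma sp_add:
  assumes "adm \<sigma>"
  shows "sp \<sigma> (P \<boxplus> Q) = sp \<sigma> P \<boxplus> sp \<sigma> Q"
proof (cases P; cases Q)
  fix x1 y1 x2 y2 assume PQ: "P = Affine x1 y1" "Q = Affine x2 y2"
  have a: "field_aut \<sigma>" "\<sigma> a1 = a1" "\<sigma> a2 = a2" "\<sigma> a3 = a3" "\<sigma> a4 = a4" "\<sigma> a6 = a6"
    using assms by (auto simp: adm_def)
  have z: "\<sigma> y1 + \<sigma> y2 + a1 * \<sigma> x2 + a3 = 0 \<longleftrightarrow> y1 + y2 + a1 * x2 + a3 = 0"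
    using field_autD(12)[OF a(1), of "y1 + y2 + a1 * x2 + a3"] by (simp add: field_autD[OF a(1)] a)
  show ?thesis
    unfolding PQ ec_point.map ec_add.simps z field_autD(3)[OF a(1)] Let_def
    by (simp add: field_autD[OF a(1)] a)
qed auto

lemma sp_mult: "adm \<sigma> \<Longrightarrow> sp \<sigma> (ec_mult E n P) = ec_mult E n (sp \<sigma> P)"
  by (induction n) (simp_all add: mult_Suc sp_add)

lemma sp_neg: "adm \<sigma> \<Longrightarrow> sp \<sigma> (neg P) = neg (sp \<sigma> P)"
  by (cases P) (simp_all add: field_autD adm_def)

lemma sp_torsion [simp]: "adm \<sigma> \<Longrightarrow> sp \<sigma> P \<in> torsion E m \<longleftrightarrow> P \<in> torsion E m"
  by (simp add: torsion_def flip: sp_mult)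

lemma cof_sp:
  assumes "adm \<sigma>"
  shows "filterlim (sp \<sigma>) cof cof"
  unfolding filterlim_iff
proof (intro allI impI)
  let ?t = "inv_into UNIV \<sigma>"
  fix Q assume "eventually Q cof"
  then have "finite (sp ?t ` {P \<in> aff. \<not> Q P})"
    by (simp add: eventually_cof)
  moreover have "{P \<in> aff. \<not> Q (sp \<sigma> P)} \<subseteq> sp ?t ` {P \<in> aff. \<not> Q P}"
  proof
    fix P assume "P \<in> {P \<in> aff. \<not> Q (sp \<sigma> P)}"
    then show "P \<in> sp ?t ` {P \<in> aff. \<not> Q P}"
      using assms by (intro image_eqI[of _ _ "sp \<sigma> P"]) (simp_all add: sp_sp)
  qed
  ultimately show "\<forall>\<^sub>F P in cof. Q (sp \<sigma> P)"
    unfolding eventually_cof by (rule rev_finite_subset)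
qed

text \<open>The Galois action on functions; on a(x) + b(x) y it amounts to applying \<sigma> to the
  coefficients.\<close>

definition cj :: "('k \<Rightarrow> 'k) \<Rightarrow> ('k ec_point \<Rightarrow> 'k) \<Rightarrow> 'k ec_point \<Rightarrow> 'k" where
  "cj \<sigma> f Z = \<sigma> (f (sp (inv_into UNIV \<sigma>) Z))"

lemma px_sp: "field_aut \<sigma> \<Longrightarrow> px (sp \<sigma> P) = \<sigma> (px P)" and py_sp: "field_aut \<sigma> \<Longrightarrow> py (sp \<sigma> P) = \<sigma> (py P)"
  by (cases P; simp add: field_autD)+

lemma cj_lin:
  assumes "adm \<sigma>"
  shows "cj \<sigma> (lin a b) Z = lin (map_poly \<sigma> a) (map_poly \<sigma> b) Z"
proof -
  let ?W = "sp (inv_into UNIV \<sigma>) Z"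
  have Z: "Z = sp \<sigma> ?W"
    using sp_sp(1)[OF assms] by simp
  have "cj \<sigma> (lin a b) Z = \<sigma> (lin a b ?W)"
    by (simp add: cj_def)
  also have "\<dots> = lin (map_poly \<sigma> a) (map_poly \<sigma> b) (sp \<sigma> ?W)"
    using adm_aut[OF assms] by (simp add: lin_def px_sp py_sp field_autD poly_map_aut)
  finally show ?thesis
    using Z by simp
qed

lemma cj_reg:
  assumes "adm \<sigma>" "reg f"
  shows "reg (cj \<sigma> f)"
proof -
  obtain a b where ab: "\<And>P. P \<in> aff \<Longrightarrow> f P = lin a b P"
    using assms(2) by (auto simp: reg_def)
  have "cj \<sigma> f P = lin (map_poly \<sigma> a) (map_poly \<sigma> b) P" if "P \<in> aff" for P
    using cj_lin[OF assms(1), of a b P] ab[of "sp (inv_into UNIV \<sigma>) P"] that adm_inv[OF assms(1)]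
    by (simp add: cj_def)
  then show ?thesis
    unfolding reg_def by blast
qed

lemma cj_ev:
  assumes "adm \<sigma>" "\<forall>\<^sub>F Z in cof. Q Z"
  shows "\<forall>\<^sub>F Z in cof. Q (sp (inv_into UNIV \<sigma>) Z)"
  by (rule cof_compose[OF cof_sp[OF adm_inv[OF assms(1)]] assms(2)])

lemma cj_hord:
  assumes s: "adm \<sigma>" and f: "hord P f n"
  shows "hord (sp \<sigma> P) (cj \<sigma> f) n"
proof (cases "P = Infinity")
  case True
  then have "hord Infinity f n"
    using f by simp
  then obtain a b c d where *: "a \<noteq> 0 \<or> b \<noteq> 0" "c \<noteq> 0 \<or> d \<noteq> 0"
    "\<forall>\<^sub>F Z in cof. f Z * lin c d Z = lin a b Z" "n = int (dg c d) - int (dg a b)"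
    by (rule hord_infE)
  note m = map_poly_aut_degree[OF adm_aut[OF s]]
  have dg: "dg (map_poly \<sigma> a) (map_poly \<sigma> b) = dg a b" for a b
    unfolding dg_def m ..
  have "\<forall>\<^sub>F Z in cof. cj \<sigma> f Z * lin (map_poly \<sigma> c) (map_poly \<sigma> d) Z = lin (map_poly \<sigma> a) (map_poly \<sigma> b) Z"
    using cj_ev[OF s *(3)]
  proof eventually_elim
    case (elim Z)
    show ?case
      unfolding cj_lin[OF s, symmetric] using elim
      by (simp add: cj_def flip: field_autD(2)[OF adm_aut[OF s]])
  qed
  then show ?thesis
    unfolding True ec_point.map using *(1,2,4)
    by (intro hord_infI[of "map_poly \<sigma> a" "map_poly \<sigma> b" "map_poly \<sigma> c" "map_poly \<sigma> d"]) (simp_all add: m dg)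
next
  case False
  then have P: "P \<in> aff"
    using hord_points[OF f] by (simp add: points_eq)
  obtain S U where *: "reg S" "reg U" "S P \<noteq> 0" "U P \<noteq> 0"
    "\<forall>\<^sub>F Z in cof. S Z * f Z = U Z * unif P Z powi n"
    by (rule hord_affE[OF f P])
  note a = adm_aut[OF s]
  have dy: "dy (sp \<sigma> P) = \<sigma> (dy P)"
    using s by (simp add: dy_def px_sp py_sp field_autD adm_def)
  have unif: "unif (sp \<sigma> P) (sp \<sigma> Z) = \<sigma> (unif P Z)" for Z
    unfolding unif_def dy by (simp add: px_sp[OF a] py_sp[OF a] field_autD[OF a])
  have "\<forall>\<^sub>F Z in cof. cj \<sigma> S Z * cj \<sigma> f Z = cj \<sigma> U Z * unif (sp \<sigma> P) Z powi n"
    using cj_ev[OF s *(5)]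
  proof eventually_elim
    case (elim Z)
    let ?W = "sp (inv_into UNIV \<sigma>) Z"
    have "\<sigma> (S ?W * f ?W) = \<sigma> (U ?W * unif P ?W powi n)"
      using elim by simp
    then have "\<sigma> (S ?W) * \<sigma> (f ?W) = \<sigma> (U ?W) * \<sigma> (unif P ?W) powi n"
      by (simp add: field_autD[OF a])
    then show ?case
      unfolding cj_def unif[symmetric] sp_sp(1)[OF s] .
  qed
  moreover have "cj \<sigma> S (sp \<sigma> P) \<noteq> 0" "cj \<sigma> U (sp \<sigma> P) \<noteq> 0"
    using *(3,4) by (simp_all add: cj_def sp_sp[OF s] field_autD[OF a])
  ultimately show ?thesis
    using P s *(1,2)
    by (intro hord_affI[where S = "cj \<sigma> S" and U = "cj \<sigma> U"]) (simp_all add: cj_reg)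
qed

end

context ell_tor
begin

text \<open>The conjugate of a function for T has the divisor required for \<sigma> T, because
  \<sigma> commutes with [m]; conjugating the multiplier relation gives the value.\<close>

lemma ep_equivariant:
  assumes s: "adm \<sigma>" and S: "S \<in> torsion E m" and T: "T \<in> torsion E m"
  shows "ep (sp \<sigma> S) (sp \<sigma> T) = \<sigma> (ep S T)"
proof -
  let ?t = "inv_into UNIV \<sigma>"
  obtain g where g: "isg T g"
    by (rule isg_ex[OF T])
  have "isg (sp \<sigma> T) (cj \<sigma> g)"
    unfolding isg_def
  proof
    fix P assume P: "P \<in> points E"
    define Q where "Q = sp ?t P"
    have Q: "Q \<in> points E"
      using P adm_inv[OF s] by (simp add: Q_def)
    have PQ: "P = sp \<sigma> Q"
      by (simp add: Q_def sp_sp[OF s])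
    have mu: "mu P = sp \<sigma> (mu Q)"
      unfolding PQ by (simp add: sp_mult[OF s])
    show "hord P (cj \<sigma> g) (of_bool (mu P = sp \<sigma> T) - of_bool (mu P = Infinity))"
      unfolding mu sp_eq_iff[OF s] sp_eq_Infinity unfolding PQ
      by (rule cj_hord[OF s isgD[OF g Q]])
  qed
  moreover have "\<forall>\<^sub>F Z in cof. cj \<sigma> g (tau (sp \<sigma> S) Z) = \<sigma> (ep S T) * cj \<sigma> g Z"
    using cj_ev[OF s ep_spec(2)[OF S g]]
  proof eventually_elim
    case (elim Z)
    have "sp ?t (tau (sp \<sigma> S) Z) = tau S (sp ?t Z)"
      by (simp add: tau_def sp_add[OF adm_inv[OF s]] sp_sp[OF s])
    then show ?case
      using elim by (simp add: cj_def field_autD[OF adm_aut[OF s]])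
  qed
  ultimately show ?thesis
    using S s by (intro ep_eq) auto
qed

end

subsection \<open>The action on a basis of the torsion\<close>

lemma pol_pCons [simp]: "pol L (pCons a p) \<longleftrightarrow> a \<in> L \<and> pol L p"
proof
  assume "pol L (pCons a p)"
  then have *: "Polynomial.coeff (pCons a p) i \<in> L" for i
    by (simp add: pol_def)
  show "a \<in> L \<and> pol L p"
    using *[of 0] *[of "Suc i" for i] by (simp add: pol_def)
qed (auto simp: pol_def coeff_pCons split: nat.split)

lemma pol_0: "is_subfield L \<Longrightarrow> pol L 0"
  by (simp add: pol_def subfieldD)

lemma subfield_numeral: "is_subfield L \<Longrightarrow> numeral v \<in> L"
proof -
  assume L: "is_subfield L"
  have "of_nat n \<in> L" for n
    by (induction n) (auto intro: subfieldD[OF L])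
  from this[of "numeral v"] show ?thesis by simp
qed

lemma field_aut_comp: "field_aut \<sigma> \<Longrightarrow> field_aut \<tau> \<Longrightarrow> field_aut (\<lambda>x. \<sigma> (\<tau> x))"
  unfolding field_aut_def using bij_comp[of \<tau> \<sigma>] by (simp add: comp_def)

context ell
begin

text \<open>Since \<open>px\<close> and \<open>py\<close> are 0 at infinity, the point O counts as
  rational over every subfield, so these points are closed under addition.\<close>

definition onL :: "'k set \<Rightarrow> 'k ec_point \<Rightarrow> bool" where
  "onL L P \<longleftrightarrow> px P \<in> L \<and> py P \<in> L"

lemma onL_add:
  assumes L: "is_subfield L" and a: "a1 \<in> L" "a2 \<in> L" "a3 \<in> L" "a4 \<in> L"
    and P: "onL L P" and Q: "onL L Q"
  shows "onL L (P \<boxplus> Q)"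
proof (cases P; cases Q)
  fix x1 y1 x2 y2 assume PQ: "P = Affine x1 y1" "Q = Affine x2 y2"
  have xy: "x1 \<in> L" "y1 \<in> L" "x2 \<in> L" "y2 \<in> L"
    using P Q by (auto simp: onL_def PQ)
  note sf = subfieldD[OF L] subfield_numeral[OF L]
  show ?thesis
  proof (cases "x1 = x2 \<and> y1 + y2 + a1 * x2 + a3 = 0")
    case True
    then show ?thesis
      using sf(2) by (simp add: PQ onL_def)
  next
    case False
    define l where "l = (if x1 = x2 then (3 * x1 ^ 2 + 2 * a2 * x1 + a4 - a1 * y1) / (2 * y1 + a1 * x1 + a3)
      else (y2 - y1) / (x2 - x1))"
    have "l \<in> L"
      unfolding l_def using xy a by (auto intro!: sf)
    moreover have "P \<boxplus> Q = Affine (l ^ 2 + a1 * l - a2 - x1 - x2)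
        (- (l + a1) * (l ^ 2 + a1 * l - a2 - x1 - x2) - (y1 - l * x1) - a3)"
      unfolding PQ ec_add.simps Let_def l_def[symmetric] using False by simp
    ultimately show ?thesis
      unfolding onL_def using xy a by (auto intro!: sf(3-9))
  qed
qed (use P Q in auto)

lemma onL_mult:
  assumes "is_subfield L" "a1 \<in> L" "a2 \<in> L" "a3 \<in> L" "a4 \<in> L" "onL L P"
  shows "onL L (ec_mult E n P)"
proof (induction n)
  case 0
  then show ?case
    using subfieldD(2)[OF assms(1)] by (simp add: onL_def)
next
  case (Suc n)
  then show ?case
    using assms by (simp add: mult_Suc onL_add)
qed

lemma horizontal_add:
  assumes P: "P \<in> aff" and Q: "Q \<in> aff" and y: "py Q = py P" and ne: "px P \<noteq> px Q"
  shows "P \<boxplus> Q = Affine (- a2 - px P - px Q) (- a1 * (- a2 - px P - px Q) - py P - a3)"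
  using assms by (auto elim!: affE simp: Let_def)

text \<open>For equal ordinates, two successive difference quotients of the cubic give that the
  abscissas sum to -a_2, and this is the abscissa produced by a chord of slope 0.\<close>

lemma horizontal_triple:
  assumes P: "P \<in> aff" and Q: "Q \<in> aff" and R: "R \<in> aff" and y: "py Q = py P" "py R = py P"
    and ne: "px P \<noteq> px Q" "px P \<noteq> px R" "px Q \<noteq> px R"
  shows "P \<boxplus> Q = neg R"
proof -
  have "(px P - px Q) * (px P ^ 2 + px P * px Q + px Q ^ 2 + a2 * (px P + px Q) + a4 - a1 * py P) = 0"
    using curve_eqn[OF P] curve_eqn[OF Q] unfolding y by Groebner_Basis.algebra
  then have 1: "px P ^ 2 + px P * px Q + px Q ^ 2 + a2 * (px P + px Q) + a4 - a1 * py P = 0"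
    using ne by simp
  have "(px P - px R) * (px P ^ 2 + px P * px R + px R ^ 2 + a2 * (px P + px R) + a4 - a1 * py P) = 0"
    using curve_eqn[OF P] curve_eqn[OF R] unfolding y by Groebner_Basis.algebra
  then have 2: "px P ^ 2 + px P * px R + px R ^ 2 + a2 * (px P + px R) + a4 - a1 * py P = 0"
    using ne by simp
  have "(px Q - px R) * (px P + px Q + px R + a2) = 0"
    using 1 2 by Groebner_Basis.algebra
  then have "px P + px Q + px R + a2 = 0"
    using ne by simp
  then have r: "- a2 - px P - px Q = px R"
    by Groebner_Basis.algebra
  obtain x y' where "R = Affine x y'"
    using R by (auto elim: affE)
  then show ?thesis
    using y unfolding horizontal_add[OF P Q y(1) ne(1)] r by (simp add: algebra_simps)
qed

lemma neg_eq_self: "P \<in> points E \<Longrightarrow> neg P = P \<Longrightarrow> ec_mult E 2 P = Infinity"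
  using padd_neg[of P] by (simp add: numeral_2_eq_2 mult_Suc)

end

section \<open>Automorphisms acting on a basis of the torsion\<close>

locale ell_basis = ell_tor E m for E :: "'k::alg_closed_field weierstrass" and m +
  fixes P1 P2 :: "'k ec_point"
  assumes basis: "torsion_basis E m P1 P2" and m4: "m \<ge> 4"
begin

lemma P12_tor [simp]: "P1 \<in> torsion E m" "P2 \<in> torsion E m"
  using basis by (simp_all add: torsion_basis_def)

lemma P12_points [simp]: "P1 \<in> points E" "P2 \<in> points E"
  by simp_all

lemma basis_surj:
  assumes "Q \<in> torsion E m"
  obtains a b where "a < m" "b < m" "Q = ec_mult E a P1 \<boxplus> ec_mult E b P2"
proof -
  have "torsion E m = (\<lambda>(a, b). ec_mult E a P1 \<boxplus> ec_mult E b P2) ` ({..<m} \<times> {..<m})"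
    using basis unfolding torsion_basis_def bij_betw_def by simp
  with assms show thesis
    using that by auto
qed

lemma mult_mod:
  assumes "Q \<in> torsion E m"
  shows "ec_mult E n Q = ec_mult E (n mod m) Q"
proof -
  have Q: "Q \<in> points E" "mu Q = Infinity"
    using assms by (simp_all add: tor_iff)
  have "ec_mult E (n div m * m + n mod m) Q = ec_mult E (n div m) (mu Q) \<boxplus> ec_mult E (n mod m) Q"
    using Q(1) by (simp only: mult_add mult_mult)
  then show ?thesis
    using Q by simp
qed

lemma basis_indep:
  assumes "ec_mult E i P1 \<boxplus> ec_mult E j P2 = Infinity"
  shows "m dvd i" "m dvd j"
proof -
  have inj: "inj_on (\<lambda>(a, b). ec_mult E a P1 \<boxplus> ec_mult E b P2) ({..<m} \<times> {..<m})"
    using basis unfolding torsion_basis_def bij_betw_def by simp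
  have "ec_mult E (i mod m) P1 \<boxplus> ec_mult E (j mod m) P2 = ec_mult E 0 P1 \<boxplus> ec_mult E 0 P2"
    using assms mult_mod[of P1 i] mult_mod[of P2 j] by simp
  then have "(i mod m, j mod m) = (0, 0)"
    using m4 by (intro inj_onD[OF inj]) auto
  then show "m dvd i" "m dvd j"
    by auto
qed

lemma mult_P1_eq: "ec_mult E i P1 = Infinity \<Longrightarrow> m dvd i"
  using basis_indep(1)[of i 0] by simp

lemma mult_P2_eq: "ec_mult E j P2 = Infinity \<Longrightarrow> m dvd j"
  using basis_indep(2)[of 0 j] by simp

lemma P12_aff [simp]: "P1 \<in> aff" "P2 \<in> aff"
proof -
  have "P1 \<noteq> Infinity"
    using mult_P1_eq[of 1] m4 by auto
  moreover have "P2 \<noteq> Infinity"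
    using mult_P2_eq[of 1] m4 by auto
  ultimately show "P1 \<in> aff" "P2 \<in> aff"
    using not_aff_iff P12_points by blast+
qed

lemma P12_not_neg: "neg P1 \<noteq> P1" "neg P2 \<noteq> P2"
proof -
  have "\<not> m dvd 2"
    using m4 by (auto dest: dvd_imp_le)
  then show "neg P1 \<noteq> P1" "neg P2 \<noteq> P2"
    using neg_eq_self[of P1] neg_eq_self[of P2] mult_P1_eq[of 2] mult_P2_eq[of 2] by auto
qed

definition zeta :: 'k where "zeta = ep P1 P2"

lemma zeta_order: "zeta ^ d = 1 \<Longrightarrow> m dvd d"
  using ep_basis_order[OF basis] mult_P2_eq by (simp add: zeta_def)

lemma sp_P1:
  assumes s: "adm \<sigma>" and x: "\<sigma> (px P1) = px P1"
  shows "sp \<sigma> P1 = P1 \<or> sp \<sigma> P1 = neg P1"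
  using same_px[of P1 "sp \<sigma> P1"] s x by (simp add: px_sp adm_aut)

text \<open>Pairing \<sigma> P_1 = P_1 with \<sigma> P_2 gives zeta = zeta^b; as zeta has exact
  order m and b < m, the coefficient of P_2 is 1.\<close>

lemma sp_P2_pos:
  assumes s: "adm \<sigma>" and P1: "sp \<sigma> P1 = P1" and z: "\<sigma> zeta = zeta"
  obtains a where "a < m" "sp \<sigma> P2 = ec_mult E a P1 \<boxplus> P2"
proof -
  have "sp \<sigma> P2 \<in> torsion E m"
    using s by simp
  then obtain a b where ab: "a < m" "b < m" "sp \<sigma> P2 = ec_mult E a P1 \<boxplus> ec_mult E b P2"
    by (rule basis_surj)
  have "zeta = ep (sp \<sigma> P1) (sp \<sigma> P2)"
    using ep_equivariant[OF s, of P1 P2] z by (simp add: zeta_def)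
  also have "\<dots> = zeta ^ b"
    unfolding P1 ab(3) by (simp add: ep_add_right ep_mult_right ep_self zeta_def)
  finally have eq: "zeta = zeta ^ b" .
  have nz: "zeta \<noteq> 0"
    by (simp add: zeta_def ep_nonzero)
  have "b \<noteq> 0"
  proof
    assume "b = 0"
    then have "zeta ^ 1 = 1"
      using eq by simp
    from zeta_order[OF this] show False
      using m4 by simp
  qed
  then obtain c where c: "b = Suc c"
    using not0_implies_Suc by blast
  have "zeta ^ c = 1"
    using eq nz by (simp add: c)
  from zeta_order[OF this] have "c = 0"
    using ab(2) c by (auto dest: dvd_imp_le)
  then show thesis
    using that ab c by simp
qed

text \<open>Now the pairing gives zeta^(b + 1) = 1 with b < m, so b = m - 1 and the coefficient of
  P_2 acts as -1.\<close>

lemma sp_P2_neg: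
  assumes s: "adm \<sigma>" and P1: "sp \<sigma> P1 = neg P1" and z: "\<sigma> zeta = zeta"
  obtains a where "a < m" "sp \<sigma> P2 = ec_mult E a P1 \<boxplus> neg P2"
proof -
  have "sp \<sigma> P2 \<in> torsion E m"
    using s by simp
  then obtain a b where ab: "a < m" "b < m" "sp \<sigma> P2 = ec_mult E a P1 \<boxplus> ec_mult E b P2"
    by (rule basis_surj)
  have "zeta = ep (sp \<sigma> P1) (sp \<sigma> P2)"
    using ep_equivariant[OF s, of P1 P2] z by (simp add: zeta_def)
  also have "\<dots> = ep (neg P1) P1 ^ a * ep (neg P1) P2 ^ b"
    unfolding P1 ab(3) by (simp add: ep_add_right ep_mult_right)
  also have "ep (neg P1) P1 = 1"
    using ep_neg_left[of P1 P1] ep_self[of P1] by simp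
  finally have "zeta * zeta ^ b = (ep (neg P1) P2 * zeta) ^ b"
    by (simp add: power_mult_distrib)
  also have "ep (neg P1) P2 * zeta = 1"
    using ep_neg_left[of P1 P2] by (simp add: zeta_def)
  finally have "zeta ^ Suc b = 1"
    by simp
  from zeta_order[OF this] have "Suc b = m"
    using ab(2) by (auto dest: dvd_imp_le)
  then have "P2 \<boxplus> ec_mult E b P2 = Infinity"
    using P12_tor(2) by (metis mult_Suc tor_iff)
  then have "ec_mult E b P2 = neg P2"
    using ec_add_eq_Infinity[of P2 "ec_mult E b P2"] by simp
  then show thesis
    using that ab by simp
qed

lemma sp_sp_comp: "sp \<sigma> (sp \<tau> P) = sp (\<lambda>x. \<sigma> (\<tau> x)) P"
  by (cases P) auto

lemma adm_comp: "adm \<sigma> \<Longrightarrow> adm \<tau> \<Longrightarrow> adm (\<lambda>x. \<sigma> (\<tau> x))"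
  by (simp add: adm_def field_aut_comp)

lemma double_P1:
  assumes "odd m" "ec_mult E a P1 \<boxplus> ec_mult E a P1 = Infinity"
  shows "ec_mult E a P1 = Infinity"
proof -
  have "ec_mult E (a + a) P1 = Infinity"
    using assms(2) by (simp add: mult_add)
  then have "m dvd 2 * a"
    using mult_P1_eq[of "a + a"] by (simp add: mult_2)
  then have "m dvd a"
    using assms(1) by (simp add: coprime_dvd_mult_right_iff)
  then show ?thesis
    using mult_mod[of P1 a] by simp
qed

lemma odd_pos_fixes:
  assumes odd: "odd m" and s: "adm \<sigma>" and P1: "sp \<sigma> P1 = P1"
    and z: "\<sigma> zeta = zeta" and y: "\<sigma> (py P2) = py P2"
  shows "sp \<sigma> P2 = P2"
proof -
  obtain a where a: "a < m" "sp \<sigma> P2 = ec_mult E a P1 \<boxplus> P2"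
    by (rule sp_P2_pos[OF s P1 z])
  define A where "A = ec_mult E a P1"
  have A: "A \<in> points E" "sp \<sigma> A = A"
    by (simp_all add: A_def sp_mult[OF s] P1)
  have "A = Infinity"
  proof (rule ccontr)
    assume A0: "A \<noteq> Infinity"
    \<comment> \<open>The three points P_2, P_2 + A, P_2 + 2 A are distinct only if also 2 A is not
      O; this is where \<open>m\<close> odd is used.\<close>
    then have AA: "A \<boxplus> A \<noteq> Infinity"
      using double_P1[OF odd] by (auto simp: A_def)
    define Q where "Q = sp \<sigma> P2"
    define R where "R = sp \<sigma> Q"
    have QR: "Q \<in> aff" "R \<in> aff"
      using s by (simp_all add: Q_def R_def)
    have Q: "Q = A \<boxplus> P2"
      using a by (simp add: Q_def A_def)
    have R: "R = A \<boxplus> (A \<boxplus> P2)"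
      unfolding R_def Q using A s by (simp add: sp_add a(2) flip: A_def)
    have yQR: "py Q = py P2" "py R = py P2"
      using y adm_aut[OF s] by (simp_all add: Q_def R_def py_sp)
    have inj: "U = Infinity" if "U \<boxplus> V = V" "U \<in> points E" "V \<in> points E" for U V
      using padd_right_inj[of U Infinity V] that by simp
    have 1: "px P2 \<noteq> px Q"
      using aff_eqI[of P2 Q] QR yQR inj[of A P2] A A0 Q by auto
    have 2: "px P2 \<noteq> px R"
      using aff_eqI[of P2 R] QR yQR inj[of "A \<boxplus> A" P2] A AA R by (auto simp: ec_add_assoc)
    have 3: "px Q \<noteq> px R"
      using aff_eqI[of Q R] QR yQR inj[of A "A \<boxplus> P2"] A A0 Q R by auto
    have "P2 \<boxplus> Q = neg R"
      by (rule horizontal_triple) (use QR yQR 1 2 3 in auto)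
    then have "P2 \<boxplus> Q \<boxplus> R = Infinity"
      using QR by simp
    then have "(A \<boxplus> (A \<boxplus> A)) \<boxplus> (P2 \<boxplus> (P2 \<boxplus> P2)) = Infinity"
      unfolding Q R using A by (simp add: padd_ac)
    moreover have "A \<boxplus> (A \<boxplus> A) = ec_mult E (a + (a + a)) P1"
      by (simp add: A_def mult_add)
    moreover have "P2 \<boxplus> (P2 \<boxplus> P2) = ec_mult E 3 P2"
      by (simp add: numeral_3_eq_3 mult_Suc)
    ultimately have "m dvd 3"
      using basis_indep(2)[of "a + (a + a)" 3] by simp
    then show False
      using m4 by (auto dest: dvd_imp_le)
  qed
  then show ?thesis
    using a by (simp add: A_def)
qed

lemma odd_fixes:
  assumes odd: "odd m" and s: "adm \<sigma>" and x: "\<sigma> (px P1) = px P1"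
    and z: "\<sigma> zeta = zeta" and y: "\<sigma> (py P2) = py P2"
  shows "sp \<sigma> P1 = P1" "sp \<sigma> P2 = P2"
proof -
  have "sp \<sigma> P1 \<noteq> neg P1"
  proof
    assume P1: "sp \<sigma> P1 = neg P1"
    obtain a where a: "a < m" "sp \<sigma> P2 = ec_mult E a P1 \<boxplus> neg P2"
      by (rule sp_P2_neg[OF s P1 z])
    define A where "A = ec_mult E a P1"
    have A: "A \<in> points E" "sp \<sigma> A = neg A"
      by (simp_all add: A_def sp_mult[OF s] P1 mult_neg)
    let ?t = "\<lambda>x. \<sigma> (\<sigma> x)"
    \<comment> \<open>The square of \<sigma> fixes P_1, so the case of positive sign applies to
      it.\<close>
    have "sp ?t P2 = P2"
      by (rule odd_pos_fixes[OF odd adm_comp[OF s s]])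
        (use z y P1 s in \<open>simp_all add: sp_neg flip: sp_sp_comp\<close>)
    then have "sp \<sigma> (sp \<sigma> P2) = P2"
      by (simp add: sp_sp_comp)
    then have "neg A \<boxplus> neg (A \<boxplus> neg P2) = P2"
      using A s by (simp add: a(2) sp_add sp_neg flip: A_def)
    then have "neg (A \<boxplus> A) \<boxplus> P2 = Infinity \<boxplus> P2"
      using A by (simp add: neg_add ec_add_assoc)
    then have "neg (A \<boxplus> A) = Infinity"
      using padd_right_inj[of "neg (A \<boxplus> A)" Infinity P2] A by simp
    then have "A \<boxplus> A = Infinity"
      by (metis neg_neg neg_simps(1))
    then have "A = Infinity"
      using double_P1[OF odd] by (simp add: A_def)
    then have eq: "sp \<sigma> P2 = neg P2"
      using a(2) by (simp add: A_def)
    have "py (neg P2) = py P2"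
      using y adm_aut[OF s] unfolding eq[symmetric] by (simp add: py_sp)
    then have "neg P2 = P2"
      by (intro aff_eqI) simp_all
    then show False
      using P12_not_neg by simp
  qed
  then show 1: "sp \<sigma> P1 = P1"
    using sp_P1[OF s x] by blast
  show "sp \<sigma> P2 = P2"
    by (rule odd_pos_fixes[OF odd s 1 z y])
qed

text \<open>The assumption \<open>two\<close> isolates what the even case takes from the generators
  of the torsion field. Under negative sign it makes A = a P_1 a point with 2 A = O and P_2 +
  \<sigma> P_2 = A, and both positions of \<sigma> P_2 are refuted.\<close>

lemma fixes_py1:
  assumes s: "adm \<sigma>" and x: "\<sigma> (px P1) = px P1" and z: "\<sigma> zeta = zeta" and y: "\<sigma> (py P2) = py P2"
    and a1: "a1 = 0"
    and two: "sp \<sigma> (sp \<sigma> P1) = P1 \<Longrightarrow> sp \<sigma> (sp \<sigma> P2) = P2"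
  shows "sp \<sigma> P1 = P1"
proof -
  have "sp \<sigma> P1 \<noteq> neg P1"
  proof
    assume P1: "sp \<sigma> P1 = neg P1"
    obtain a where a: "a < m" "sp \<sigma> P2 = ec_mult E a P1 \<boxplus> neg P2"
      by (rule sp_P2_neg[OF s P1 z])
    define A where "A = ec_mult E a P1"
    define Q where "Q = sp \<sigma> P2"
    have A: "A \<in> points E" "sp \<sigma> A = neg A"
      by (simp_all add: A_def sp_mult[OF s] P1 mult_neg)
    have "Q = A \<boxplus> neg P2"
      using a by (simp add: Q_def A_def)
    moreover have "Q \<in> aff" "py Q = py P2"
      using s y by (simp_all add: Q_def py_sp adm_aut)
    ultimately have Q: "Q = A \<boxplus> neg P2" "Q \<in> aff" "py Q = py P2"
      by simp_all
    have "sp \<sigma> (sp \<sigma> P2) = P2"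
      by (rule two) (simp add: P1 sp_neg s)
    then have "neg A \<boxplus> neg (A \<boxplus> neg P2) = P2"
      using A s by (simp add: a(2) sp_add sp_neg flip: A_def)
    then have "neg (A \<boxplus> A) \<boxplus> P2 = Infinity \<boxplus> P2"
      using A by (simp add: neg_add ec_add_assoc)
    then have "neg (A \<boxplus> A) = Infinity"
      using padd_right_inj[of "neg (A \<boxplus> A)" Infinity P2] A by simp
    then have AA: "A \<boxplus> A = Infinity"
      by (metis neg_neg neg_simps(1))
    have PQ: "P2 \<boxplus> Q = A"
      unfolding Q using A by (simp add: padd_ac)
    show False
    proof (cases "px P2 = px Q")
      case True
      then have "Q = P2"
        using Q by (intro aff_eqI) simp_all
      then have A2: "A = ec_mult E 2 P2"
        using PQ by (simp add: numeral_2_eq_2 mult_Suc)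
      \<comment> \<open>On torsion points \<open>m - 2\<close> stands for the coefficient -2, as
        multiples are natural: a P_1 = 2 P_2 becomes a relation whose second coefficient
        \<open>m\<close> would have to divide.\<close>
      have "m - 2 + 2 = m"
        using m4 by simp
      then have "ec_mult E (m - 2 + 2) P2 = Infinity"
        using P12_tor(2) by (simp only: tor_iff)
      then have "ec_mult E a P1 \<boxplus> ec_mult E (m - 2) P2 = Infinity"
        unfolding A_def[symmetric] A2 by (simp only: mult_add P12_points ec_add_commute mult_closed)
      then have "m dvd m - 2"
        by (rule basis_indep)
      then show False
        using m4 by (auto dest: dvd_imp_le)
    next
      case False
      have eq: "A = Affine (- a2 - px P2 - px Q) (- a1 * (- a2 - px P2 - px Q) - py P2 - a3)"
        using horizontal_add[OF P12_aff(2) Q(2,3) False] PQ by simp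
      have "neg A = A"
        using AA ec_add_eq_Infinity[of A A] A by simp
      then have "- (- a1 * (- a2 - px P2 - px Q) - py P2 - a3) - a1 * (- a2 - px P2 - px Q) - a3 =
          - a1 * (- a2 - px P2 - px Q) - py P2 - a3"
        unfolding eq neg_simps by (simp only: ec_point.inject)
      \<comment> \<open>With a_1 = 0 the condition A = -A involves only the ordinate, which A shares
        with P_2 by the horizontal chord; so it says 2 P_2 = O.\<close>
      then have "2 * py P2 + a3 = 0"
        unfolding a1 by Groebner_Basis.algebra
      then have "dy P2 = 0"
        by (simp add: dy_def a1)
      then have "neg P2 = P2"
        using neg_eq_iff[of P2] by simp
      then show False
        using P12_not_neg by simp
    qed
  qed
  then show ?thesis
    using sp_P1[OF s x] by blast
qed

section \<open>Descent to the base field L\<close>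

context
  fixes L
  assumes L: "is_subfield L" and alg: "alg_over L"
    and a_L: "a1 \<in> L" "a2 \<in> L" "a3 \<in> L" "a4 \<in> L" "a6 \<in> L"
begin

lemma adm_L: "field_aut \<sigma> \<Longrightarrow> \<forall>x\<in>L. \<sigma> x = x \<Longrightarrow> adm \<sigma>"
  using a_L by (simp add: adm_def)

text \<open>The ordinate y_1 is a root of a quadratic over L whose derivative there is
  \<open>dy P1\<close>, nonzero because 2 P_1 is not O. So y_1 is separable over L.\<close>

lemma py1_in_L:
  assumes x: "px P1 \<in> L" and fixed: "\<forall>\<sigma>. field_aut \<sigma> \<longrightarrow> (\<forall>x\<in>L. \<sigma> x = x) \<longrightarrow> \<sigma> (py P1) = py P1"
  shows "py P1 \<in> L"
proof (rule fixed_separable[OF L alg fixed])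
  let ?q = "[:- (px P1 ^ 3 + a2 * px P1 ^ 2 + a4 * px P1 + a6), a1 * px P1 + a3, 1:]"
  show "pol L ?q"
    using x a_L by (auto intro!: subfieldD[OF L] pol_0[OF L])
  show "poly ?q (py P1) = 0"
    using curve_eqn[OF P12_aff(1)] by (simp add: algebra_simps power2_eq_square)
  have "poly (pderiv ?q) (py P1) = dy P1"
    by (simp add: pderiv_pCons dy_def algebra_simps)
  then show "poly (pderiv ?q) (py P1) \<noteq> 0"
    using P12_not_neg(1) neg_eq_iff[OF P12_aff(1)] by simp
qed

text \<open>The pairing is defined through functions over the closure, so its rationality is
  obtained from Galois equivariance; T^m - 1 has simple roots because m is nonzero in the
  field.\<close>

lemma zeta_in_L:
  assumes on: "onL L P1" "onL L P2" and m: "of_nat m \<noteq> (0::'k)"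
  shows "zeta \<in> L"
proof (rule fixed_separable[OF L alg])
  show "\<forall>\<sigma>. field_aut \<sigma> \<longrightarrow> (\<forall>x\<in>L. \<sigma> x = x) \<longrightarrow> \<sigma> zeta = zeta"
  proof (intro allI impI)
    fix \<sigma> assume s: "field_aut \<sigma>" "\<forall>x\<in>L. \<sigma> x = x"
    have "sp \<sigma> P1 = P1" "sp \<sigma> P2 = P2"
      using on s Affine_px_py[OF P12_aff(1)] Affine_px_py[OF P12_aff(2)]
      by (metis ec_point.map(2) onL_def)+
    then show "\<sigma> zeta = zeta"
      using ep_equivariant[OF adm_L[OF s], of P1 P2] by (simp add: zeta_def)
  qed
  let ?q = "Polynomial.monom 1 m - [:1:] :: 'k poly"
  show "pol L ?q"
    unfolding pol_def by (auto simp: coeff_pCons split: nat.split intro!: subfieldD[OF L])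
  have one: "zeta ^ m = 1"
    using ep_mult_left[of P1 P2 m] ep_mult_left[of P1 P2 0] P12_tor by (simp add: zeta_def tor_iff)
  then show "poly ?q zeta = 0"
    by (simp add: poly_monom)
  have "zeta \<noteq> 0"
    by (simp add: zeta_def ep_nonzero)
  then show "poly (pderiv ?q) zeta \<noteq> 0"
    using m by (simp add: pderiv_diff pderiv_monom pderiv_pCons poly_monom)
qed

text \<open>If \<open>x\<^sub>2\<close> were inseparable over \<open>L\<close>, the tangent at \<open>P\<^sub>2\<close> would be horizontal: either \<open>3 P\<^sub>2 = O\<close>, or
  \<open>2 P\<^sub>2\<close>, and with it \<open>P\<^sub>2\<close>, is rational over \<open>L\<close>.\<close>
lemma px2_in_L:
  assumes odd: "odd m" and y: "py P2 \<in> L"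
    and fixed: "\<forall>\<sigma>. field_aut \<sigma> \<longrightarrow> (\<forall>x\<in>L. \<sigma> x = x) \<longrightarrow> \<sigma> (px P2) = px P2"
  shows "px P2 \<in> L"
proof -
  let ?x = "px P2"
  \<comment> \<open>The cubic in x cut out by the horizontal line through P_2. Its coefficients lie
    in L, so (X - x_2)^d divides it and d is at most 3.\<close>
  define q where "q = [:a6 - py P2 ^ 2 - a3 * py P2, a4 - a1 * py P2, a2, 1:]"
  have q: "pol L q" "poly q ?x = 0"
    using y a_L curve_eqn[OF P12_aff(2)]
    by (auto simp: q_def algebra_simps power2_eq_square power3_eq_cube intro!: subfieldD[OF L] pol_0[OF L])
  obtain d where d: "d > 0" "pol L ([:- ?x, 1:] ^ d)" "\<exists>s. pol L s \<and> q = [:- ?x, 1:] ^ d * s"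
    by (rule fixed_minimal_polynomial[OF L alg fixed]) (use q in blast)
  then obtain s where s: "pol L s" "q = [:- ?x, 1:] ^ d * s"
    by blast
  show ?thesis
  proof (cases "d = 1")
    case True
    then have "- ?x \<in> L"
      using d(2) by simp
    from subfieldD(5)[OF L this] show ?thesis by simp
  next
    case False
    then obtain k where k: "d = k + 2"
      using d(1) by (metis Suc_1 Suc_leI add.commute le_Suc_ex le_neq_implies_less One_nat_def)
    define t where "t = [:- ?x, 1:] ^ k * s"
    have qt: "q = [:- ?x, 1:] ^ 2 * t"
      by (simp only: s(2) k t_def power_add mult_ac)
    have "q \<noteq> 0"
      by (simp add: q_def)
    then have t0: "t \<noteq> 0" "s \<noteq> 0"
      using qt s(2) by auto
    have "Polynomial.degree q = 3"
      by (simp add: q_def)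
    moreover have "Polynomial.degree q = 2 + Polynomial.degree t"
      unfolding qt using t0 by (subst degree_mult_eq) (auto simp: degree_power_eq)
    ultimately have "Polynomial.degree t = 1"
      by simp
    then obtain u v where uv: "t = [:u, v:]"
      by (metis degree1_coeffs)
    have c: "q = [:?x ^ 2 * u, ?x ^ 2 * v - 2 * ?x * u, u - 2 * ?x * v, v:]"
      unfolding qt uv by (simp add: power2_eq_square algebra_simps)
    then have v: "v = 1" and u: "u = a2 + 2 * ?x" and lin: "a4 - a1 * py P2 = ?x ^ 2 - 2 * ?x * u"
      unfolding q_def by auto
    have dx0: "dx P2 = 0"
      using lin unfolding u dx_def by Groebner_Basis.algebra
    \<comment> \<open>For d at least 2 the cubic is (X - x_2)^2 (X + u). The double root makes the
      tangent at P_2 horizontal, and -u is the abscissa of its remaining intersection.\<close>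
    have dbl: "P2 \<boxplus> P2 = neg (Affine (- u) (py P2))"
    proof -
      obtain x y where xy: "P2 = Affine x y"
        using Affine_px_py[OF P12_aff(2)] by blast
      have "dy P2 \<noteq> 0"
        using P12_not_neg(2) neg_eq_iff[OF P12_aff(2)] by simp
      then have "y + y + a1 * x + a3 \<noteq> 0"
        unfolding dy_def xy px.simps py.simps mult_2 .
      moreover have "3 * x ^ 2 + 2 * a2 * x + a4 - a1 * y = 0"
        using dx0 by (simp add: dx_def xy)
      ultimately show ?thesis
        unfolding u by (simp add: xy Let_def algebra_simps)
    qed
    have "k = 0 \<or> k = 1"
    proof -
      have "Polynomial.degree t = k + Polynomial.degree s"
        unfolding t_def using t0 by (subst degree_mult_eq) (auto simp: degree_power_eq)
      then show ?thesis
        using \<open>Polynomial.degree t = 1\<close> by auto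
    qed
    then show ?thesis
    proof
      \<comment> \<open>Here d = 2, so the cofactor X + u has coefficients in L and 2 P_2 is
        rational over L.\<close>
      assume "k = 0"
      then have "u \<in> L"
        using s(1) uv by (simp add: t_def)
      then have "onL L (P2 \<boxplus> P2)"
        unfolding dbl onL_def using y a_L by (auto intro!: subfieldD[OF L])
      \<comment> \<open>For odd \<open>m\<close> the number \<open>(m + 1) div 2\<close> inverts 2
        modulo \<open>m\<close>, so this multiple of 2 P_2 is P_2.\<close>
      then have on: "onL L (ec_mult E ((m + 1) div 2) (P2 \<boxplus> P2))"
        by (intro onL_mult L a_L)
      have "P2 \<boxplus> P2 = ec_mult E 2 P2"
        by (simp add: numeral_2_eq_2 mult_Suc)
      then have "ec_mult E ((m + 1) div 2) (P2 \<boxplus> P2) = ec_mult E ((m + 1) div 2 * 2) P2"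
        by (simp only: mult_mult P12_points)
      also have "(m + 1) div 2 * 2 = Suc m"
        using odd by presburger
      also have "ec_mult E (Suc m) P2 = P2"
        using P12_tor(2) by (simp add: mult_Suc tor_iff)
      finally show ?thesis
        using on by (simp add: onL_def)
    next
      \<comment> \<open>Here d = 3: the tangent meets the curve only at P_2, a flex, so 3 P_2 =
        O.\<close>
      assume "k = 1"
      then have "Polynomial.degree s = 0"
        using \<open>Polynomial.degree t = 1\<close> t0 unfolding t_def by (subst (asm) degree_mult_eq) auto
      then obtain e where "s = [:e:]"
        by (metis degree_eq_zeroE)
      then have "u = - ?x * e" "v = e"
        using uv \<open>k = 1\<close> by (auto simp: t_def)
      then have "u = - ?x"
        using v by simp
      then have "P2 \<boxplus> P2 = neg P2"
        unfolding dbl using Affine_px_py[OF P12_aff(2)] by simp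
      then have "ec_mult E 3 P2 = Infinity"
        by (simp add: numeral_3_eq_3 mult_Suc)
      then have "m dvd 3"
        by (rule mult_P2_eq)
      then show ?thesis
        using m4 by (auto dest: dvd_imp_le)
    qed
  qed
qed

lemma odd_in_L:
  assumes odd: "odd m" and x: "px P1 \<in> L" and z: "zeta \<in> L" and y: "py P2 \<in> L"
  shows "py P1 \<in> L" "px P2 \<in> L"
proof -
  have *: "sp \<sigma> P1 = P1" "sp \<sigma> P2 = P2" if "field_aut \<sigma>" "\<forall>x\<in>L. \<sigma> x = x" for \<sigma>
    using odd_fixes[OF odd adm_L[OF that]] that(2) x y z by auto
  show "py P1 \<in> L"
    by (rule py1_in_L[OF x]) (use * py_sp in metis)
  show "px P2 \<in> L"
    by (rule px2_in_L[OF odd y]) (use * px_sp in metis)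
qed

text \<open>The premise \<open>gen\<close> is applied to the square of \<sigma>, which fixes y_1
  under either sign; it thus fixes x_2 and hence P_2, as \<open>fixes_py1\<close> requires.\<close>

lemma even_in_L:
  assumes a1: "a1 = 0" and x: "px P1 \<in> L" and z: "zeta \<in> L" and y: "py P2 \<in> L"
    and gen: "\<And>\<sigma>. field_aut \<sigma> \<Longrightarrow> \<forall>x\<in>L. \<sigma> x = x \<Longrightarrow> \<sigma> (py P1) = py P1 \<Longrightarrow> \<sigma> (px P2) = px P2"
  shows "py P1 \<in> L"
proof (rule py1_in_L[OF x], intro allI impI)
  fix \<sigma> assume s: "field_aut \<sigma>" "\<forall>x\<in>L. \<sigma> x = x"
  have adm: "adm \<sigma>"
    by (rule adm_L[OF s])
  have "sp \<sigma> P1 = P1"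
  proof (rule fixes_py1[OF adm _ _ _ a1])
    show "\<sigma> (px P1) = px P1" "\<sigma> zeta = zeta" "\<sigma> (py P2) = py P2"
      using s(2) x y z by auto
    assume P1: "sp \<sigma> (sp \<sigma> P1) = P1"
    then have "\<sigma> (\<sigma> (py P1)) = py P1"
      using py_sp[OF s(1)] by metis
    then have "\<sigma> (\<sigma> (px P2)) = px P2"
      using gen[OF field_aut_comp[OF s(1) s(1)]] s(2) by simp
    moreover have "\<sigma> (\<sigma> (py P2)) = py P2"
      using s(2) y by simp
    ultimately show "sp \<sigma> (sp \<sigma> P2) = P2"
      using adm by (intro aff_eqI) (simp_all add: px_sp[OF s(1)] py_sp[OF s(1)])
  qed
  then show "\<sigma> (py P1) = py P1"
    using py_sp[OF s(1)] by metis
qed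

end

end

subsection \<open>Fields generated by torsion points\<close>

lemma type_ring_simps [simp]:
  "carrier (ring_of_type_algebra :: 'k::field ring) = UNIV"
  "monoid.mult (ring_of_type_algebra :: 'k::field ring) = (*)"
  "one (ring_of_type_algebra :: 'k::field ring) = 1"
  "ring.zero (ring_of_type_algebra :: 'k::field ring) = 0"
  "add (ring_of_type_algebra :: 'k::field ring) = (+)"
  by (simp_all add: ring_of_type_algebra_def)

lemma type_ring_a_inv: "\<ominus>\<^bsub>(ring_of_type_algebra :: 'k::field ring)\<^esub> x = - x"
proof -
  interpret field "ring_of_type_algebra :: 'k ring" ..
  show ?thesis
    using minus_equality[of "- x" x] by simp
qed

lemma type_ring_m_inv: "x \<noteq> 0 \<Longrightarrow> inv\<^bsub>(ring_of_type_algebra :: 'k::field ring)\<^esub> x = inverse x"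
proof -
  interpret field "ring_of_type_algebra :: 'k ring" ..
  assume "x \<noteq> 0"
  then show ?thesis
    using inv_unique'[of x "inverse x"] comm_inv_char[of x "inverse x"] by simp
qed

lemma adjoin_subfield: "is_subfield (adjoin A)"
proof -
  have "inverse x \<in> adjoin A" if "x \<in> adjoin A" for x
    using generate_field.m_inv[of x "ring_of_type_algebra :: 'a alg_closure ring" "range to_ac \<union> A"] that
    by (cases "x = 0") (simp_all add: adjoin_def type_ring_m_inv)
  moreover have "- x \<in> adjoin A" if "x \<in> adjoin A" for x
    using generate_field.a_inv[of x "ring_of_type_algebra :: 'a alg_closure ring" "range to_ac \<union> A"] that
    by (simp add: adjoin_def type_ring_a_inv)
  moreover have "x + y \<in> adjoin A" "x * y \<in> adjoin A" if "x \<in> adjoin A" "y \<in> adjoin A" for x y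
    using generate_field.eng_add[of x "ring_of_type_algebra :: 'a alg_closure ring" "range to_ac \<union> A" y]
      generate_field.eng_mult[of x "ring_of_type_algebra :: 'a alg_closure ring" "range to_ac \<union> A" y] that
    by (simp_all add: adjoin_def)
  moreover have "1 \<in> adjoin A"
    using generate_field.one[of "ring_of_type_algebra :: 'a alg_closure ring" "range to_ac \<union> A"]
    by (simp add: adjoin_def)
  ultimately show ?thesis
    unfolding is_subfield_def by auto
qed

lemma adjoin_incl: "range to_ac \<subseteq> adjoin A" "A \<subseteq> adjoin A"
  unfolding adjoin_def by (auto intro: generate_field.incl)

lemma adjoin_least:
  assumes F: "is_subfield F" and "range to_ac \<subseteq> F" "A \<subseteq> F"
  shows "adjoin A \<subseteq> F"
proof
  fix x assume "x \<in> adjoin A"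
  then have "x \<in> generate_field ring_of_type_algebra (range to_ac \<union> A)"
    by (simp add: adjoin_def)
  then show "x \<in> F"
    by induction (use assms(2,3) in \<open>auto simp: type_ring_a_inv type_ring_m_inv intro: subfieldD[OF F]\<close>)
qed

lemma adjoin_alg_over: "alg_over (adjoin A)"
  unfolding alg_over_def
proof
  fix z :: "'a alg_closure"
  obtain p :: "'a poly" where p: "p \<noteq> 0" "poly (map_poly to_ac p) z = 0"
    by (rule alg_closure_algebraic)
  have "pol (adjoin A) (map_poly to_ac p)"
    unfolding pol_def using adjoin_incl(1)[of A] by (auto simp: coeff_map_poly)
  moreover have "map_poly to_ac p \<noteq> 0"
    using p(1) by (simp add: map_poly_eq_0_iff)
  ultimately show "\<exists>p. pol (adjoin A) p \<and> p \<noteq> 0 \<and> poly p z = 0"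
    using p(2) by blast
qed

theorem theorem3p6:
  fixes E :: "'a::field weierstrass"
    and m :: nat
    and x1 y1 x2 y2 \<zeta> :: "'a alg_closure"
  assumes "elliptic_curve E"
    and "m \<ge> 4"
    and "CHAR('a) > 0 \<longrightarrow> coprime m CHAR('a)"
    and "even m \<longrightarrow> wa1 E = 0"
    and "torsion_basis (closure_curve E) m (Affine x1 y1) (Affine x2 y2)"
    and "\<zeta> = weil_pairing (closure_curve E) m (Affine x1 y1) (Affine x2 y2)"
  shows "(torsion_field E m = adjoin {x1, \<zeta>, y1, y2} \<longrightarrow>
            torsion_field E m = adjoin {x1, \<zeta>, y2}) \<and>
         (odd m \<and> m \<ge> 5 \<longrightarrow> torsion_field E m = adjoin {x1, \<zeta>, y2})"
proof -
  let ?E = "closure_curve E" and ?P = "Affine x1 y1" and ?Q = "Affine x2 y2"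
  have wa: "wa1 ?E = to_ac (wa1 E)" "wa2 ?E = to_ac (wa2 E)" "wa3 ?E = to_ac (wa3 E)"
    "wa4 ?E = to_ac (wa4 E)" "wa6 ?E = to_ac (wa6 E)"
    by (simp_all add: weierstrass.map_sel)
  have "discriminant ?E = to_ac (discriminant E)"
    by (simp add: discriminant_def Let_def wa)
  then have disc: "discriminant ?E \<noteq> 0"
    using assms(1) by (simp add: elliptic_curve_def)
  have bij: "bij_betw (\<lambda>(a, b). ec_add ?E (ec_mult ?E a ?P) (ec_mult ?E b ?Q)) ({..<m} \<times> {..<m}) (torsion ?E m)"
    using assms(5) by (simp add: torsion_basis_def)
  then have fin: "finite (torsion ?E m)"
    using bij_betw_finite by blast
  have card: "card (torsion ?E m) = m * m"
    using bij_betw_same_card[OF bij] by simp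
  interpret B: ell_basis ?E m ?P ?Q
    by unfold_locales (use disc fin card assms(2,5) in auto)
  have zeta: "B.zeta = \<zeta>"
    using B.weil_pairing_eq[of ?P ?Q] assms(6) by (simp add: B.zeta_def)
  have coeffs: "wa1 ?E \<in> adjoin A" "wa2 ?E \<in> adjoin A" "wa3 ?E \<in> adjoin A" "wa4 ?E \<in> adjoin A"
    "wa6 ?E \<in> adjoin A" for A
    unfolding wa using adjoin_incl(1)[of A] by auto
  let ?L = "adjoin {x1, \<zeta>, y2}" and ?M = "torsion_field E m"
  have in_L: "x1 \<in> ?L" "\<zeta> \<in> ?L" "y2 \<in> ?L"
    using adjoin_incl(2)[of "{x1, \<zeta>, y2}"] by auto
  have M_coords: "x \<in> ?M" "y \<in> ?M" if "Affine x y \<in> torsion ?E m" for x y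
  proof -
    have "{x, y} \<subseteq> \<Union>{{x, y} |x y. Affine x y \<in> torsion ?E m}"
      using that by blast
    then show "x \<in> ?M" "y \<in> ?M"
      unfolding torsion_field_def using adjoin_incl(2) by blast+
  qed
  \<comment> \<open>All torsion points are combinations of the basis, and the addition formulas stay
    inside any field containing the coefficients and the four coordinates.\<close>
  have M_least: "?M \<subseteq> F" if F: "is_subfield F" "range to_ac \<subseteq> F" and P: "x1 \<in> F" "y1 \<in> F" "x2 \<in> F" "y2 \<in> F" for F
    unfolding torsion_field_def
  proof (rule adjoin_least[OF F])
    have aF: "wa1 ?E \<in> F" "wa2 ?E \<in> F" "wa3 ?E \<in> F" "wa4 ?E \<in> F"
      unfolding wa using F(2) by auto
    have "x \<in> F \<and> y \<in> F" if T: "Affine x y \<in> torsion ?E m" for x y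
    proof -
      obtain a b where ab: "Affine x y = ec_add ?E (ec_mult ?E a ?P) (ec_mult ?E b ?Q)"
        by (rule B.basis_surj[OF T])
      have "B.onL F (Affine x y)"
        unfolding ab using P by (intro B.onL_add B.onL_mult F(1) aF) (simp_all add: B.onL_def)
      then show ?thesis
        by (simp add: B.onL_def)
    qed
    then show "\<Union>{{x, y} |x y. Affine x y \<in> torsion ?E m} \<subseteq> F"
      by blast
  qed
  have M_field: "is_subfield ?M" "range to_ac \<subseteq> ?M" "alg_over ?M"
    unfolding torsion_field_def using adjoin_subfield adjoin_incl(1) adjoin_alg_over by blast+
  have P_M: "x1 \<in> ?M" "y1 \<in> ?M" "x2 \<in> ?M" "y2 \<in> ?M"
    using M_coords B.P12_tor by blast+
  have odd_case: "?M = ?L" if odd: "odd m"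
  proof
    have "y1 \<in> ?L" "x2 \<in> ?L"
      using B.odd_in_L[OF adjoin_subfield adjoin_alg_over coeffs odd, of "{x1, \<zeta>, y2}"] in_L zeta by simp_all
    then show "?M \<subseteq> ?L"
      using in_L by (intro M_least adjoin_subfield adjoin_incl(1))
    \<comment> \<open>A characteristic dividing m would be positive, hence coprime to m, hence 1,
      which no field has. This feeds the separability of zeta over the torsion field.\<close>
    have "of_nat m \<noteq> (0 :: 'a)"
    proof
      assume "of_nat m = (0 :: 'a)"
      then have dvd: "CHAR('a) dvd m"
        by (simp add: of_nat_eq_0_iff_char_dvd)
      then have "CHAR('a) > 0"
        using assms(2) by (auto intro: gr0I)
      then have "CHAR('a) = 1"
        using assms(3) dvd coprime_common_divisor_nat[of m "CHAR('a)" "CHAR('a)"] by simp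
      then show False
        by simp
    qed
    then have "of_nat m \<noteq> (0 :: 'a alg_closure)"
      by (metis to_ac_eq_0_iff to_ac_of_nat)
    then have "\<zeta> \<in> ?M"
      using B.zeta_in_L[OF M_field(1,3)] M_field(2) P_M zeta unfolding wa B.onL_def by (simp add: image_subset_iff)
    then show "?L \<subseteq> ?M"
      using P_M by (intro adjoin_least M_field) simp
  qed
  have even_case: "?M = ?L" if even: "even m" and gen: "?M = adjoin {x1, \<zeta>, y1, y2}"
  proof
    have a1: "wa1 ?E = 0"
      using assms(4) even by (simp add: wa)
    \<comment> \<open>The fixed field of \<sigma> contains all generators of the torsion field given
      by the hypothesis, hence also x_2.\<close>
    have fixed: "\<sigma> x2 = x2" if s: "field_aut \<sigma>" "\<forall>x\<in>?L. \<sigma> x = x" "\<sigma> y1 = y1" for \<sigma>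
    proof -
      let ?F = "{x. \<sigma> x = x}"
      have "is_subfield ?F"
        unfolding is_subfield_def by (simp add: field_autD[OF s(1)])
      moreover have "range to_ac \<subseteq> ?F"
        using s(2) adjoin_incl(1) by fastforce
      moreover have "{x1, \<zeta>, y1, y2} \<subseteq> ?F"
        using s in_L by auto
      ultimately have "?M \<subseteq> ?F"
        unfolding gen by (rule adjoin_least)
      then show ?thesis
        using P_M by auto
    qed
    have "y1 \<in> ?L"
      using B.even_in_L[OF adjoin_subfield adjoin_alg_over coeffs a1, of "{x1, \<zeta>, y2}"] in_L fixed zeta by simp
    then show "?M \<subseteq> ?L"
      unfolding gen using in_L by (intro adjoin_least adjoin_subfield adjoin_incl(1)) simp
    show "?L \<subseteq> ?M"
      unfolding gen using adjoin_incl(2)[of "{x1, \<zeta>, y1, y2}"]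
      by (intro adjoin_least adjoin_subfield adjoin_incl(1)) simp
  qed
  show ?thesis
    using odd_case even_case by blast
qed

end
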